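(* Let $(M,g,\Phi)$ be a ${\rm Spin}(7)$-structure on an $8$-dimensional Riemannian manifold, with Lee form $\theta$. Let $s$ be the scalar curvature of the Levi-Civita connection and $s^{{\rm Spin}(7)}$ the scalar curvature of the minimal ${\rm Spin}(7)$-connection $\nabla^{{\rm Spin}(7)}$. Then $$7\,{\rm div}\,\theta^{\sharp}=8\left(s^{{\rm Spin}(7)}-s\right)+\frac{21}{8}|\theta|^2-\frac{1}{2}|(\delta\Phi)_{48}|^2,$$ $$\frac{7}{2}\,{\rm div}\,\theta^{\sharp}=-s+\frac{21}{8}|\theta|^2-\frac{1}{2}|(\delta\Phi)_{48}|^2.$$
   Context: A ${\rm Spin}(7)$-structure on an $8$-dimensional Riemannian manifold $(M,g)$ is a global $4$-form $\Phi$ such that around each point there is a local orthonormal frame $e_0,\dots,e_7$ with dual coframe $e^0,\dots,e^7$ in which (writing $e^{ijkl}=e^i\wedge e^j\wedge e^k\wedge e^l$) $$\Phi=e^{0123}-e^{0145}-e^{0167}-e^{0246}+e^{0257}-e^{0347}-e^{0356}+e^{4567}-e^{2367}-e^{2345}-e^{1357}+e^{1346}-e^{1256}-e^{1247}.$$ $M$ is oriented by $e^{01234567}$, $\star$ is the Hodge star, $\star\Phi=\Phi$, and $\delta\Phi=-\star d\star\Phi$ is the codifferential. ${\rm Spin}(7)\subset SO(8)$ is the stabilizer of $\Phi$. Pointwise ${\rm Spin}(7)$-decompositions: $\Lambda^2=\Lambda^2_7\oplus\Lambda^2_{21}$ with $\Lambda^2_7=\{\omega:\star(\Phi\wedge\omega)=3\omega\}$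 and $\Lambda^2_{21}=\{\omega:\star(\Phi\wedge\omega)=-\omega\}$; $\Lambda^3=\Lambda^3_8\oplus\Lambda^3_{48}$ with $\Lambda^3_8=\{\star(\Phi\wedge\eta):\eta\in\Lambda^1\}$ and $\Lambda^3_{48}=\{\gamma:\Phi\wedge\gamma=0\}$; $(\delta\Phi)_{48}$ is the $\Lambda^3_{48}$-component of $\delta\Phi$. Norms of forms are those for which the $e^{i_1\dots i_k}$, $i_1<\dots<i_k$, are orthonormal. Lee form: $\theta=\frac{1}{7}\star(\delta\Phi\wedge\Phi)$; $\theta^\sharp$ is the dual vector field, and ${\rm div}\,V=\sum_i g(\nabla_{e_i}V,e_i)$ with $\nabla$ the Levi-Civita connection. Skew endomorphisms $A$ of $TM$ are identified with $2$-forms via $(Y,Z)\mapsto g(AY,Z)$; with this identification $\mathfrak{so}(8)=\mathfrak{spin}(7)\oplus\mathfrak{spin}(7)^{\perp}$ corresponds to $\Lambda^2=\Lambda^2_{21}\oplus\Lambda^2_7$. The minimal ${\rm Spin}(7)$-connection $\nabla^{{\rm Spin}(7)}$ is the connection given by the $\mathfrak{spin}(7)$-component of the Levi-Civita connection form; equivalently, it is the unique metric connection with $\nabla^{{\rm Spin}(7)}\Phi=0$ such that $\xi=\nabla^{{\rm Spin}(7)}-\nabla$ satisfies $\xi_X\in\Lambda^2_7$ for all $X$. Scalar curvatures are $s=\sum_{i,j}g(R(e_i,e_j)e_j,e_i)$ and $s^{{\rm Spin}(7)}=\sum_{i,j}g(R^{{\rm Spin}(7)}(e_i,e_j)e_j,e_i)$,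 where $R$, $R^{{\rm Spin}(7)}$ are the curvature tensors of $\nabla$, $\nabla^{{\rm Spin}(7)}$, with $R(X,Y)=[\nabla_X,\nabla_Y]-\nabla_{[X,Y]}$ (and analogously for $R^{{\rm Spin}(7)}$). *)

theory Defs
  imports "HOL-Analysis.Analysis"
begin

section \<open>Smooth manifolds\<close>

text \<open>On an open set \<open>S\<close> of a finite-dimensional space, \<open>ck_on n S f\<close> says that \<open>f\<close> is of class
  \<open>C\<^sup>n\<close> (for \<open>n \<ge> 1\<close>: differentiable with all directional derivatives of class \<open>C\<^sup>n\<^sup>-\<^sup>1\<close>).\<close>

fun ck_on :: "nat \<Rightarrow> 'a::real_normed_vector set \<Rightarrow> ('a \<Rightarrow> 'b::real_normed_vector) \<Rightarrow> bool" where
  "ck_on 0 S f \<longleftrightarrow> continuous_on S f"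
| "ck_on (Suc n) S f \<longleftrightarrow>
     f differentiable_on S \<and> (\<forall>v. ck_on n S (\<lambda>x. frechet_derivative f (at x) v))"

definition smooth_on :: "'a::real_normed_vector set \<Rightarrow> ('a \<Rightarrow> 'b::real_normed_vector) \<Rightarrow> bool" where
  "smooth_on S f \<longleftrightarrow> (\<forall>n. ck_on n S f)"

text \<open>The manifold is the union of the chart domains of an atlas; Hausdorffness and second
  countability come from the type class constraints on the type of points.\<close>

type_synonym 'm chart = "'m set \<times> ('m \<Rightarrow> real ^ 8)"

definition smooth_atlas :: "'m::{t2_space,second_countable_topology} chart set \<Rightarrow> bool" where
  "smooth_atlas A \<longleftrightarrow>
     (\<forall>(U, \<phi>) \<in> A. open U \<and> open (\<phi> ` U) \<and> homeomorphism U (\<phi> ` U) \<phi> (inv_into U \<phi>)) \<and>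
     (\<forall>(U, \<phi>) \<in> A. \<forall>(V, \<psi>) \<in> A. smooth_on (\<phi> ` (U \<inter> V)) (\<psi> \<circ> inv_into U \<phi>))"

definition points :: "'m chart set \<Rightarrow> 'm set" where
  "points A = (\<Union>(U, \<phi>) \<in> A. U)"

definition smooth_fun :: "'m::topological_space chart set \<Rightarrow> 'm set \<Rightarrow> ('m \<Rightarrow> real) \<Rightarrow> bool" where
  "smooth_fun A W f \<longleftrightarrow> open W \<and> W \<subseteq> points A \<and>
     (\<forall>(U, \<phi>) \<in> A. smooth_on (\<phi> ` (U \<inter> W)) (f \<circ> inv_into U \<phi>))"

definition smooth_at :: "'m::topological_space chart set \<Rightarrow> 'm \<Rightarrow> ('m \<Rightarrow> real) \<Rightarrow> bool" where
  "smooth_at A p f \<longleftrightarrow> (\<exists>W. p \<in> W \<and> smooth_fun A W f)"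

text \<open>Tangent vectors are derivations of germs of smooth functions.  A derivation is represented
  by a functional on all functions; it is made unique by demanding the value \<open>0\<close> on functions that
  are not smooth near the point.  The vector space operations are pointwise.\<close>

type_synonym 'm tvec = "('m \<Rightarrow> real) \<Rightarrow> real"
type_synonym 'm vfield = "'m \<Rightarrow> 'm tvec"

definition tangent_space :: "'m::topological_space chart set \<Rightarrow> 'm \<Rightarrow> 'm tvec set" where
  "tangent_space A p = {v.
     (\<forall>f h. smooth_at A p f \<and> smooth_at A p h \<and> eventually (\<lambda>q. f q = h q) (nhds p) \<longrightarrow> v f = v h) \<and>
     (\<forall>f h. smooth_at A p f \<and> smooth_at A p h \<longrightarrow> v (\<lambda>q. f q + h q) = v f + v h) \<and>
     (\<forall>c f. smooth_at A p f \<longrightarrow> v (\<lambda>q. c * f q) = c * v f) \<and>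
     (\<forall>f h. smooth_at A p f \<and> smooth_at A p h \<longrightarrow> v (\<lambda>q. f q * h q) = v f * h p + f p * v h) \<and>
     (\<forall>f. \<not> smooth_at A p f \<longrightarrow> v f = 0)}"

definition smooth_vf :: "'m::topological_space chart set \<Rightarrow> 'm set \<Rightarrow> 'm vfield \<Rightarrow> bool" where
  "smooth_vf A W X \<longleftrightarrow> open W \<and> W \<subseteq> points A \<and> (\<forall>p\<in>W. X p \<in> tangent_space A p) \<and>
     (\<forall>W' f. W' \<subseteq> W \<and> smooth_fun A W' f \<longrightarrow> smooth_fun A W' (\<lambda>p. X p f))"

definition lie_bracket :: "'m::topological_space chart set \<Rightarrow> 'm vfield \<Rightarrow> 'm vfield \<Rightarrow> 'm vfield" where
  "lie_bracket A X Y p =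
     (\<lambda>f. if smooth_at A p f then X p (\<lambda>q. Y q f) - Y p (\<lambda>q. X q f) else 0)"

section \<open>Differential forms\<close>

text \<open>A \<open>k\<close>-form at \<open>p\<close> is a function on lists of tangent vectors, multilinear and alternating on
  lists of length \<open>k\<close> in the tangent space and \<open>0\<close> on all other lists.\<close>

type_synonym 'm form = "'m tvec list \<Rightarrow> real"

definition alt_form :: "'m::topological_space chart set \<Rightarrow> 'm \<Rightarrow> nat \<Rightarrow> 'm form \<Rightarrow> bool" where
  "alt_form A p k \<omega> \<longleftrightarrow>
     (\<forall>vs. \<not> (length vs = k \<and> set vs \<subseteq> tangent_space A p) \<longrightarrow> \<omega> vs = 0) \<and>
     (\<forall>us u v ws a b. set us \<union> {u, v} \<union> set ws \<subseteq> tangent_space A p \<longrightarrow>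
        \<omega> (us @ (\<lambda>f. a * u f + b * v f) # ws) = a * \<omega> (us @ u # ws) + b * \<omega> (us @ v # ws)) \<and>
     (\<forall>vs. \<not> distinct vs \<longrightarrow> \<omega> vs = 0)"

definition smooth_form :: "'m::topological_space chart set \<Rightarrow> nat \<Rightarrow> ('m \<Rightarrow> 'm form) \<Rightarrow> bool" where
  "smooth_form A k \<omega> \<longleftrightarrow> (\<forall>p\<in>points A. alt_form A p k (\<omega> p)) \<and>
     (\<forall>W Xs. open W \<and> W \<subseteq> points A \<and> (\<forall>X\<in>set Xs. smooth_vf A W X) \<longrightarrow>
        smooth_fun A W (\<lambda>p. \<omega> p (map (\<lambda>X. X p) Xs)))"

text \<open>The sign of the shuffle that lists first the positions in \<open>S\<close> and then those not in \<open>S\<close>.\<close>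

definition shuffle_sign :: "nat \<Rightarrow> nat set \<Rightarrow> real" where
  "shuffle_sign n S = (-1) ^ card {(i, j). i < j \<and> j < n \<and> i \<notin> S \<and> j \<in> S}"

text \<open>For a \<open>k\<close>-form \<open>\<alpha>\<close> only the sets \<open>S\<close> with \<open>k\<close> elements contribute.  The normalisation is
  the one in which \<open>e\<^sup>i \<and> e\<^sup>j\<close> takes the value \<open>1\<close> on \<open>[e\<^sub>i, e\<^sub>j]\<close> for \<open>i \<noteq> j\<close>.\<close>

definition wedge :: "'m form \<Rightarrow> 'm form \<Rightarrow> 'm form" where
  "wedge \<alpha> \<beta> vs = (\<Sum>S \<in> Pow {..<length vs}.
     shuffle_sign (length vs) S * \<alpha> (nths vs S) * \<beta> (nths vs (- S)))"

text \<open>The invariant formula for the exterior derivative: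
  \<open>\<Sum>\<^sub>i (-1)\<^sup>i X\<^sub>i(\<omega>(\<dots>, omit X\<^sub>i, \<dots>)) + \<Sum>\<^sub>i\<^sub><\<^sub>j (-1)\<^sup>i\<^sup>+\<^sup>j \<omega>([X\<^sub>i, X\<^sub>j], \<dots>, omit X\<^sub>i, X\<^sub>j, \<dots>)\<close>.\<close>

definition ext_deriv_fields ::
  "'m::topological_space chart set \<Rightarrow> ('m \<Rightarrow> 'm form) \<Rightarrow> 'm vfield list \<Rightarrow> 'm \<Rightarrow> real" where
  "ext_deriv_fields A \<omega> Xs p =
     (\<Sum>i<length Xs. (-1) ^ i * (Xs ! i) p (\<lambda>q. \<omega> q (map (\<lambda>X. X q) (nths Xs (- {i}))))) +
     (\<Sum>j<length Xs. \<Sum>i<j. (-1) ^ (i + j) *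
        \<omega> p (lie_bracket A (Xs ! i) (Xs ! j) p # map (\<lambda>X. X p) (nths Xs (- {i, j}))))"

text \<open>The value on tangent vectors is the common value for all local smooth extensions.\<close>

definition ext_deriv :: "'m::topological_space chart set \<Rightarrow> ('m \<Rightarrow> 'm form) \<Rightarrow> 'm \<Rightarrow> 'm form" where
  "ext_deriv A \<omega> p vs =
     (if set vs \<subseteq> tangent_space A p
      then THE r. \<forall>W Xs. p \<in> W \<and> (\<forall>X\<in>set Xs. smooth_vf A W X) \<and> open W \<and> W \<subseteq> points A \<and>
             map (\<lambda>X. X p) Xs = vs \<longrightarrow> ext_deriv_fields A \<omega> Xs p = r
      else 0)"

section \<open>Metrics and connections\<close>

type_synonym 'm metric = "'m \<Rightarrow> 'm tvec \<Rightarrow> 'm tvec \<Rightarrow> real"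

definition riemannian_metric :: "'m::topological_space chart set \<Rightarrow> 'm metric \<Rightarrow> bool" where
  "riemannian_metric A g \<longleftrightarrow>
     (\<forall>p\<in>points A. \<forall>u\<in>tangent_space A p. \<forall>v\<in>tangent_space A p. \<forall>w\<in>tangent_space A p. \<forall>a b.
        g p (\<lambda>f. a * u f + b * v f) w = a * g p u w + b * g p v w \<and>
        g p u v = g p v u \<and>
        (u \<noteq> (\<lambda>f. 0) \<longrightarrow> g p u u > 0)) \<and>
     (\<forall>W X Y. smooth_vf A W X \<and> smooth_vf A W Y \<longrightarrow> smooth_fun A W (\<lambda>p. g p (X p) (Y p)))"

text \<open>\<open>nab p u Y\<close> is the covariant derivative at \<open>p\<close> of the (locally defined) vector field \<open>Y\<close> in
  the direction of the tangent vector \<open>u\<close> at \<open>p\<close>.\<close>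

type_synonym 'm connection = "'m \<Rightarrow> 'm tvec \<Rightarrow> 'm vfield \<Rightarrow> 'm tvec"

definition affine_connection :: "'m::topological_space chart set \<Rightarrow> 'm connection \<Rightarrow> bool" where
  "affine_connection A nab \<longleftrightarrow>
     (\<forall>W p u v Y Z f a b. p \<in> W \<and> u \<in> tangent_space A p \<and> v \<in> tangent_space A p \<and>
        smooth_vf A W Y \<and> smooth_vf A W Z \<and> smooth_fun A W f \<longrightarrow>
        nab p u Y \<in> tangent_space A p \<and>
        nab p (\<lambda>h. a * u h + b * v h) Y = (\<lambda>h. a * nab p u Y h + b * nab p v Y h) \<and>
        nab p u (\<lambda>q h. Y q h + Z q h) = (\<lambda>h. nab p u Y h + nab p u Z h) \<and>
        nab p u (\<lambda>q h. f q * Y q h) = (\<lambda>h. u f * Y p h + f p * nab p u Y h)) \<and>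
     (\<forall>W W' p u Y Z. p \<in> W \<and> u \<in> tangent_space A p \<and> smooth_vf A W Y \<and> smooth_vf A W' Z \<and>
        eventually (\<lambda>q. Y q = Z q) (nhds p) \<longrightarrow> nab p u Y = nab p u Z) \<and>
     (\<forall>W X Y. smooth_vf A W X \<and> smooth_vf A W Y \<longrightarrow> smooth_vf A W (\<lambda>q. nab q (X q) Y))"

definition metric_connection ::
  "'m::topological_space chart set \<Rightarrow> 'm metric \<Rightarrow> 'm connection \<Rightarrow> bool" where
  "metric_connection A g nab \<longleftrightarrow> affine_connection A nab \<and>
     (\<forall>W p u Y Z. p \<in> W \<and> u \<in> tangent_space A p \<and> smooth_vf A W Y \<and> smooth_vf A W Z \<longrightarrow>
        u (\<lambda>q. g q (Y q) (Z q)) = g p (nab p u Y) (Z p) + g p (Y p) (nab p u Z))"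

definition levi_civita ::
  "'m::topological_space chart set \<Rightarrow> 'm metric \<Rightarrow> 'm connection \<Rightarrow> bool" where
  "levi_civita A g nab \<longleftrightarrow> metric_connection A g nab \<and>
     (\<forall>W p X Y. p \<in> W \<and> smooth_vf A W X \<and> smooth_vf A W Y \<longrightarrow>
        (\<lambda>f. nab p (X p) Y f - nab p (Y p) X f) = lie_bracket A X Y p)"

definition parallel_form ::
  "'m::topological_space chart set \<Rightarrow> 'm connection \<Rightarrow> ('m \<Rightarrow> 'm form) \<Rightarrow> bool" where
  "parallel_form A nab \<omega> \<longleftrightarrow>
     (\<forall>W p u Ys. open W \<and> W \<subseteq> points A \<and> p \<in> W \<and> u \<in> tangent_space A p \<and>
        (\<forall>Y\<in>set Ys. smooth_vf A W Y) \<longrightarrow>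
        u (\<lambda>q. \<omega> q (map (\<lambda>Y. Y q) Ys)) =
        (\<Sum>i<length Ys. \<omega> p ((map (\<lambda>Y. Y p) Ys)[i := nab p u (Ys ! i)])))"

definition curvature ::
  "'m::topological_space chart set \<Rightarrow> 'm connection \<Rightarrow> 'm vfield \<Rightarrow> 'm vfield \<Rightarrow> 'm vfield \<Rightarrow> 'm vfield"
where
  "curvature A nab X Y Z p =
     (\<lambda>f. nab p (X p) (\<lambda>q. nab q (Y q) Z) f - nab p (Y p) (\<lambda>q. nab q (X q) Z) f
          - nab p (lie_bracket A X Y p) Z f)"

definition sharp :: "'m::topological_space chart set \<Rightarrow> 'm metric \<Rightarrow> ('m \<Rightarrow> 'm form) \<Rightarrow> 'm vfield" where
  "sharp A g \<eta> p =
     (THE v. v \<in> tangent_space A p \<and> (\<forall>w\<in>tangent_space A p. g p v w = \<eta> p [w]))"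

section \<open>Spin(7)-structures\<close>

text \<open>For an orthonormal basis \<open>e\<close> of the tangent space, \<open>coframe A g p e i\<close> is the dual 1-form
  \<open>e\<^sup>i\<close> and \<open>coframe_form A g p e [i, j, \<dots>]\<close> is \<open>e\<^sup>i \<and> e\<^sup>j \<and> \<dots>\<close>.\<close>

definition coframe :: "'m::topological_space chart set \<Rightarrow> 'm metric \<Rightarrow> 'm \<Rightarrow> (nat \<Rightarrow> 'm tvec) \<Rightarrow> nat \<Rightarrow> 'm form"
where
  "coframe A g p e i vs =
     (if length vs = 1 \<and> hd vs \<in> tangent_space A p then g p (hd vs) (e i) else 0)"

definition coframe_form ::
  "'m::topological_space chart set \<Rightarrow> 'm metric \<Rightarrow> 'm \<Rightarrow> (nat \<Rightarrow> 'm tvec) \<Rightarrow> nat list \<Rightarrow> 'm form" where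
  "coframe_form A g p e is =
     foldr (\<lambda>i. wedge (coframe A g p e i)) is (\<lambda>vs. if vs = [] then 1 else 0)"

definition spin7_terms :: "(real \<times> nat list) list" where
  "spin7_terms =
     [( 1, [0,1,2,3]), (-1, [0,1,4,5]), (-1, [0,1,6,7]), (-1, [0,2,4,6]), ( 1, [0,2,5,7]),
      (-1, [0,3,4,7]), (-1, [0,3,5,6]), ( 1, [4,5,6,7]), (-1, [2,3,6,7]), (-1, [2,3,4,5]),
      (-1, [1,3,5,7]), ( 1, [1,3,4,6]), (-1, [1,2,5,6]), (-1, [1,2,4,7])]"

definition spin7_model ::
  "'m::topological_space chart set \<Rightarrow> 'm metric \<Rightarrow> 'm \<Rightarrow> (nat \<Rightarrow> 'm tvec) \<Rightarrow> 'm form" where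
  "spin7_model A g p e vs = (\<Sum>(c, is) \<leftarrow> spin7_terms. c * coframe_form A g p e is vs)"

text \<open>A smooth local frame on \<open>W\<close>, orthonormal and adapted to \<open>\<Phi>\<close>; \<open>e i\<close> for \<open>i < 8\<close> are the
  frame fields.\<close>

definition adapted_frame_on ::
  "'m::topological_space chart set \<Rightarrow> 'm metric \<Rightarrow> ('m \<Rightarrow> 'm form) \<Rightarrow> 'm set \<Rightarrow> (nat \<Rightarrow> 'm vfield) \<Rightarrow> bool"
where
  "adapted_frame_on A g \<Phi> W e \<longleftrightarrow> (\<forall>i<8. smooth_vf A W (e i)) \<and>
     (\<forall>q\<in>W. (\<forall>v\<in>tangent_space A q. \<exists>a. v = (\<lambda>f. \<Sum>i<8. a i * e i q f)) \<and>
            (\<forall>i<8. \<forall>j<8. g q (e i q) (e j q) = (if i = j then 1 else 0)) \<and>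
            \<Phi> q = spin7_model A g q (\<lambda>i. e i q))"

definition spin7_structure ::
  "'m::topological_space chart set \<Rightarrow> 'm metric \<Rightarrow> ('m \<Rightarrow> 'm form) \<Rightarrow> bool" where
  "spin7_structure A g \<Phi> \<longleftrightarrow> smooth_form A 4 \<Phi> \<and>
     (\<forall>p\<in>points A. \<exists>W e. p \<in> W \<and> adapted_frame_on A g \<Phi> W e)"

text \<open>A choice of adapted frame near \<open>p\<close>.  Two adapted frames differ by a function with values in
  Spin(7), a subgroup of SO(8), so they are orthonormal frames defining the same orientation, and
  the Hodge star, norms, divergences and scalar curvatures below do not depend on the choice.\<close>

definition adapted_frame ::
  "'m::topological_space chart set \<Rightarrow> 'm metric \<Rightarrow> ('m \<Rightarrow> 'm form) \<Rightarrow> 'm \<Rightarrow> nat \<Rightarrow> 'm vfield" where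
  "adapted_frame A g \<Phi> p = (SOME e. \<exists>W. p \<in> W \<and> adapted_frame_on A g \<Phi> W e)"

definition frame_at ::
  "'m::topological_space chart set \<Rightarrow> 'm metric \<Rightarrow> ('m \<Rightarrow> 'm form) \<Rightarrow> 'm \<Rightarrow> nat \<Rightarrow> 'm tvec" where
  "frame_at A g \<Phi> p i = adapted_frame A g \<Phi> p i p"

text \<open>\<open>\<star>\<omega> = \<Sum>\<^sub>I \<omega>(e\<^sub>I) vol(e\<^sub>I, \<dots>)\<close> over increasing multi-indices \<open>I\<close>, where \<open>vol\<close> is
  \<open>e\<^sup>0 \<and> \<dots> \<and> e\<^sup>7\<close>.  Equivalently \<open>e\<^sup>I \<and> \<star>e\<^sup>I = vol\<close>.  Sets of the wrong cardinality contribute \<open>0\<close>.\<close>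

definition hodge ::
  "'m::topological_space chart set \<Rightarrow> 'm metric \<Rightarrow> ('m \<Rightarrow> 'm form) \<Rightarrow> 'm \<Rightarrow> 'm form \<Rightarrow> 'm form" where
  "hodge A g \<Phi> p \<omega> vs = (let e = frame_at A g \<Phi> p in
     \<Sum>I \<in> Pow {..<8}. \<omega> (map e (nths [0..<8] I)) *
       coframe_form A g p e [0..<8] (map e (nths [0..<8] I) @ vs))"

definition form_norm2 ::
  "'m::topological_space chart set \<Rightarrow> 'm metric \<Rightarrow> ('m \<Rightarrow> 'm form) \<Rightarrow> 'm \<Rightarrow> 'm form \<Rightarrow> real" where
  "form_norm2 A g \<Phi> p \<omega> =
     (\<Sum>I \<in> Pow {..<8}. (\<omega> (map (frame_at A g \<Phi> p) (nths [0..<8] I)))\<^sup>2)"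

definition divergence ::
  "'m::topological_space chart set \<Rightarrow> 'm metric \<Rightarrow> ('m \<Rightarrow> 'm form) \<Rightarrow> 'm connection \<Rightarrow> 'm vfield \<Rightarrow> 'm \<Rightarrow> real"
where
  "divergence A g \<Phi> nab V p =
     (\<Sum>i<8. g p (nab p (frame_at A g \<Phi> p i) V) (frame_at A g \<Phi> p i))"

definition scalar_curvature ::
  "'m::topological_space chart set \<Rightarrow> 'm metric \<Rightarrow> ('m \<Rightarrow> 'm form) \<Rightarrow> 'm connection \<Rightarrow> 'm \<Rightarrow> real" where
  "scalar_curvature A g \<Phi> nab p = (let e = adapted_frame A g \<Phi> p in
     \<Sum>i<8. \<Sum>j<8. g p (curvature A nab (e i) (e j) (e j) p) (e i p))"

definition codifferential ::
  "'m::topological_space chart set \<Rightarrow> 'm metric \<Rightarrow> ('m \<Rightarrow> 'm form) \<Rightarrow> ('m \<Rightarrow> 'm form) \<Rightarrow> 'm \<Rightarrow> 'm form"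
where
  "codifferential A g \<Phi> \<omega> p vs =
     - hodge A g \<Phi> p (ext_deriv A (\<lambda>q. hodge A g \<Phi> q (\<omega> q)) p) vs"

definition lee_form ::
  "'m::topological_space chart set \<Rightarrow> 'm metric \<Rightarrow> ('m \<Rightarrow> 'm form) \<Rightarrow> 'm \<Rightarrow> 'm form" where
  "lee_form A g \<Phi> p vs =
     1 / 7 * hodge A g \<Phi> p (wedge (codifferential A g \<Phi> \<Phi> p) (\<Phi> p)) vs"

definition Lambda2_7 ::
  "'m::topological_space chart set \<Rightarrow> 'm metric \<Rightarrow> ('m \<Rightarrow> 'm form) \<Rightarrow> 'm \<Rightarrow> 'm form set" where
  "Lambda2_7 A g \<Phi> p =
     {\<omega>. alt_form A p 2 \<omega> \<and> hodge A g \<Phi> p (wedge (\<Phi> p) \<omega>) = (\<lambda>vs. 3 * \<omega> vs)}"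

definition Lambda3_8 ::
  "'m::topological_space chart set \<Rightarrow> 'm metric \<Rightarrow> ('m \<Rightarrow> 'm form) \<Rightarrow> 'm \<Rightarrow> 'm form set" where
  "Lambda3_8 A g \<Phi> p = {hodge A g \<Phi> p (wedge (\<Phi> p) \<eta>) | \<eta>. alt_form A p 1 \<eta>}"

definition Lambda3_48 ::
  "'m::topological_space chart set \<Rightarrow> ('m \<Rightarrow> 'm form) \<Rightarrow> 'm \<Rightarrow> 'm form set" where
  "Lambda3_48 A \<Phi> p = {\<gamma>. alt_form A p 3 \<gamma> \<and> wedge (\<Phi> p) \<gamma> = (\<lambda>vs. 0)}"

definition component3_48 ::
  "'m::topological_space chart set \<Rightarrow> 'm metric \<Rightarrow> ('m \<Rightarrow> 'm form) \<Rightarrow> 'm \<Rightarrow> 'm form \<Rightarrow> 'm form" where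
  "component3_48 A g \<Phi> p \<omega> =
     (THE \<gamma>. \<gamma> \<in> Lambda3_48 A \<Phi> p \<and> (\<lambda>vs. \<omega> vs - \<gamma> vs) \<in> Lambda3_8 A g \<Phi> p)"

text \<open>The minimal connection \<open>nabS\<close> relative to the Levi-Civita connection \<open>nab\<close>: the unique metric
  connection with \<open>nabS \<Phi> = 0\<close> for which the skew endomorphism \<open>\<xi>\<^sub>u = nabS\<^sub>u - nab\<^sub>u\<close>, read as the
  2-form \<open>(Y, Z) \<mapsto> g(\<xi>\<^sub>u Y, Z)\<close>, always lies in \<open>\<Lambda>\<^sup>2\<^sub>7\<close>.\<close>

definition minimal_spin7_connection ::
  "'m::topological_space chart set \<Rightarrow> 'm metric \<Rightarrow> ('m \<Rightarrow> 'm form) \<Rightarrow> 'm connection \<Rightarrow> 'm connection \<Rightarrow> bool"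
where
  "minimal_spin7_connection A g \<Phi> nab nabS \<longleftrightarrow>
     metric_connection A g nabS \<and> parallel_form A nabS \<Phi> \<and>
     (\<forall>p\<in>points A. \<forall>u\<in>tangent_space A p. \<exists>\<omega>\<in>Lambda2_7 A g \<Phi> p.
        \<forall>W Y. p \<in> W \<and> smooth_vf A W Y \<longrightarrow>
          (\<forall>w\<in>tangent_space A p. g p (\<lambda>f. nabS p u Y f - nab p u Y f) w = \<omega> [Y p, w]))"

end

theory Submission
  imports Defs
begin

text \<open>Let \<open>\<xi> = nabS - nab\<close>.  Near a point take an adapted frame and write
  \<open>x\<^sub>i\<^sub>j\<^sub>k = g(\<xi>\<^sub>e\<^sub>i e\<^sub>j, e\<^sub>k)\<close>, \<open>T = \<Sum>\<^sub>j \<xi>\<^sub>e\<^sub>j e\<^sub>j\<close> and \<open>C = \<Sum> x\<^sub>i\<^sub>j\<^sub>m x\<^sub>j\<^sub>i\<^sub>m\<close>.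
  As \<open>\<Phi>\<close> is parallel for \<open>nabS\<close> and \<open>\<xi>\<close> has values in \<open>\<Lambda>\<^sup>2\<^sub>7\<close>, the form \<open>\<delta>\<Phi>\<close> is an explicit linear
  image of \<open>\<xi>\<close>, which gives \<open>\<theta>\<^sup>\<sharp> = (16/7) T\<close>, \<open>(\<delta>\<Phi>)\<^sub>8 = - \<star>(\<Phi> \<and> \<theta>)\<close> and
  \<open>|(\<delta>\<Phi>)\<^sub>4\<^sub>8|\<^sup>2 = (80/7) |T|\<^sup>2 + 16 C\<close>.  On the other hand the curvature of \<open>nabS\<close> and the commutators
  \<open>[\<xi>\<^sub>i, \<xi>\<^sub>j]\<close> lie in \<open>\<Lambda>\<^sup>2\<^sub>2\<^sub>1\<close>, while the \<open>nabS\<close>-derivative of \<open>\<xi>\<close> lies in \<open>\<Lambda>\<^sup>2\<^sub>7\<close>.  Contracting the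
  first Bianchi identity for \<open>nab\<close> with \<open>\<Phi>\<close>, which acts on these spaces as a scalar, yields
  \<open>s = - 8 div T + 8 |T|\<^sup>2 - 8 C\<close>, and comparing the two curvatures yields
  \<open>s\<^sup>S - s = 2 div T - |T|\<^sup>2 + C\<close>.\<close>

section \<open>Smooth functions and vector fields\<close>

text \<open>The Hodge star, and with it \<Lambda>2_7, \<delta>\<Phi> and \<theta>, is defined
  through \<open>frame_at\<close>, a frame chosen anew at every point, so nothing built from it is
  visibly smooth. Two devices deal with this. The identity \<star>\<Phi> = \<Phi> removes the star
  under the exterior derivative. Metric traces are frame independent, which carries the eigenvalue
  equation of \<Lambda>2_7 and the formula for \<theta> over to a smooth adapted frame. The
  commutators [\<xi>_i, \<xi>_j] fall into spin(7) because (so(8), spin(7)) is a symmetric pair. As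
  a representation, \<Lambda>1 times \<Lambda>2_7 splits into irreducible parts of dimensions 8 and
  48; hence |T|^2 and C span the invariant quadratic forms in \<xi>, and every norm is a combination
  of these two. The scalar curvatures come from two linear equations, the difference formula for the
  curvatures and the Bianchi identity with weights -2 on spin(7) and 6 on \<Lambda>2_7. Eliminating
  the curvature of \<open>nabS\<close> leaves four times an expression in \<xi>, and skewness adds a
  factor 2 to the divergence; this is the origin of the 8.\<close>

lemma frechet_derivative_cong_open:
  assumes "open S" "x \<in> S" "\<And>y. y \<in> S \<Longrightarrow> f y = h y"
  shows "frechet_derivative f (at x) = frechet_derivative h (at x)"
proof -
  have "(f has_derivative D) (at x) \<longleftrightarrow> (h has_derivative D) (at x)" for D
    using has_derivative_transform_within_open[of f D x UNIV S h]
      has_derivative_transform_within_open[of h D x UNIV S f] assms by auto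
  then show ?thesis unfolding frechet_derivative_def by simp
qed

lemma ck_on_cong:
  assumes "open S" "\<And>y. y \<in> S \<Longrightarrow> f y = h y"
  shows "ck_on n S f \<longleftrightarrow> ck_on n S h"
  using assms(2)
proof (induction n arbitrary: f h)
  case 0
  then show ?case by (auto intro: continuous_on_cong)
next
  case (Suc n)
  have "f differentiable_on S \<longleftrightarrow> h differentiable_on S"
    using Suc.prems by (auto simp: differentiable_on_def
        intro: differentiable_transform_within[where d=1])
  moreover have "ck_on n S (\<lambda>x. frechet_derivative f (at x) v) \<longleftrightarrow>
      ck_on n S (\<lambda>x. frechet_derivative h (at x) v)" for v
    by (rule Suc.IH) (metis Suc.prems assms(1) frechet_derivative_cong_open)
  ultimately show ?case by simp
qed

lemma ck_on_const: "ck_on n S (\<lambda>x. c)"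
  by (induction n arbitrary: c) (auto simp: frechet_derivative_const)

text \<open>Real coefficients are enough here: vectors are extended by constant combinations of
  frame fields, and the components of \<Phi> in an adapted frame are constant.\<close>

lemma ck_on_lincomb:
  fixes f h :: "'a::real_normed_vector \<Rightarrow> real"
  assumes "open S" "ck_on n S f" "ck_on n S h"
  shows "ck_on n S (\<lambda>x. a * f x + b * h x)"
  using assms(2,3)
proof (induction n arbitrary: f h)
  case 0
  then show ?case by (auto intro!: continuous_intros)
next
  case (Suc n)
  have f: "f differentiable_on S" and h: "h differentiable_on S" using Suc.prems by auto
  have "frechet_derivative (\<lambda>x. a * f x + b * h x) (at x) v =
      a * frechet_derivative f (at x) v + b * frechet_derivative h (at x) v" if "x \<in> S" for x v
  proof -
    have "f differentiable at x" "h differentiable at x"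
      using f h that assms(1) by (auto simp: differentiable_on_eq_differentiable_at)
    then have "((\<lambda>x. a * f x + b * h x) has_derivative
        (\<lambda>v. a * frechet_derivative f (at x) v + b * frechet_derivative h (at x) v)) (at x)"
      by (auto intro!: derivative_eq_intros simp: frechet_derivative_works)
    from frechet_derivative_at[OF this] show ?thesis by metis
  qed
  then have "ck_on n S (\<lambda>x. frechet_derivative (\<lambda>x. a * f x + b * h x) (at x) v)" for v
    using Suc.IH[of "\<lambda>x. frechet_derivative f (at x) v" "\<lambda>x. frechet_derivative h (at x) v"]
      Suc.prems by (subst ck_on_cong[OF assms(1)]) auto
  then show ?case using f h by (auto intro!: derivative_intros)
qed

lemma ck_on_subset: "ck_on n S f \<Longrightarrow> S' \<subseteq> S \<Longrightarrow> ck_on n S' f"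
  by (induction n arbitrary: f) (auto intro: continuous_on_subset differentiable_on_subset)

section \<open>Smooth functions seen through charts\<close>

lemma open_chart_image:
  assumes "smooth_atlas A" "(U, \<phi>) \<in> A" "open W"
  shows "open (\<phi> ` (U \<inter> W))"
proof -
  have o: "open U" "open (\<phi> ` U)" and h: "homeomorphism U (\<phi> ` U) \<phi> (inv_into U \<phi>)"
    using assms(1,2) unfolding smooth_atlas_def by auto
  have "openin (top_of_set (\<phi> ` U)) (\<phi> ` (U \<inter> W))"
    by (rule homeomorphism_imp_open_map[OF h]) (simp add: assms(3) openin_open_Int)
  then show ?thesis using o openin_open_trans by blast
qed

lemma inv_chart:
  assumes "smooth_atlas A" "(U, \<phi>) \<in> A" "x \<in> \<phi> ` (U \<inter> W)"
  shows "inv_into U \<phi> x \<in> W"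
proof -
  have "homeomorphism U (\<phi> ` U) \<phi> (inv_into U \<phi>)"
    using assms(1,2) unfolding smooth_atlas_def by auto
  then show ?thesis using assms(3) by (auto simp: homeomorphism_def)
qed

lemma smooth_fun_openD: "smooth_fun A W f \<Longrightarrow> open W \<and> W \<subseteq> points A"
  by (simp add: smooth_fun_def)

text \<open>Functions are total, so two expressions for the same quantity agree only on
  \<open>W\<close>. Chart images of \<open>W\<close> are open, and on an open set the iterated
  derivatives depend only on the values there.\<close>

lemma smooth_fun_cong:
  assumes "smooth_atlas A" "\<And>q. q \<in> W \<Longrightarrow> f q = h q" "smooth_fun A W f"
  shows "smooth_fun A W h"
proof -
  have "smooth_on (\<phi> ` (U \<inter> W)) (h \<circ> inv_into U \<phi>)" if "(U, \<phi>) \<in> A" for U \<phi>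
  proof -
    have "open (\<phi> ` (U \<inter> W))"
      using assms(1,3) that open_chart_image unfolding smooth_fun_def by blast
    moreover have "smooth_on (\<phi> ` (U \<inter> W)) (f \<circ> inv_into U \<phi>)"
      using assms(3) that unfolding smooth_fun_def by blast
    ultimately show ?thesis
      unfolding smooth_on_def
      using assms(2) inv_chart[OF assms(1) that, of _ W]
        ck_on_cong[of "\<phi> ` (U \<inter> W)" "f \<circ> inv_into U \<phi>" "h \<circ> inv_into U \<phi>"]
      by (metis comp_apply)
  qed
  then show ?thesis using assms(3) unfolding smooth_fun_def by auto
qed

lemma smooth_fun_const:
  assumes "open W" "W \<subseteq> points A"
  shows "smooth_fun A W (\<lambda>q. c)"
  using assms by (auto simp: smooth_fun_def smooth_on_def o_def ck_on_const)

lemma smooth_fun_subset: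
  assumes "smooth_fun A W f" "open W'" "W' \<subseteq> W"
  shows "smooth_fun A W' f"
proof -
  have "smooth_on (\<phi> ` (U \<inter> W')) (f \<circ> inv_into U \<phi>)" if "(U, \<phi>) \<in> A" for U \<phi>
    using assms(1,3) that ck_on_subset[of _ "\<phi> ` (U \<inter> W)" _ "\<phi> ` (U \<inter> W')"]
    unfolding smooth_fun_def smooth_on_def by blast
  then show ?thesis using assms unfolding smooth_fun_def by auto
qed

lemma smooth_fun_lincomb:
  assumes "smooth_atlas A" "smooth_fun A W f" "smooth_fun A W h"
  shows "smooth_fun A W (\<lambda>q. a * f q + b * h q)"
proof -
  have "ck_on n (\<phi> ` (U \<inter> W)) ((\<lambda>q. a * f q + b * h q) \<circ> inv_into U \<phi>)"
    if "(U, \<phi>) \<in> A" for U \<phi> n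
  proof -
    have "open (\<phi> ` (U \<inter> W))"
      using assms(1,2) that open_chart_image unfolding smooth_fun_def by blast
    then show ?thesis
      using assms(2,3) that ck_on_lincomb[of "\<phi> ` (U \<inter> W)" n "f \<circ> inv_into U \<phi>" "h \<circ> inv_into U \<phi>"]
      unfolding smooth_fun_def smooth_on_def by (fastforce simp: o_def)
  qed
  then show ?thesis using assms(2) unfolding smooth_fun_def smooth_on_def by auto
qed

lemma smooth_fun_sum:
  assumes "smooth_atlas A" "open W" "W \<subseteq> points A" "finite J"
    "\<And>j. j \<in> J \<Longrightarrow> smooth_fun A W (F j)"
  shows "smooth_fun A W (\<lambda>q. \<Sum>j\<in>J. F j q)"
  using assms(4,5)
proof (induction J rule: finite_induct)
  case empty
  then show ?case using smooth_fun_const[OF assms(2,3)] by simp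
next
  case (insert j J)
  then show ?case using smooth_fun_lincomb[OF assms(1), of W "F j" "\<lambda>q. \<Sum>j\<in>J. F j q" 1 1] by simp
qed

section \<open>Germs, and tangent vectors as derivations\<close>

lemma smooth_atI: "smooth_fun A W f \<Longrightarrow> p \<in> W \<Longrightarrow> smooth_at A p f"
  unfolding smooth_at_def by blast

lemma smooth_at_common:
  assumes "smooth_at A p f" "smooth_at A p h"
  obtains W where "p \<in> W" "smooth_fun A W f" "smooth_fun A W h"
proof -
  obtain W1 W2 where "p \<in> W1" "smooth_fun A W1 f" "p \<in> W2" "smooth_fun A W2 h"
    using assms unfolding smooth_at_def by blast
  then show ?thesis using that[of "W1 \<inter> W2"] smooth_fun_subset smooth_fun_openD
    by (metis IntI inf_le1 inf_le2 open_Int)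
qed

lemma smooth_at_lincomb:
  "smooth_atlas A \<Longrightarrow> smooth_at A p f \<Longrightarrow> smooth_at A p h \<Longrightarrow> smooth_at A p (\<lambda>q. a * f q + b * h q)"
  by (erule (1) smooth_at_common) (metis smooth_atI smooth_fun_lincomb)

lemma smooth_at_cmult:
  "smooth_atlas A \<Longrightarrow> smooth_at A p f \<Longrightarrow> smooth_at A p (\<lambda>q. a * f q)"
  using smooth_at_lincomb[of A p f f a 0] by simp

lemma tangentD:
  assumes "v \<in> tangent_space A p"
  shows "smooth_at A p f \<Longrightarrow> smooth_at A p h \<Longrightarrow> eventually (\<lambda>q. f q = h q) (nhds p) \<Longrightarrow> v f = v h"
    and "smooth_at A p f \<Longrightarrow> smooth_at A p h \<Longrightarrow> v (\<lambda>q. f q + h q) = v f + v h"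
    and "smooth_at A p f \<Longrightarrow> v (\<lambda>q. c * f q) = c * v f"
    and "smooth_at A p f \<Longrightarrow> smooth_at A p h \<Longrightarrow> v (\<lambda>q. f q * h q) = v f * h p + f p * v h"
    and "\<not> smooth_at A p f \<Longrightarrow> v f = 0"
  using assms unfolding tangent_space_def by blast+

lemma tangent_lincomb:
  assumes u: "u \<in> tangent_space A p" and v: "v \<in> tangent_space A p"
  shows "(\<lambda>f. a * u f + b * v f) \<in> tangent_space A p"
  unfolding tangent_space_def
proof (intro CollectI conjI allI impI)
  fix f h
  assume "smooth_at A p f \<and> smooth_at A p h \<and> (\<forall>\<^sub>F q in nhds p. f q = h q)"
  then show "a * u f + b * v f = a * u h + b * v h"
    using tangentD(1)[OF u, of f h] tangentD(1)[OF v, of f h] by simp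
next
  fix f h
  assume "smooth_at A p f \<and> smooth_at A p h"
  then show "a * u (\<lambda>q. f q + h q) + b * v (\<lambda>q. f q + h q) = a * u f + b * v f + (a * u h + b * v h)"
    using tangentD(2)[OF u, of f h] tangentD(2)[OF v, of f h] by (simp add: algebra_simps)
next
  fix c f
  assume "smooth_at A p f"
  then show "a * u (\<lambda>q. c * f q) + b * v (\<lambda>q. c * f q) = c * (a * u f + b * v f)"
    using tangentD(3)[OF u, of f c] tangentD(3)[OF v, of f c] by (simp add: algebra_simps)
next
  fix f h
  assume "smooth_at A p f \<and> smooth_at A p h"
  then show "a * u (\<lambda>q. f q * h q) + b * v (\<lambda>q. f q * h q) =
      (a * u f + b * v f) * h p + f p * (a * u h + b * v h)"
    using tangentD(4)[OF u, of f h] tangentD(4)[OF v, of f h] by (simp add: algebra_simps)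
next
  fix f
  assume "\<not> smooth_at A p f"
  then show "a * u f + b * v f = 0" using tangentD(5)[OF u, of f] tangentD(5)[OF v, of f] by simp
qed

lemma tangent_zero: "(\<lambda>f. 0) \<in> tangent_space A p"
  unfolding tangent_space_def by auto

lemma tangent_sum:
  assumes "finite J" "\<And>j. j \<in> J \<Longrightarrow> u j \<in> tangent_space A p"
  shows "(\<lambda>f. \<Sum>j\<in>J. a j * u j f) \<in> tangent_space A p"
  using assms
proof (induction J rule: finite_induct)
  case empty
  then show ?case by (simp add: tangent_zero)
next
  case (insert j J)
  then show ?case using tangent_lincomb[of "u j" A p "\<lambda>f. \<Sum>j\<in>J. a j * u j f" "a j" 1] by simp
qed

text \<open>A derivation sees only the germ at \<open>p\<close>. Used whenever an identity known on
  \<open>W\<close> only, such as \<star>\<Phi> = \<Phi> or the orthonormality of a frame, is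
  differentiated at \<open>p\<close>.\<close>

lemma tangent_local:
  assumes "u \<in> tangent_space A p" "p \<in> W" "smooth_fun A W f" "smooth_fun A W h"
    "\<And>q. q \<in> W \<Longrightarrow> f q = h q"
  shows "u f = u h"
proof -
  have "eventually (\<lambda>q. f q = h q) (nhds p)"
    using assms(2,5) smooth_fun_openD[OF assms(3)] by (auto simp: eventually_nhds)
  then show ?thesis
    by (rule tangentD(1)[OF assms(1) smooth_atI[OF assms(3,2)] smooth_atI[OF assms(4,2)]])
qed

lemma tangent_apply_lincomb:
  assumes "smooth_atlas A" "u \<in> tangent_space A p" "smooth_at A p f" "smooth_at A p h"
  shows "u (\<lambda>q. a * f q + b * h q) = a * u f + b * u h"
  using tangentD(2)[OF assms(2) smooth_at_cmult[OF assms(1,3)] smooth_at_cmult[OF assms(1,4)]]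
    tangentD(3)[OF assms(2,3)] tangentD(3)[OF assms(2,4)] by simp

lemma tangent_apply_const:
  assumes "u \<in> tangent_space A p" "p \<in> points A" "open (points A)"
  shows "u (\<lambda>q. c) = 0"
proof -
  have s: "smooth_at A p (\<lambda>q. c)" for c
    using smooth_fun_const[of "points A" A] assms by (auto intro: smooth_atI)
  \<comment> \<open>The Leibniz rule for 1 = 1 * 1 gives u(1) = 2 u(1).\<close>
  have "u (\<lambda>q. 1 * 1) = u (\<lambda>q. 1) * 1 + 1 * u (\<lambda>q. 1)"
    using tangentD(4)[OF assms(1) s s, of 1 1] .
  then have "u (\<lambda>q. 1) = 0" by simp
  moreover have "u (\<lambda>q. c * 1) = c * u (\<lambda>q. 1)"
    using tangentD(3)[OF assms(1) s] .
  ultimately show ?thesis by simp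
qed

lemma open_points: "smooth_atlas A \<Longrightarrow> open (points A)"
  unfolding points_def smooth_atlas_def by (intro open_UN) auto

lemma tangent_apply_sum:
  assumes "smooth_atlas A" "u \<in> tangent_space A p" "p \<in> W" "finite J"
    "open W" "W \<subseteq> points A" "\<And>j. j \<in> J \<Longrightarrow> smooth_fun A W (F j)"
  shows "u (\<lambda>q. \<Sum>j\<in>J. F j q) = (\<Sum>j\<in>J. u (F j))"
  using assms(4,7)
proof (induction J rule: finite_induct)
  case empty
  then show ?case using tangent_apply_const[OF assms(2), of 0] assms open_points by auto
next
  case (insert j J)
  have "smooth_fun A W (\<lambda>q. \<Sum>j\<in>J. F j q)"
    using smooth_fun_sum assms insert by (metis insertCI)
  then have "u (\<lambda>q. 1 * F j q + 1 * (\<Sum>j\<in>J. F j q)) = 1 * u (F j) + 1 * u (\<lambda>q. \<Sum>j\<in>J. F j q)"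
    using assms insert by (intro tangent_apply_lincomb) (auto intro: smooth_atI)
  then show ?case using insert by simp
qed

section \<open>Smooth vector fields\<close>

lemma smooth_vfD:
  assumes "smooth_vf A W X"
  shows "open W" "W \<subseteq> points A" "q \<in> W \<Longrightarrow> X q \<in> tangent_space A q"
    "W' \<subseteq> W \<Longrightarrow> smooth_fun A W' f \<Longrightarrow> smooth_fun A W' (\<lambda>q. X q f)"
  using assms unfolding smooth_vf_def by auto

lemma smooth_vf_subset:
  "smooth_vf A W X \<Longrightarrow> open W' \<Longrightarrow> W' \<subseteq> W \<Longrightarrow> smooth_vf A W' X"
  unfolding smooth_vf_def by blast

lemma smooth_vfI:
  assumes "open W" "W \<subseteq> points A" "\<And>q. q \<in> W \<Longrightarrow> X q \<in> tangent_space A q"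
    "\<And>W' f. W' \<subseteq> W \<Longrightarrow> smooth_fun A W' f \<Longrightarrow> smooth_fun A W' (\<lambda>q. X q f)"
  shows "smooth_vf A W X"
  using assms unfolding smooth_vf_def by blast

lemma smooth_vf_cong:
  assumes "smooth_atlas A" "smooth_vf A W X" "\<And>q. q \<in> W \<Longrightarrow> X q = Y q"
  shows "smooth_vf A W Y"
proof (rule smooth_vfI)
  fix W' f assume *: "W' \<subseteq> W" "smooth_fun A W' f"
  show "smooth_fun A W' (\<lambda>p. Y p f)"
  proof (rule smooth_fun_cong[OF assms(1)])
    show "smooth_fun A W' (\<lambda>q. X q f)" by (rule smooth_vfD(4)[OF assms(2) *])
    show "X q f = Y q f" if "q \<in> W'" for q using assms(3) that *(1) by (metis subsetD)
  qed
next
  fix q assume "q \<in> W"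
  then show "Y q \<in> tangent_space A q"
    using smooth_vfD(3)[OF assms(2), of q] assms(3)[of q] by simp
qed (rule smooth_vfD(1,2)[OF assms(2)])+

lemma smooth_vf_lincomb:
  assumes "smooth_atlas A" "smooth_vf A W X" "smooth_vf A W Y"
  shows "smooth_vf A W (\<lambda>q f. a * X q f + b * Y q f)"
proof (rule smooth_vfI)
  fix W' f assume *: "W' \<subseteq> W" "smooth_fun A W' f"
  show "smooth_fun A W' (\<lambda>q. a * X q f + b * Y q f)"
    by (rule smooth_fun_lincomb[OF assms(1) smooth_vfD(4)[OF assms(2) *] smooth_vfD(4)[OF assms(3) *]])
next
  fix q assume "q \<in> W"
  then show "(\<lambda>f. a * X q f + b * Y q f) \<in> tangent_space A q"
    using tangent_lincomb smooth_vfD(3) assms(2,3) by metis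
qed (rule smooth_vfD(1,2)[OF assms(2)])+

lemma smooth_vf_zero:
  assumes "open W" "W \<subseteq> points A"
  shows "smooth_vf A W (\<lambda>q f. 0)"
  by (rule smooth_vfI) (use assms in \<open>simp_all add: tangent_zero smooth_fun_const smooth_fun_openD\<close>)

lemma smooth_vf_sum:
  assumes "smooth_atlas A" "open W" "W \<subseteq> points A" "finite J"
    "\<And>j. j \<in> J \<Longrightarrow> smooth_vf A W (X j)"
  shows "smooth_vf A W (\<lambda>q f. \<Sum>j\<in>J. a j * X j q f)"
  using assms(4,5)
proof (induction J rule: finite_induct)
  case empty
  then show ?case using smooth_vf_zero assms by simp
next
  case (insert j J)
  then show ?case
    using smooth_vf_lincomb[OF assms(1), of W "X j" "\<lambda>q f. \<Sum>j\<in>J. a j * X j q f" "a j" 1] by simp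
qed

section \<open>Alternating forms\<close>

text \<open>Only adjacent exchanges, and entries of any type: the notion has to cover alternating
  forms on tangent vectors as well as \<open>csign\<close> and \<open>phi\<close> on lists of
  indices.\<close>

definition antisym_form :: "('a list \<Rightarrow> real) \<Rightarrow> bool" where
  "antisym_form \<omega> \<longleftrightarrow> (\<forall>us x y ws. \<omega> (us @ x # y # ws) = - \<omega> (us @ y # x # ws))"

lemma antisym_formD: "antisym_form \<omega> \<Longrightarrow> \<omega> (us @ x # y # ws) = - \<omega> (us @ y # x # ws)"
  unfolding antisym_form_def by blast

lemma antisym_form_move:
  assumes "antisym_form \<omega>"
  shows "\<omega> (us @ x # ys @ zs) = (-1) ^ length ys * \<omega> (us @ ys @ x # zs)"
proof (induction ys arbitrary: us)
  case (Cons y ys)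
  have "\<omega> (us @ x # y # ys @ zs) = - \<omega> ((us @ [y]) @ x # ys @ zs)"
    using antisym_formD[OF assms, of us x y "ys @ zs"] by simp
  also have "\<dots> = - ((-1) ^ length ys * \<omega> ((us @ [y]) @ ys @ x # zs))"
    by (subst Cons.IH) simp
  finally show ?case by simp
qed simp

lemma antisym_form_not_distinct:
  assumes "antisym_form \<omega>" "\<not> distinct vs"
  shows "\<omega> vs = 0"
proof -
  obtain us ys zs x where vs: "vs = us @ x # ys @ x # zs"
    using not_distinct_decomp[OF assms(2)] by auto
  have "\<omega> (us @ ys @ x # x # zs) = 0"
    using antisym_formD[OF assms(1), of "us @ ys" x x zs] by simp
  then show ?thesis using antisym_form_move[OF assms(1), of us x ys "x # zs"] vs by simp
qed

text \<open>Insertion sort changes the value by a sign that is not recorded, hence the absolute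
  values; only vanishing is transferred from increasing lists to arbitrary ones.\<close>

lemma antisym_form_sort:
  assumes "antisym_form \<omega>"
  shows "\<bar>\<omega> (us @ map e (sort js))\<bar> = \<bar>\<omega> (us @ map e js)\<bar>"
proof (induction js arbitrary: us)
  case (Cons j js)
  obtain as bs where ab: "sort js = as @ bs" "insort j (sort js) = as @ j # bs"
  proof -
    have "\<exists>as bs. xs = as @ bs \<and> insort j xs = as @ j # bs" for xs
    proof (induction xs)
      case (Cons x xs)
      then obtain as bs where *: "xs = as @ bs" "insort j xs = as @ j # bs" by blast
      show ?case
      proof (cases "j \<le> x")
        case True
        then have "x # xs = [] @ (x # xs) \<and> insort j (x # xs) = [] @ j # x # xs" by simp
          then show ?thesis by blast
      next
        case False
        then have "x # xs = (x # as) @ bs \<and> insort j (x # xs) = (x # as) @ j # bs" using * by simp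
          then show ?thesis by blast
      qed
    qed auto
    then show ?thesis using that by blast
  qed
  have "\<bar>\<omega> (us @ map e (sort (j # js)))\<bar> = \<bar>\<omega> (us @ e j # map e (sort js))\<bar>"
    using antisym_form_move[OF assms, of us "e j" "map e as" "map e bs"] ab
    by (simp add: abs_mult)
  also have "\<dots> = \<bar>\<omega> ((us @ [e j]) @ map e js)\<bar>"
    using Cons.IH[of "us @ [e j]"] by simp
  finally show ?case by simp
qed simp

lemma alt_form_lin:
  "alt_form A p k \<omega> \<Longrightarrow> set us \<subseteq> tangent_space A p \<Longrightarrow> set ws \<subseteq> tangent_space A p \<Longrightarrow>
    u \<in> tangent_space A p \<Longrightarrow> v \<in> tangent_space A p \<Longrightarrow>
    \<omega> (us @ (\<lambda>f. a * u f + b * v f) # ws) = a * \<omega> (us @ u # ws) + b * \<omega> (us @ v # ws)"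
  unfolding alt_form_def by (elim conjE allE[of _ us] allE[of _ u] allE[of _ v] allE[of _ ws]) simp

lemma alt_form_zero: "alt_form A p k \<omega> \<Longrightarrow> \<not> (length vs = k \<and> set vs \<subseteq> tangent_space A p) \<Longrightarrow> \<omega> vs = 0"
  unfolding alt_form_def by blast

lemma alt_form_nd: "alt_form A p k \<omega> \<Longrightarrow> \<not> distinct vs \<Longrightarrow> \<omega> vs = 0"
  unfolding alt_form_def by blast

lemma alt_form_antisym:
  assumes "alt_form A p k \<omega>"
  shows "antisym_form \<omega>"
  unfolding antisym_form_def
proof (intro allI)
  fix us ws :: "'a tvec list" and x y :: "'a tvec"
  show "\<omega> (us @ x # y # ws) = - \<omega> (us @ y # x # ws)"
  proof (cases "set us \<union> {x, y} \<union> set ws \<subseteq> tangent_space A p")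
    case True
    \<comment> \<open>Polarisation: put x + y into both slots, expand, and drop the diagonal
      terms.\<close>
    define z where "z = (\<lambda>f. 1 * x f + 1 * y f)"
    have z: "z \<in> tangent_space A p" unfolding z_def using True by (intro tangent_lincomb) auto
    have lin1: "\<omega> (us @ z # w # ws) = \<omega> (us @ x # w # ws) + \<omega> (us @ y # w # ws)"
      if "w \<in> tangent_space A p" for w
      unfolding z_def using alt_form_lin[OF assms, of us "w # ws" x y 1 1] True that by simp
    have lin2: "\<omega> (us @ w # z # ws) = \<omega> (us @ w # x # ws) + \<omega> (us @ w # y # ws)"
      if "w \<in> tangent_space A p" for w
      unfolding z_def using alt_form_lin[OF assms, of "us @ [w]" ws x y 1 1] True that by simp
    have eq: "\<omega> (us @ w # w # ws) = 0" for w by (rule alt_form_nd[OF assms]) simp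
    show ?thesis using lin1[OF z] lin2[of x] lin2[of y] eq[of x] eq[of y] eq[of z] True by simp
  next
    case False
    then have "\<omega> (us @ x # y # ws) = 0" "\<omega> (us @ y # x # ws) = 0"
      by (auto intro!: alt_form_zero[OF assms])
    then show ?thesis by simp
  qed
qed

lemma alt_form_sum:
  assumes "alt_form A p k \<omega>" "set us \<subseteq> tangent_space A p" "set ws \<subseteq> tangent_space A p"
    "finite J" "\<And>j. j \<in> J \<Longrightarrow> e j \<in> tangent_space A p"
  shows "\<omega> (us @ (\<lambda>f. \<Sum>j\<in>J. a j * e j f) # ws) = (\<Sum>j\<in>J. a j * \<omega> (us @ e j # ws))"
  using assms(4,5)
proof (induction J rule: finite_induct)
  case empty
  then show ?case
    using alt_form_lin[OF assms(1-3) tangent_zero tangent_zero, of 0 0] by simp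
next
  case (insert j J)
  have "(\<lambda>f. \<Sum>j\<in>J. a j * e j f) \<in> tangent_space A p"
    using insert by (intro tangent_sum) auto
  from alt_form_lin[OF assms(1-3) _ this, of "e j" "a j" 1] show ?case using insert by simp
qed

lemma alt_form_lincomb:
  assumes "alt_form A p k \<alpha>" "alt_form A p k \<beta>"
  shows "alt_form A p k (\<lambda>vs. a * \<alpha> vs + b * \<beta> vs)"
  unfolding alt_form_def
proof (intro conjI allI impI)
  fix us ws u v c d
  assume "set us \<union> {u, v} \<union> set ws \<subseteq> tangent_space A p"
  then show "a * \<alpha> (us @ (\<lambda>f. c * u f + d * v f) # ws) + b * \<beta> (us @ (\<lambda>f. c * u f + d * v f) # ws) =
      c * (a * \<alpha> (us @ u # ws) + b * \<beta> (us @ u # ws)) + d * (a * \<alpha> (us @ v # ws) + b * \<beta> (us @ v # ws))"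
    using alt_form_lin[OF assms(1), of us ws u v c d] alt_form_lin[OF assms(2), of us ws u v c d]
    by (simp add: algebra_simps)
qed (simp_all add: alt_form_zero[OF assms(1)] alt_form_zero[OF assms(2)]
    alt_form_nd[OF assms(1)] alt_form_nd[OF assms(2)])

lemma alt_formI:
  assumes "\<And>vs. \<not> (length vs = k \<and> set vs \<subseteq> tangent_space A p) \<Longrightarrow> \<omega> vs = 0"
    and "\<And>us u v ws a b. set us \<subseteq> tangent_space A p \<Longrightarrow> u \<in> tangent_space A p \<Longrightarrow> v \<in> tangent_space A p \<Longrightarrow>
      set ws \<subseteq> tangent_space A p \<Longrightarrow>
      \<omega> (us @ (\<lambda>f. a * u f + b * v f) # ws) = a * \<omega> (us @ u # ws) + b * \<omega> (us @ v # ws)"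
    and "antisym_form \<omega>"
  shows "alt_form A p k \<omega>"
  using assms antisym_form_not_distinct[OF assms(3)] unfolding alt_form_def by simp

text \<open>The difference vanishes on increasing frame lists, hence up to sign on all frame lists;
  multilinearity then replaces frame vectors by arbitrary ones.\<close>

lemma alt_form_eqI:
  fixes e :: "nat \<Rightarrow> 'm::topological_space tvec"
  assumes "alt_form A p k \<alpha>" "alt_form A p k \<beta>"
    and e: "\<And>i. i < n \<Longrightarrow> e i \<in> tangent_space A p"
    and span: "\<And>v. v \<in> tangent_space A p \<Longrightarrow> \<exists>a. v = (\<lambda>f. \<Sum>i<n. a i * e i f)"
    and eq: "\<And>js. length js = k \<Longrightarrow> sorted js \<Longrightarrow> distinct js \<Longrightarrow> set js \<subseteq> {..<n} \<Longrightarrow>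
      \<alpha> (map e js) = \<beta> (map e js)"
  shows "\<alpha> = \<beta>"
proof -
  define \<omega> where "\<omega> = (\<lambda>vs. 1 * \<alpha> vs + (-1) * \<beta> vs)"
  have \<omega>: "alt_form A p k \<omega>" unfolding \<omega>_def by (rule alt_form_lincomb[OF assms(1,2)])
  note anti = alt_form_antisym[OF \<omega>]
  have frame: "\<omega> (map e js) = 0" if js: "set js \<subseteq> {..<n}" for js
  proof (cases "length js = k \<and> distinct (map e js)")
    case True
    then have "distinct (sort js)" by (auto simp: distinct_map)
    then have "\<omega> (map e (sort js)) = 0"
      using eq[of "sort js"] True js unfolding \<omega>_def by simp
    then show ?thesis using antisym_form_sort[OF anti, of "[]" e js] by simp
  next
    case False
    then show ?thesis using alt_form_zero[OF \<omega>] alt_form_nd[OF \<omega>] by auto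
  qed
  \<comment> \<open>Arbitrary vectors stand in front of frame vectors. Expanding the last arbitrary
    one turns it into one more frame vector.\<close>
  have "\<omega> (us @ map e js) = 0" if "set js \<subseteq> {..<n}" "set us \<subseteq> tangent_space A p" for us js
    using that
  proof (induction us arbitrary: js rule: rev_induct)
    case Nil
    then show ?case using frame by simp
  next
    case (snoc v us)
    obtain a where v: "v = (\<lambda>f. \<Sum>i<n. a i * e i f)" using span snoc.prems by fastforce
    have "\<omega> (us @ (\<lambda>f. \<Sum>i<n. a i * e i f) # map e js) = (\<Sum>i<n. a i * \<omega> (us @ e i # map e js))"
      using snoc.prems e by (intro alt_form_sum[OF \<omega>]) auto
    also have "\<dots> = 0" using snoc.IH[of "_ # js"] snoc.prems by (intro sum.neutral) auto
    finally show ?case using v by simp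
  qed
  from this[of "[]"] have "\<omega> vs = 0" if "set vs \<subseteq> tangent_space A p" for vs
    using that by simp
  then have "\<omega> vs = 0" for vs using alt_form_zero[OF \<omega>] by blast
  then show ?thesis unfolding \<omega>_def by (auto simp: fun_eq_iff)
qed

text \<open>The sum over subsets in \<open>wedge\<close> as a recursion that simplification can run
  on concrete lists. A head that goes to the second list passes all of \<open>ys\<close>, whence the
  sign. \<open>F\<close> is an arbitrary function of both lists, so that inductions can absorb the
  head into it.\<close>

fun shuffle_sum :: "('a list \<Rightarrow> 'a list \<Rightarrow> real) \<Rightarrow> 'a list \<Rightarrow> real" where
  "shuffle_sum F [] = F [] []"
| "shuffle_sum F (x # xs) = shuffle_sum (\<lambda>ys zs. F (x # ys) zs) xs +
     shuffle_sum (\<lambda>ys zs. (-1) ^ length ys * F ys (x # zs)) xs"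

lemma shuffle_sum_cong:
  "(\<And>ys zs. length ys + length zs = length xs \<Longrightarrow> set ys \<union> set zs = set xs \<Longrightarrow> F ys zs = G ys zs) \<Longrightarrow>
    shuffle_sum F xs = shuffle_sum G xs"
proof (induction xs arbitrary: F G)
  case (Cons x xs)
  have "shuffle_sum (\<lambda>ys zs. F (x # ys) zs) xs = shuffle_sum (\<lambda>ys zs. G (x # ys) zs) xs"
    by (rule Cons.IH, rule Cons.prems) auto
  moreover have "shuffle_sum (\<lambda>ys zs. (-1) ^ length ys * F ys (x # zs)) xs =
      shuffle_sum (\<lambda>ys zs. (-1) ^ length ys * G ys (x # zs)) xs"
    by (rule Cons.IH, subst Cons.prems) auto
  ultimately show ?case by simp
qed simp

lemma shuffle_sum_lincomb:
  "shuffle_sum (\<lambda>ys zs. a * F ys zs + b * G ys zs) xs = a * shuffle_sum F xs + b * shuffle_sum G xs"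
proof (induction xs arbitrary: F G)
  case (Cons x xs)
  have "(\<lambda>ys zs. (-1) ^ length ys * (a * F ys (x # zs) + b * G ys (x # zs))) =
    (\<lambda>ys zs. a * ((-1) ^ length ys * F ys (x # zs)) + b * ((-1) ^ length ys * G ys (x # zs)))"
    by (simp add: algebra_simps)
  then show ?case
    using Cons.IH[of "\<lambda>ys zs. F (x # ys) zs" "\<lambda>ys zs. G (x # ys) zs"]
      Cons.IH[of "\<lambda>ys zs. (-1) ^ length ys * F ys (x # zs)" "\<lambda>ys zs. (-1) ^ length ys * G ys (x # zs)"]
    by (simp add: algebra_simps)
qed simp

lemma shuffle_sum_minus: "shuffle_sum (\<lambda>ys zs. - F ys zs) xs = - shuffle_sum F xs"
  using shuffle_sum_lincomb[of "-1" F 0 F xs] by simp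

lemma shuffle_sum_zero: "shuffle_sum (\<lambda>ys zs. 0) xs = 0"
  using shuffle_sum_lincomb[of 0 "\<lambda>ys zs. 0" 0 "\<lambda>ys zs. 0" xs] by simp

lemma shuffle_sum_map:
  "shuffle_sum F (map e js) = shuffle_sum (\<lambda>ys zs. F (map e ys) (map e zs)) js"
  by (induction js arbitrary: F) simp_all

lemma sum_Pow_lessThan_Suc:
  fixes H :: "nat set \<Rightarrow> 'b::comm_monoid_add"
  shows "(\<Sum>S\<in>Pow {..<Suc n}. H S) =
    (\<Sum>S\<in>Pow {..<n}. H (insert 0 (Suc ` S))) + (\<Sum>S\<in>Pow {..<n}. H (Suc ` S))"
proof -
  have "Pow {..<Suc n} = (\<lambda>S. insert 0 (Suc ` S)) ` Pow {..<n} \<union> (`) Suc ` Pow {..<n}" (is "_ = ?R")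
  proof (intro equalityI subsetI)
    fix S assume S: "S \<in> Pow {..<Suc n}"
    define S' where "S' = {j. Suc j \<in> S}"
    have "S' \<in> Pow {..<n}" "S = (if 0 \<in> S then insert 0 (Suc ` S') else Suc ` S')"
      using S unfolding S'_def by (auto simp: image_iff) (metis not0_implies_Suc)+
    then show "S \<in> ?R" by (metis UnI1 UnI2 imageI)
  qed auto
  moreover have "inj_on (\<lambda>S. insert 0 (Suc ` S)) (Pow {..<n})"
    by (auto simp: inj_on_def)
  moreover have "inj_on ((`) Suc) (Pow {..<n})"
    by (auto simp: inj_on_def)
  moreover have "(\<lambda>S. insert 0 (Suc ` S)) ` Pow {..<n} \<inter> (`) Suc ` Pow {..<n} = {}" by auto
  ultimately show ?thesis by (simp add: sum.union_disjoint sum.reindex)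
qed

text \<open>Position 0 outside the set forms an inversion with each of the \<open>card S\<close>
  elements of the set; inside the set it forms none.\<close>

lemma shuffle_sign_Suc:
  assumes "S \<subseteq> {..<n}"
  shows "shuffle_sign (Suc n) (Suc ` S) = (-1) ^ card S * shuffle_sign n S"
    and "shuffle_sign (Suc n) (insert 0 (Suc ` S)) = shuffle_sign n S"
proof -
  let ?I = "{(i, j). i < j \<and> j < n \<and> i \<notin> S \<and> j \<in> S}"
  have fin: "finite S" "finite ?I"
    using assms finite_subset by (auto intro: finite_subset[of _ "{..<n} \<times> {..<n}"])
  have c: "card (map_prod Suc Suc ` ?I) = card ?I"
    by (rule card_image) (auto simp: inj_on_def)
  have "{(i, j). i < j \<and> j < Suc n \<and> i \<notin> insert 0 (Suc ` S) \<and> j \<in> insert 0 (Suc ` S)} =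
      map_prod Suc Suc ` ?I" (is "?L = ?R")
  proof (intro equalityI subsetI)
    fix x assume "x \<in> ?L"
    then obtain i j where x: "x = (i, j)" "i < j" "j < Suc n" "i \<noteq> 0" "i \<notin> Suc ` S" "j \<in> Suc ` S"
      by auto
    then obtain i' j' where "i = Suc i'" "j = Suc j'" using not0_implies_Suc by blast
    then show "x \<in> ?R" using x by (auto simp: image_iff)
  qed auto
  then show "shuffle_sign (Suc n) (insert 0 (Suc ` S)) = shuffle_sign n S"
    unfolding shuffle_sign_def using c by simp
  have "{(i, j). i < j \<and> j < Suc n \<and> i \<notin> Suc ` S \<and> j \<in> Suc ` S} =
      (\<lambda>j. (0, Suc j)) ` S \<union> map_prod Suc Suc ` ?I" (is "?L = ?R")
  proof (intro equalityI subsetI)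
    fix x assume "x \<in> ?L"
    then obtain i j where x: "x = (i, Suc j)" "i < Suc j" "j < n" "i \<notin> Suc ` S" "j \<in> S" by auto
    then show "x \<in> ?R" by (cases i) (auto simp: image_iff)
  qed (use assms in auto)
  moreover have "(\<lambda>j. (0, Suc j)) ` S \<inter> map_prod Suc Suc ` ?I = {}" by auto
  moreover have "card ((\<lambda>j. (0::nat, Suc j)) ` S) = card S"
    by (rule card_image) (auto simp: inj_on_def)
  ultimately show "shuffle_sign (Suc n) (Suc ` S) = (-1) ^ card S * shuffle_sign n S"
    unfolding shuffle_sign_def using c fin by (simp add: card_Un_disjoint power_add)
qed

lemma sum_shuffle_sign:
  "(\<Sum>S\<in>Pow {..<length vs}. shuffle_sign (length vs) S * F (nths vs S) (nths vs (- S))) = shuffle_sum F vs"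
proof (induction vs arbitrary: F)
  case Nil
  then show ?case by (simp add: shuffle_sign_def)
next
  case (Cons x xs)
  let ?n = "length xs"
  have sets: "{j. Suc j \<in> insert 0 (Suc ` S)} = S" "{j. Suc j \<in> Suc ` S} = S"
    "{j. Suc j \<notin> insert 0 (Suc ` S)} = - S" "{j. Suc j \<notin> Suc ` S} = - S" for S by auto
  have "(\<Sum>S\<in>Pow {..<?n}. shuffle_sign (Suc ?n) (insert 0 (Suc ` S)) *
        F (nths (x # xs) (insert 0 (Suc ` S))) (nths (x # xs) (- insert 0 (Suc ` S)))) =
      shuffle_sum (\<lambda>ys zs. F (x # ys) zs) xs"
    unfolding Cons.IH[symmetric]
    by (rule sum.cong[OF refl]) (use sets in \<open>simp add: shuffle_sign_Suc nths_Cons\<close>)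
  moreover have "(\<Sum>S\<in>Pow {..<?n}. shuffle_sign (Suc ?n) (Suc ` S) *
        F (nths (x # xs) (Suc ` S)) (nths (x # xs) (- Suc ` S))) =
      shuffle_sum (\<lambda>ys zs. (-1) ^ length ys * F ys (x # zs)) xs"
    unfolding Cons.IH[symmetric]
  proof (rule sum.cong[OF refl])
    fix S assume S: "S \<in> Pow {..<?n}"
    have "length (nths xs S) = card {i. i < ?n \<and> i \<in> S}" by (rule length_nths)
    also have "{i. i < ?n \<and> i \<in> S} = S" using S by auto
    finally show "shuffle_sign (Suc ?n) (Suc ` S) *
          F (nths (x # xs) (Suc ` S)) (nths (x # xs) (- Suc ` S)) =
        shuffle_sign ?n S * ((-1) ^ length (nths xs S) * F (nths xs S) (x # nths xs (- S)))"
      using sets S by (simp add: shuffle_sign_Suc nths_Cons)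
  qed
  ultimately show ?case by (simp add: sum_Pow_lessThan_Suc)
qed

lemma wedge_eq_shuffle_sum: "wedge \<alpha> \<beta> vs = shuffle_sum (\<lambda>ys zs. \<alpha> ys * \<beta> zs) vs"
  using sum_shuffle_sign[of vs "\<lambda>ys zs. \<alpha> ys * \<beta> zs"] by (simp add: wedge_def mult.assoc)

text \<open>If x and y go to the same list, antisymmetry of \<open>F\<close> applies. If they are
  separated, the terms of the two sums match up to a sign, since in one of the two orders the later
  list entry has to pass the other one.\<close>

lemma shuffle_sum_swap:
  assumes "\<And>as x y bs cs. F (as @ x # y # bs) cs = - F (as @ y # x # bs) cs"
    "\<And>as x y bs cs. F cs (as @ x # y # bs) = - F cs (as @ y # x # bs)"
  shows "shuffle_sum F (us @ x # y # ws) = - shuffle_sum F (us @ y # x # ws)"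
  using assms
proof (induction us arbitrary: F)
  case Nil
  have 1: "shuffle_sum (\<lambda>ys zs. F (x # y # ys) zs) ws = - shuffle_sum (\<lambda>ys zs. F (y # x # ys) zs) ws"
    unfolding shuffle_sum_minus[symmetric] by (rule shuffle_sum_cong) (rule Nil(1)[of "[]", simplified])
  have 2: "shuffle_sum (\<lambda>ys zs. (-1) ^ length ys * ((-1) ^ length ys * F ys (x # y # zs))) ws =
      - shuffle_sum (\<lambda>ys zs. (-1) ^ length ys * ((-1) ^ length ys * F ys (y # x # zs))) ws"
    unfolding shuffle_sum_minus[symmetric]
    by (rule shuffle_sum_cong) (subst Nil(2)[of _ "[]", simplified], simp)
  have 3: "shuffle_sum (\<lambda>ys zs. - ((-1) ^ length ys * F (a # ys) (b # zs))) ws =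
      - shuffle_sum (\<lambda>ys zs. (-1) ^ length ys * F (a # ys) (b # zs)) ws" for a b
    by (rule shuffle_sum_minus)
  show ?case using 1 2 3[of x y] 3[of y x] by simp
next
  case (Cons u us)
  have "shuffle_sum (\<lambda>ys zs. F (u # ys) zs) (us @ x # y # ws) =
      - shuffle_sum (\<lambda>ys zs. F (u # ys) zs) (us @ y # x # ws)"
    by (rule Cons.IH) (rule Cons.prems(1)[of "u # _", simplified], rule Cons.prems(2))
  moreover have "shuffle_sum (\<lambda>ys zs. (-1) ^ length ys * F ys (u # zs)) (us @ x # y # ws) =
      - shuffle_sum (\<lambda>ys zs. (-1) ^ length ys * F ys (u # zs)) (us @ y # x # ws)"
    by (rule Cons.IH) (subst Cons.prems(1), simp, subst Cons.prems(2)[of _ "u # _", simplified], simp)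
  ultimately show ?case by simp
qed

text \<open>\<open>T\<close> carries the restriction to tangent vectors, outside which a form is 0
  and not linear.\<close>

lemma shuffle_sum_lin:
  assumes "\<And>as bs cs. set as \<subseteq> T \<Longrightarrow> set bs \<subseteq> T \<Longrightarrow> set cs \<subseteq> T \<Longrightarrow>
      F (as @ z # bs) cs = a * F (as @ u # bs) cs + b * F (as @ v # bs) cs"
    "\<And>as bs cs. set as \<subseteq> T \<Longrightarrow> set bs \<subseteq> T \<Longrightarrow> set cs \<subseteq> T \<Longrightarrow>
      F cs (as @ z # bs) = a * F cs (as @ u # bs) + b * F cs (as @ v # bs)"
    "set us \<subseteq> T" "set ws \<subseteq> T"
  shows "shuffle_sum F (us @ z # ws) = a * shuffle_sum F (us @ u # ws) + b * shuffle_sum F (us @ v # ws)"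
  using assms
proof (induction us arbitrary: F)
  case Nil
  have 1: "shuffle_sum (\<lambda>ys zs. F (z # ys) zs) ws =
      a * shuffle_sum (\<lambda>ys zs. F (u # ys) zs) ws + b * shuffle_sum (\<lambda>ys zs. F (v # ys) zs) ws"
    unfolding shuffle_sum_lincomb[symmetric]
    by (rule shuffle_sum_cong) (use Nil(1)[of "[]"] Nil(4) in fastforce)
  have 2: "shuffle_sum (\<lambda>ys zs. (-1) ^ length ys * F ys (z # zs)) ws =
      a * shuffle_sum (\<lambda>ys zs. (-1) ^ length ys * F ys (u # zs)) ws +
      b * shuffle_sum (\<lambda>ys zs. (-1) ^ length ys * F ys (v # zs)) ws"
    unfolding shuffle_sum_lincomb[symmetric]
  proof (rule shuffle_sum_cong)
    fix ys zs assume "set ys \<union> set zs = set ws"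
    then have "F ys (z # zs) = a * F ys (u # zs) + b * F ys (v # zs)"
      using Nil(2)[of "[]" zs ys] Nil(4) by auto
    then show "(-1) ^ length ys * F ys (z # zs) =
        a * ((-1) ^ length ys * F ys (u # zs)) + b * ((-1) ^ length ys * F ys (v # zs))"
      by (simp add: algebra_simps)
  qed
  show ?case using 1 2 by (simp add: algebra_simps)
next
  case (Cons t us)
  have "shuffle_sum (\<lambda>ys zs. F (t # ys) zs) (us @ z # ws) =
      a * shuffle_sum (\<lambda>ys zs. F (t # ys) zs) (us @ u # ws) +
      b * shuffle_sum (\<lambda>ys zs. F (t # ys) zs) (us @ v # ws)"
    by (rule Cons.IH) (use Cons.prems(1)[of "t # _"] Cons.prems(2)[of _ _ "t # _"] Cons.prems(3,4) in simp_all)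
  moreover have "shuffle_sum (\<lambda>ys zs. (-1) ^ length ys * F ys (t # zs)) (us @ z # ws) =
      a * shuffle_sum (\<lambda>ys zs. (-1) ^ length ys * F ys (t # zs)) (us @ u # ws) +
      b * shuffle_sum (\<lambda>ys zs. (-1) ^ length ys * F ys (t # zs)) (us @ v # ws)"
    by (rule Cons.IH) (use Cons.prems(1)[of _ _ "t # _"] Cons.prems(2)[of "t # _"] Cons.prems(3,4) in
        \<open>simp_all add: algebra_simps\<close>)
  ultimately show ?case by (simp add: algebra_simps)
qed

lemma alt_form_wedge:
  assumes "alt_form A p k \<alpha>" "alt_form A p l \<beta>"
  shows "alt_form A p (k + l) (wedge \<alpha> \<beta>)"
proof (rule alt_formI)
  fix vs assume *: "\<not> (length vs = k + l \<and> set vs \<subseteq> tangent_space A p)"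
  have "shuffle_sum (\<lambda>ys zs. \<alpha> ys * \<beta> zs) vs = shuffle_sum (\<lambda>ys zs. 0) vs"
  proof (rule shuffle_sum_cong)
    fix ys zs assume "length ys + length zs = length vs" "set ys \<union> set zs = set vs"
    then have "\<not> (length ys = k \<and> set ys \<subseteq> tangent_space A p) \<or>
        \<not> (length zs = l \<and> set zs \<subseteq> tangent_space A p)" using * by auto
    then show "\<alpha> ys * \<beta> zs = 0"
      using alt_form_zero[OF assms(1), of ys] alt_form_zero[OF assms(2), of zs] by auto
  qed
  then show "wedge \<alpha> \<beta> vs = 0" by (simp add: wedge_eq_shuffle_sum shuffle_sum_zero)
next
  fix us ws u v a b
  assume "set us \<subseteq> tangent_space A p" "u \<in> tangent_space A p" "v \<in> tangent_space A p"
    "set ws \<subseteq> tangent_space A p"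
  then show "wedge \<alpha> \<beta> (us @ (\<lambda>f. a * u f + b * v f) # ws) =
      a * wedge \<alpha> \<beta> (us @ u # ws) + b * wedge \<alpha> \<beta> (us @ v # ws)"
    unfolding wedge_eq_shuffle_sum
    by (intro shuffle_sum_lin[where T="tangent_space A p"])
      (simp_all add: alt_form_lin[OF assms(1)] alt_form_lin[OF assms(2)] algebra_simps)
next
  note anti = antisym_formD[OF alt_form_antisym[OF assms(1)]] antisym_formD[OF alt_form_antisym[OF assms(2)]]
  show "antisym_form (wedge \<alpha> \<beta>)"
    unfolding antisym_form_def wedge_eq_shuffle_sum
    by (intro allI shuffle_sum_swap; subst anti; simp)
qed

section \<open>Components with respect to an orthonormal frame\<close>

text \<open>Pointwise and without \<Phi>: it has to fit \<open>frame_at\<close> as well as a local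
  adapted frame evaluated at a point.\<close>

definition orthonormal_frame ::
  "'m::topological_space chart set \<Rightarrow> 'm metric \<Rightarrow> 'm \<Rightarrow> (nat \<Rightarrow> 'm tvec) \<Rightarrow> bool" where
  "orthonormal_frame A g q e \<longleftrightarrow> (\<forall>i<8. e i \<in> tangent_space A q) \<and>
     (\<forall>v\<in>tangent_space A q. \<exists>a. v = (\<lambda>f. \<Sum>i<8. a i * e i f)) \<and>
     (\<forall>i<8. \<forall>j<8. g q (e i) (e j) = (if i = j then 1 else 0))"

lemma orthonormal_frameD:
  assumes "orthonormal_frame A g q e"
  shows "i < 8 \<Longrightarrow> e i \<in> tangent_space A q"
    and "v \<in> tangent_space A q \<Longrightarrow> \<exists>a. v = (\<lambda>f. \<Sum>i<8. a i * e i f)"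
    and "i < 8 \<Longrightarrow> j < 8 \<Longrightarrow> g q (e i) (e j) = (if i = j then 1 else 0)"
  using assms unfolding orthonormal_frame_def by auto

lemma frame_map_subset:
  "orthonormal_frame A g q e \<Longrightarrow> set js \<subseteq> {..<8} \<Longrightarrow> set (map e js) \<subseteq> tangent_space A q"
  by (auto intro: orthonormal_frameD(1))

text \<open>The exterior product with the coordinate 1-form of index \<open>i\<close>, on functions
  of index lists: an occurrence of \<open>i\<close> is removed with the sign of its
  position.\<close>

fun pick :: "'a \<Rightarrow> ('a list \<Rightarrow> real) \<Rightarrow> 'a list \<Rightarrow> real" where
  "pick i c [] = 0"
| "pick i c (x # xs) = (if x = i then c xs else 0) - pick i (\<lambda>zs. c (x # zs)) xs"

text \<open>\<open>csign is js\<close> is the value of \<open>e\<^sup>i\<^sup>1 \<and> e\<^sup>i\<^sup>2 \<and> \<dots>\<close> on \<open>[e\<^sub>j\<^sub>1, e\<^sub>j\<^sub>2, \<dots>]\<close>, expanded along the first index.\<close>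

fun csign :: "nat list \<Rightarrow> nat list \<Rightarrow> real" where
  "csign [] js = (if js = [] then 1 else 0)"
| "csign (i # is) js = pick i (csign is) js"

lemma shuffle_sum_Nil: "shuffle_sum (\<lambda>ys zs. (if ys = [] then 1 else 0) * c zs) xs = c xs"
proof (induction xs arbitrary: c)
  case (Cons x xs)
  have "shuffle_sum (\<lambda>ys zs. (-1) ^ length ys * ((if ys = [] then 1 else 0) * c (x # zs))) xs =
      shuffle_sum (\<lambda>ys zs. (if ys = [] then 1 else 0) * c (x # zs)) xs"
    by (rule shuffle_sum_cong) simp
  then show ?case using Cons.IH[of "\<lambda>zs. c (x # zs)"] by (simp add: shuffle_sum_zero)
qed simp

lemma shuffle_sum_singleton:
  "shuffle_sum (\<lambda>ys zs. (if ys = [i] then 1 else 0) * c zs) xs = pick i c xs"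
proof (induction xs arbitrary: c)
  case (Cons x xs)
  \<comment> \<open>The indicator forces \<open>ys\<close> to have length 1, so the sign is
    constantly -1.\<close>
  have "shuffle_sum (\<lambda>ys zs. (-1) ^ length ys * ((if ys = [i] then 1 else 0) * c (x # zs))) xs =
      shuffle_sum (\<lambda>ys zs. - ((if ys = [i] then 1 else 0) * c (x # zs))) xs"
    by (rule shuffle_sum_cong) simp
  also have "\<dots> = - pick i (\<lambda>zs. c (x # zs)) xs"
    by (simp only: shuffle_sum_minus Cons.IH)
  finally show ?case
    using shuffle_sum_Nil[of c xs] by (cases "x = i") (simp_all add: shuffle_sum_zero)
qed simp

lemma coframe_frame:
  assumes "orthonormal_frame A g q e" "i < 8" "set ys \<subseteq> {..<8}"
  shows "coframe A g q e i (map e ys) = (if ys = [i] then 1 else 0)"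
proof (cases ys)
  case (Cons y zs)
  then show ?thesis
    using assms orthonormal_frameD(1)[OF assms(1), of y] orthonormal_frameD(3)[OF assms(1), of y i]
    by (auto simp: coframe_def)
qed (simp add: coframe_def)

text \<open>The bridge from geometry to computation: components of wedge monomials become signs of
  index lists, which simplification can evaluate.\<close>

lemma coframe_form_frame:
  assumes "orthonormal_frame A g q e" "set is \<subseteq> {..<8}" "set js \<subseteq> {..<8}"
  shows "coframe_form A g q e is (map e js) = csign is js"
  using assms(2,3)
proof (induction "is" arbitrary: js)
  case Nil
  then show ?case by (simp add: coframe_form_def)
next
  case (Cons i "is")
  have "coframe_form A g q e (i # is) (map e js) =
      shuffle_sum (\<lambda>ys zs. coframe A g q e i (map e ys) * coframe_form A g q e is (map e zs)) js"
    by (simp add: coframe_form_def wedge_eq_shuffle_sum shuffle_sum_map)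
  also have "\<dots> = shuffle_sum (\<lambda>ys zs. (if ys = [i] then 1 else 0) * csign is zs) js"
  proof (rule shuffle_sum_cong)
    fix ys zs assume "set ys \<union> set zs = set js"
    then have "set ys \<subseteq> {..<8}" "set zs \<subseteq> {..<8}" using Cons.prems(2) by auto
    then show "coframe A g q e i (map e ys) * coframe_form A g q e is (map e zs) =
        (if ys = [i] then 1 else 0) * csign is zs"
      using Cons.IH[of zs] Cons.prems(1) coframe_frame[OF assms(1), of i ys] by simp
  qed
  finally show ?case by (simp only: shuffle_sum_singleton csign.simps)
qed

lemma riemannian_metricD:
  assumes "riemannian_metric A g" "q \<in> points A"
    "u \<in> tangent_space A q" "v \<in> tangent_space A q" "w \<in> tangent_space A q"
  shows "g q (\<lambda>f. a * u f + b * v f) w = a * g q u w + b * g q v w"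
    and "g q u v = g q v u"
    and "u \<noteq> (\<lambda>f. 0) \<Longrightarrow> g q u u > 0"
  using assms unfolding riemannian_metric_def by blast+

lemma coframe_alt_form:
  assumes "riemannian_metric A g" "q \<in> points A" "e i \<in> tangent_space A q"
  shows "alt_form A q 1 (coframe A g q e i)"
proof (rule alt_formI)
  show "coframe A g q e i vs = 0" if "\<not> (length vs = 1 \<and> set vs \<subseteq> tangent_space A q)" for vs
    using that by (cases vs) (auto simp: coframe_def)
next
  fix us ws u v a b
  assume "u \<in> tangent_space A q" "v \<in> tangent_space A q"
  then show "coframe A g q e i (us @ (\<lambda>f. a * u f + b * v f) # ws) =
      a * coframe A g q e i (us @ u # ws) + b * coframe A g q e i (us @ v # ws)"
    using riemannian_metricD(1)[OF assms(1,2) _ _ assms(3), of u v a b] tangent_lincomb[of u A q v a b]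
    by (cases us) (simp_all add: coframe_def)
qed (simp add: antisym_form_def coframe_def)

lemma coframe_form_alt_form:
  assumes "riemannian_metric A g" "q \<in> points A" "\<And>i. i \<in> set is \<Longrightarrow> e i \<in> tangent_space A q"
  shows "alt_form A q (length is) (coframe_form A g q e is)"
  using assms(3)
proof (induction "is")
  case Nil
  show ?case by (rule alt_formI) (auto simp: coframe_form_def antisym_form_def)
next
  case (Cons i "is")
  then have "alt_form A q (1 + length is) (wedge (coframe A g q e i) (coframe_form A g q e is))"
    using assms by (intro alt_form_wedge coframe_alt_form) auto
  then show ?case by (simp add: coframe_form_def)
qed

lemma alt_form_append:
  assumes "alt_form A q k \<omega>" "set us \<subseteq> tangent_space A q" "length us \<le> k"
  shows "alt_form A q (k - length us) (\<lambda>vs. \<omega> (us @ vs))"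
proof (rule alt_formI)
  show "\<omega> (us @ vs) = 0" if "\<not> (length vs = k - length us \<and> set vs \<subseteq> tangent_space A q)" for vs
    using that assms by (intro alt_form_zero[OF assms(1)]) auto
  show "antisym_form (\<lambda>vs. \<omega> (us @ vs))"
    using antisym_formD[OF alt_form_antisym[OF assms(1)], of "us @ _"]
    unfolding antisym_form_def by (metis append.assoc)
next
  fix us' ws u v a b
  assume "set us' \<subseteq> tangent_space A q" "u \<in> tangent_space A q" "v \<in> tangent_space A q"
    "set ws \<subseteq> tangent_space A q"
  then show "\<omega> (us @ us' @ (\<lambda>f. a * u f + b * v f) # ws) =
      a * \<omega> (us @ us' @ u # ws) + b * \<omega> (us @ us' @ v # ws)"
    using alt_form_lin[OF assms(1), of "us @ us'" ws u v a b] assms(2) by simp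
qed

lemma alt_form_const_zero: "alt_form A q k (\<lambda>vs. 0)"
  by (rule alt_formI) (auto simp: antisym_form_def)

lemma alt_form_sum_forms:
  assumes "finite J" "\<And>j. j \<in> J \<Longrightarrow> alt_form A q k (\<omega> j)"
  shows "alt_form A q k (\<lambda>vs. \<Sum>j\<in>J. c j * \<omega> j vs)"
  using assms
proof (induction J rule: finite_induct)
  case empty
  then show ?case by (simp add: alt_form_const_zero)
next
  case (insert j J)
  then show ?case
    using alt_form_lincomb[of A q k "\<omega> j" "\<lambda>vs. \<Sum>j\<in>J. c j * \<omega> j vs" "c j" 1] by simp
qed

text \<open>Sums over this list unfold term by term when \<open>xs\<close> is explicit, in contrast
  to sums over \<open>Pow\<close>.\<close>

fun ksubs :: "nat \<Rightarrow> 'a list \<Rightarrow> 'a list list" where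
  "ksubs 0 xs = [[]]"
| "ksubs (Suc k) [] = []"
| "ksubs (Suc k) (x # xs) = map ((#) x) (ksubs k xs) @ ksubs (Suc k) xs"

lemma filter_in_ksubs: "filter P xs \<in> set (ksubs (length (filter P xs)) xs)"
proof (induction xs)
  case (Cons x xs)
  then show ?case by (cases "length (filter P xs)") auto
qed simp

lemma sum_Pow_nths:
  fixes F :: "'a list \<Rightarrow> real"
  assumes "\<And>ys. length ys \<noteq> k \<Longrightarrow> F ys = 0"
  shows "(\<Sum>I\<in>Pow {..<length xs}. F (nths xs I)) = (\<Sum>ys\<leftarrow>ksubs k xs. F ys)"
  using assms
proof (induction xs arbitrary: F k)
  case Nil
  then show ?case by (cases k) auto
next
  case (Cons x xs)
  have sets: "{j. Suc j \<in> insert 0 (Suc ` S)} = S" "{j. Suc j \<in> Suc ` S} = S" for S by auto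
  have *: "(\<Sum>I\<in>Pow {..<length (x # xs)}. F (nths (x # xs) I)) =
      (\<Sum>S\<in>Pow {..<length xs}. F (x # nths xs S)) + (\<Sum>S\<in>Pow {..<length xs}. F (nths xs S))"
    by (simp only: list.size(4) add_Suc_right add_0_right sum_Pow_lessThan_Suc nths_Cons sets) simp
  show ?case
  proof (cases k)
    case 0
    have "(\<Sum>I\<in>Pow {..<length xs}. F (nths xs I)) = F []"
      using Cons.IH[of k F] Cons.prems 0 by simp
    then show ?thesis using * Cons.prems 0 by simp
  next
    case (Suc l)
    have "(\<Sum>S\<in>Pow {..<length xs}. F (x # nths xs S)) = (\<Sum>ys\<leftarrow>ksubs l xs. F (x # ys))"
      by (rule Cons.IH) (use Cons.prems Suc in simp)
    then show ?thesis using * Cons.IH[of k F] Cons.prems Suc by (simp add: o_def)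
  qed
qed

lemma sorted_subset_filter:
  assumes "sorted js" "distinct js" "set js \<subseteq> {..<n}"
  shows "js = filter (\<lambda>i. i \<in> set js) [0..<n]"
  using assms by (intro sorted_distinct_set_unique) (auto simp: sorted_wrt_filter)

lemma alt_form_frame_eqI:
  assumes "orthonormal_frame A g q e" "alt_form A q k \<alpha>" "alt_form A q k \<beta>"
    and "\<And>js. js \<in> set (ksubs k [0..<8]) \<Longrightarrow> set js \<subseteq> {..<8} \<Longrightarrow> \<alpha> (map e js) = \<beta> (map e js)"
  shows "\<alpha> = \<beta>"
proof (rule alt_form_eqI[OF assms(2,3), of 8 e])
  fix js :: "nat list"
  assume js: "length js = k" "sorted js" "distinct js" "set js \<subseteq> {..<8}"
  then show "\<alpha> (map e js) = \<beta> (map e js)"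
    using assms(4)[of js] filter_in_ksubs[of "\<lambda>i. i \<in> set js" "[0..<8]"]
      sorted_subset_filter[of js 8] by metis
qed (use orthonormal_frameD[OF assms(1)] in auto)

text \<open>The sign is a value of a wedge monomial on frame vectors and inherits degree and
  alternation from that form. This is why a frame occurs among the hypotheses of a statement on
  index lists.\<close>

lemma csign_eq_0:
  assumes "orthonormal_frame A g q e" "riemannian_metric A g" "q \<in> points A"
    "set is \<subseteq> {..<8}" "set js \<subseteq> {..<8}" "\<not> distinct js \<or> length js \<noteq> length is"
  shows "csign is js = 0"
proof -
  have *: "alt_form A q (length is) (coframe_form A g q e is)"
    using assms orthonormal_frameD(1)[OF assms(1)] by (intro coframe_form_alt_form) auto
  have "coframe_form A g q e is (map e js) = 0"
    using assms(6) alt_form_zero[OF *, of "map e js"] alt_form_nd[OF *, of "map e js"]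
    by (auto simp: distinct_map)
  then show ?thesis using coframe_form_frame[OF assms(1,4,5)] by simp
qed

text \<open>Of all sets \<open>I\<close> only the complement of \<open>js\<close> survives, because
  the volume form kills repetitions and lists of length other than 8.\<close>

lemma hodge_frame:
  assumes e: "orthonormal_frame A g q (frame_at A g \<Phi> q)" and "riemannian_metric A g" "q \<in> points A"
    "distinct js" "set js \<subseteq> {..<8}"
  shows "hodge A g \<Phi> q \<omega> (map (frame_at A g \<Phi> q) js) =
    \<omega> (map (frame_at A g \<Phi> q) (filter (\<lambda>i. i \<notin> set js) [0..<8])) *
      csign [0..<8] (filter (\<lambda>i. i \<notin> set js) [0..<8] @ js)"
proof -
  define I0 where "I0 = {i. i < 8 \<and> i \<notin> set js}"
  define F where "F I = \<omega> (map (frame_at A g \<Phi> q) (nths [0..<8] I)) *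
      csign [0..<8] (nths [0..<8] I @ js)" for I
  have sub: "set (nths [0..<8] I) \<subseteq> {..<8}" for I :: "nat set"
    using set_nths_subset[of "[0..<8]" I] by auto
  have "coframe_form A g q (frame_at A g \<Phi> q) [0..<8]
      (map (frame_at A g \<Phi> q) (nths [0..<8] I) @ map (frame_at A g \<Phi> q) js) =
      csign [0..<8] (nths [0..<8] I @ js)" for I
    using coframe_form_frame[OF e, of "[0..<8]" "nths [0..<8] I @ js"] sub[of I] assms(5)
    by (simp add: lessThan_atLeast0)
  then have "hodge A g \<Phi> q \<omega> (map (frame_at A g \<Phi> q) js) = (\<Sum>I\<in>Pow {..<8}. F I)"
    by (simp add: hodge_def Let_def F_def)
  also have "\<dots> = (\<Sum>I\<in>{I0}. F I)"
  proof (rule sum.mono_neutral_right)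
    show "\<forall>I\<in>Pow {..<8} - {I0}. F I = 0"
    proof
      fix I :: "nat set" assume I: "I \<in> Pow {..<8} - {I0}"
      have "nths [0..<8] I = filter (\<lambda>i. i \<in> I) [0..<8]"
    proof -
      have "I = {i. i < length [0..<8] \<and> [0..<8] ! i \<in> I}" using I by auto
      then show ?thesis using filter_eq_nths[of "\<lambda>i. i \<in> I" "[0..<8]"] by simp
    qed
    then have set: "set (nths [0..<8] I) = I" using I by auto
      have "\<not> distinct (nths [0..<8] I @ js) \<or> length (nths [0..<8] I @ js) \<noteq> length [0..<8]"
      proof (rule ccontr)
        assume c: "\<not> ?thesis"
        then have "card (I \<union> set js) = 8"
          using distinct_card[of "nths [0..<8] I @ js"] set by simp
        then have "I \<union> set js = {..<8}"
          using I assms(5) by (intro card_subset_eq) auto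
        moreover have "I \<inter> set js = {}" using c set by auto
        ultimately have "I = I0" unfolding I0_def by auto
        then show False using I by simp
      qed
      then have "csign [0..<8] (nths [0..<8] I @ js) = 0"
        using assms(5) set I by (intro csign_eq_0[OF e assms(2,3)]) auto
      then show "F I = 0" by (simp add: F_def)
    qed
  qed (auto simp: I0_def)
  finally have "hodge A g \<Phi> q \<omega> (map (frame_at A g \<Phi> q) js) = F I0" by simp
  moreover have "nths [0..<8] I0 = filter (\<lambda>i. i \<notin> set js) [0..<8]"
  proof -
    have "{i. i < length [0..<8] \<and> [0..<8] ! i \<notin> set js} = I0" by (auto simp: I0_def)
    then show ?thesis using filter_eq_nths[of "\<lambda>i. i \<notin> set js" "[0..<8]"] by simp
  qed
  ultimately show ?thesis by (simp add: F_def)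
qed

text \<open>Alternation comes from the volume form, while \<omega> only supplies coefficients and
  the degree. The lemma can thus be applied to \<open>ext_deriv\<close>, for which only values and
  degree are at hand.\<close>

lemma hodge_alt_form:
  assumes e: "orthonormal_frame A g q (frame_at A g \<Phi> q)" and "riemannian_metric A g" "q \<in> points A"
    "\<And>vs. length vs \<noteq> k \<Longrightarrow> \<omega> vs = 0" "k \<le> 8"
  shows "alt_form A q (8 - k) (hodge A g \<Phi> q \<omega>)"
proof -
  let ?e = "frame_at A g \<Phi> q"
  define c where "c I = \<omega> (map ?e (nths [0..<8] I))" for I
  \<comment> \<open>Sets of the wrong size have coefficient 0; giving them the zero form keeps every
    summand of degree \<open>8 - k\<close>.\<close>
  define F where "F I vs = (if length (nths [0..<8] I) = k
    then coframe_form A g q ?e [0..<8] (map ?e (nths [0..<8] I) @ vs) else 0)" for I vs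
  have "hodge A g \<Phi> q \<omega> = (\<lambda>vs. \<Sum>I\<in>Pow {..<8}. c I * F I vs)"
    using assms(4) by (auto simp: hodge_def Let_def c_def F_def fun_eq_iff intro!: sum.cong)
  moreover have "alt_form A q (8 - k) (\<lambda>vs. \<Sum>I\<in>Pow {..<8}. c I * F I vs)"
  proof (rule alt_form_sum_forms)
    fix I :: "nat set" assume "I \<in> Pow {..<8}"
    have vol: "alt_form A q 8 (coframe_form A g q ?e [0..<8])"
      using coframe_form_alt_form[OF assms(2,3), of "[0..<8]" ?e] orthonormal_frameD(1)[OF e] by simp
    have sub: "set (map ?e (nths [0..<8] I)) \<subseteq> tangent_space A q"
      using set_nths_subset[of "[0..<8]" I] by (intro frame_map_subset[OF e]) auto
    show "alt_form A q (8 - k) (F I)"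
    proof (cases "length (nths [0..<8] I) = k")
      case True
      then have "F I = (\<lambda>vs. coframe_form A g q ?e [0..<8] (map ?e (nths [0..<8] I) @ vs))"
        by (simp add: F_def fun_eq_iff)
      then show ?thesis using alt_form_append[OF vol sub] True assms(5) by simp
    next
      case False
      then have "F I = (\<lambda>vs. 0)" by (simp add: F_def fun_eq_iff)
      then show ?thesis by (simp add: alt_form_const_zero)
    qed
  qed simp
  ultimately show ?thesis by simp
qed

lemma form_norm2_frame:
  assumes "alt_form A q k \<omega>"
  shows "form_norm2 A g \<Phi> q \<omega> = (\<Sum>js\<leftarrow>ksubs k [0..<8]. (\<omega> (map (frame_at A g \<Phi> q) js))\<^sup>2)"
  using sum_Pow_nths[of k "\<lambda>js. (\<omega> (map (frame_at A g \<Phi> q) js))\<^sup>2" "[0..<8]"]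
    alt_form_zero[OF assms] by (simp add: form_norm2_def)

lemma metric_frame_eqI:
  assumes "riemannian_metric A g" "q \<in> points A" "u \<in> tangent_space A q" "v \<in> tangent_space A q"
    "\<And>w. w \<in> tangent_space A q \<Longrightarrow> g q u w = g q v w"
  shows "u = v"
proof (rule ccontr)
  assume "u \<noteq> v"
  define w where "w = (\<lambda>f. 1 * u f + (-1) * v f)"
  have w: "w \<in> tangent_space A q" unfolding w_def using assms by (intro tangent_lincomb) auto
  have "w \<noteq> (\<lambda>f. 0)" using \<open>u \<noteq> v\<close> by (auto simp: w_def fun_eq_iff)
  then have "g q w w > 0" using riemannian_metricD(3)[OF assms(1,2) w w w] by simp
  moreover have "g q w w = 0"
    using riemannian_metricD(1)[OF assms(1-4) w, of 1 "-1"] assms(5)[OF w] by (simp add: w_def)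
  ultimately show False by simp
qed

lemma metric_sum:
  assumes "riemannian_metric A g" "q \<in> points A" "finite J"
    "\<And>j. j \<in> J \<Longrightarrow> u j \<in> tangent_space A q" "w \<in> tangent_space A q"
  shows "g q (\<lambda>f. \<Sum>j\<in>J. a j * u j f) w = (\<Sum>j\<in>J. a j * g q (u j) w)"
  using assms(3,4)
proof (induction J rule: finite_induct)
  case empty
  then show ?case using riemannian_metricD(1)[OF assms(1,2,5,5,5), of 0 0] by simp
next
  case (insert j J)
  then show ?case
    using riemannian_metricD(1)[OF assms(1,2) _ tangent_sum[of J u A q a] assms(5), of "u j" "a j" 1]
    by simp
qed

lemma frame_expansion:
  assumes "orthonormal_frame A g q e" "riemannian_metric A g" "q \<in> points A" "v \<in> tangent_space A q"
  shows "v = (\<lambda>f. \<Sum>i<8. g q v (e i) * e i f)"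
proof -
  obtain a where a: "v = (\<lambda>f. \<Sum>i<8. a i * e i f)" using orthonormal_frameD(2)[OF assms(1,4)] by blast
  have "g q v (e j) = a j" if j: "j < 8" for j
  proof -
    have "g q v (e j) = (\<Sum>i<8. a i * g q (e i) (e j))"
      using metric_sum[OF assms(2,3), of "{..<8}" e "e j" a] orthonormal_frameD(1)[OF assms(1)] j a
      by auto
    also have "\<dots> = (\<Sum>i<8. if i = j then a i else 0)"
      using orthonormal_frameD(3)[OF assms(1)] j by (intro sum.cong) auto
    finally show ?thesis using j by simp
  qed
  then show ?thesis using a by (auto intro!: sum.cong)
qed

section \<open>Linear algebra of the model 4-form\<close>

definition phi :: "nat list \<Rightarrow> real" where
  "phi js = (\<Sum>(c, is) \<leftarrow> spin7_terms. c * csign is js)"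

definition skew8 :: "(nat \<Rightarrow> nat \<Rightarrow> real) \<Rightarrow> bool" where
  "skew8 w \<longleftrightarrow> (\<forall>i<8. \<forall>j<8. w i j = - w j i)"

definition contract :: "(nat \<Rightarrow> nat \<Rightarrow> real) \<Rightarrow> nat \<Rightarrow> nat \<Rightarrow> real" where
  "contract w i j = (\<Sum>k<8. \<Sum>l<8. phi [i, j, k, l] * w k l)"

text \<open>The contraction is twice the map \<open>\<omega> \<mapsto> \<star>(\<Phi> \<and> \<omega>)\<close>, so its eigenvalues \<open>6\<close> and \<open>-2\<close> single
  out \<open>\<Lambda>\<^sup>2\<^sub>7\<close> and \<open>\<Lambda>\<^sup>2\<^sub>2\<^sub>1\<close>.\<close>

definition eigen2 :: "real \<Rightarrow> (nat \<Rightarrow> nat \<Rightarrow> real) \<Rightarrow> bool" where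
  "eigen2 c w \<longleftrightarrow> skew8 w \<and> (\<forall>i<8. \<forall>j<8. contract w i j = c * w i j)"

text \<open>The entries are \<open>w k l\<close> = g(w e_k, e_l), first index the argument, so the
  composite of \<open>a\<close> after \<open>b\<close> has entries \<open>b k m * a m l\<close>
  summed over \<open>m\<close>. This is therefore [a, b] and not its negative.\<close>

definition commutator :: "(nat \<Rightarrow> nat \<Rightarrow> real) \<Rightarrow> (nat \<Rightarrow> nat \<Rightarrow> real) \<Rightarrow> nat \<Rightarrow> nat \<Rightarrow> real" where
  "commutator a b k l = (\<Sum>m<8. b k m * a m l - a k m * b m l)"

text \<open>The components of the sum of \<Phi>(.., w e_j, ..) over the slots, that is, the
  infinitesimal action of \<open>w\<close> on \<Phi> up to sign. It vanishes on all quadruples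
  exactly if a skew \<open>w\<close> lies in spin(7).\<close>

definition act :: "(nat \<Rightarrow> nat \<Rightarrow> real) \<Rightarrow> nat list \<Rightarrow> real" where
  "act w js = (\<Sum>k<length js. \<Sum>m<8. w (js ! k) m * phi (js[k := m]))"

section \<open>Rewriting rules for explicit components\<close>

lemma sum_lessThan_8: "sum f {..<8} = f 0 + f 1 + f 2 + f 3 + f 4 + f 5 + f 6 + f (7::nat)"
  by (simp add: eval_nat_numeral)

lemma all_less_8: "(\<forall>i<8. P i) \<longleftrightarrow> P 0 \<and> P 1 \<and> P 2 \<and> P 3 \<and> P 4 \<and> P 5 \<and> P 6 \<and> P (7::nat)"
  by (simp add: eval_nat_numeral All_less_Suc conj_ac)

lemma skew8D: "skew8 w \<Longrightarrow> i < 8 \<Longrightarrow> j < 8 \<Longrightarrow> w i j = - w j i"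
  unfolding skew8_def by blast

lemma skew8_diag: "skew8 w \<Longrightarrow> i < 8 \<Longrightarrow> w i i = 0"
  using skew8D[of w i i] by simp

lemma skew8_order: "skew8 w \<Longrightarrow> j < i \<Longrightarrow> i < 8 \<Longrightarrow> w i j = - w j i"
  using skew8D[of w i j] by simp

lemma eigen2_skew: "eigen2 c w \<Longrightarrow> skew8 w"
  unfolding eigen2_def by blast

lemma eigen2_contract: "eigen2 c w \<Longrightarrow> i < 8 \<Longrightarrow> j < 8 \<Longrightarrow> contract w i j = c * w i j"
  unfolding eigen2_def by blast

lemma antisym_csign: "antisym_form (csign is)"
proof (induction "is")
  case Nil
  show ?case by (simp add: antisym_form_def)
next
  case (Cons i "is")
  have "shuffle_sum (\<lambda>ys zs. (if ys = [i] then 1 else 0) * csign is zs) (us @ x # y # ws) =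
      - shuffle_sum (\<lambda>ys zs. (if ys = [i] then 1 else 0) * csign is zs) (us @ y # x # ws)" for us x y ws
    by (rule shuffle_sum_swap) (simp, subst antisym_formD[OF Cons.IH], simp)
  then show ?case unfolding antisym_form_def csign.simps shuffle_sum_singleton by blast
qed

lemma antisym_phi: "antisym_form phi"
  unfolding antisym_form_def
proof (intro allI)
  fix us x y ws
  have "csign is (us @ x # y # ws) = - csign is (us @ y # x # ws)" for "is"
    by (rule antisym_formD[OF antisym_csign])
  then show "phi (us @ x # y # ws) = - phi (us @ y # x # ws)"
    by (simp add: phi_def spin7_terms_def)
qed

lemma phi_swap: "phi [j, i, k, l] = - phi [i, j, k, l]"
  using antisym_formD[OF antisym_phi, of "[]" j i "[k, l]"] by simp

lemma phi_cycle: "phi [j, k, i, l] = phi [i, j, k, l]"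
proof -
  have "phi [j, k, i, l] = - phi [j, i, k, l]"
    using antisym_formD[OF antisym_phi, of "[j]" k i "[l]"] by simp
  then show ?thesis using phi_swap[of i j k l] by simp
qed

lemma contract_swap: "contract w j i = - contract w i j"
proof -
  have "phi [j, i, k, l] = - phi [i, j, k, l]" for k l by (rule phi_swap)
  then show ?thesis unfolding contract_def by (simp add: sum_negf)
qed

text \<open>The order conditions orient these rules towards increasing lists, where
  \<open>phi_table\<close> applies. For numerals they are decided by simplification.\<close>

lemma phi_sort:
  shows "j < i \<Longrightarrow> phi [i, j, k, l] = - phi [j, i, k, l]"
    and "k < j \<Longrightarrow> phi [i, j, k, l] = - phi [i, k, j, l]"
    and "l < k \<Longrightarrow> phi [i, j, k, l] = - phi [i, j, l, k]"
    and "phi [i, i, k, l] = 0" "phi [i, j, j, l] = 0" "phi [i, j, k, k] = 0"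
proof -
  show "j < i \<Longrightarrow> phi [i, j, k, l] = - phi [j, i, k, l]"
    using antisym_formD[OF antisym_phi, of "[]" i j "[k, l]"] unfolding append_Nil .
  show "k < j \<Longrightarrow> phi [i, j, k, l] = - phi [i, k, j, l]"
    using antisym_formD[OF antisym_phi, of "[i]" j k "[l]"] unfolding append_Cons append_Nil .
  show "l < k \<Longrightarrow> phi [i, j, k, l] = - phi [i, j, l, k]"
    using antisym_formD[OF antisym_phi, of "[i, j]" k l "[]"] unfolding append_Cons append_Nil .
qed (simp_all add: antisym_form_not_distinct[OF antisym_phi])

lemma phi_table:
  shows "phi [0, 1, 2, 3] = 1" "phi [0, 1, 2, 4] = 0" "phi [0, 1, 2, 5] = 0" "phi [0, 1, 2, 6] = 0"
    "phi [0, 1, 2, 7] = 0" "phi [0, 1, 3, 4] = 0" "phi [0, 1, 3, 5] = 0" "phi [0, 1, 3, 6] = 0"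
    "phi [0, 1, 3, 7] = 0" "phi [0, 1, 4, 5] = -1" "phi [0, 1, 4, 6] = 0" "phi [0, 1, 4, 7] = 0"
    "phi [0, 1, 5, 6] = 0" "phi [0, 1, 5, 7] = 0" "phi [0, 1, 6, 7] = -1" "phi [0, 2, 3, 4] = 0"
    "phi [0, 2, 3, 5] = 0" "phi [0, 2, 3, 6] = 0" "phi [0, 2, 3, 7] = 0" "phi [0, 2, 4, 5] = 0"
    "phi [0, 2, 4, 6] = -1" "phi [0, 2, 4, 7] = 0" "phi [0, 2, 5, 6] = 0" "phi [0, 2, 5, 7] = 1"
    "phi [0, 2, 6, 7] = 0" "phi [0, 3, 4, 5] = 0" "phi [0, 3, 4, 6] = 0" "phi [0, 3, 4, 7] = -1"
    "phi [0, 3, 5, 6] = -1" "phi [0, 3, 5, 7] = 0" "phi [0, 3, 6, 7] = 0" "phi [0, 4, 5, 6] = 0"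
    "phi [0, 4, 5, 7] = 0" "phi [0, 4, 6, 7] = 0" "phi [0, 5, 6, 7] = 0" "phi [1, 2, 3, 4] = 0"
    "phi [1, 2, 3, 5] = 0" "phi [1, 2, 3, 6] = 0" "phi [1, 2, 3, 7] = 0" "phi [1, 2, 4, 5] = 0"
    "phi [1, 2, 4, 6] = 0" "phi [1, 2, 4, 7] = -1" "phi [1, 2, 5, 6] = -1" "phi [1, 2, 5, 7] = 0"
    "phi [1, 2, 6, 7] = 0" "phi [1, 3, 4, 5] = 0" "phi [1, 3, 4, 6] = 1" "phi [1, 3, 4, 7] = 0"
    "phi [1, 3, 5, 6] = 0" "phi [1, 3, 5, 7] = -1" "phi [1, 3, 6, 7] = 0" "phi [1, 4, 5, 6] = 0"
    "phi [1, 4, 5, 7] = 0" "phi [1, 4, 6, 7] = 0" "phi [1, 5, 6, 7] = 0" "phi [2, 3, 4, 5] = -1"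
    "phi [2, 3, 4, 6] = 0" "phi [2, 3, 4, 7] = 0" "phi [2, 3, 5, 6] = 0" "phi [2, 3, 5, 7] = 0"
    "phi [2, 3, 6, 7] = -1" "phi [2, 4, 5, 6] = 0" "phi [2, 4, 5, 7] = 0" "phi [2, 4, 6, 7] = 0"
    "phi [2, 5, 6, 7] = 0" "phi [3, 4, 5, 6] = 0" "phi [3, 4, 5, 7] = 0" "phi [3, 4, 6, 7] = 0"
    "phi [3, 5, 6, 7] = 0" "phi [4, 5, 6, 7] = 1"
  by (simp_all add: phi_def spin7_terms_def del: One_nat_def)

lemmas phi_simps = phi_sort phi_table

text \<open>Each pair of indices lies in exactly three of the fourteen terms of \<Phi>, whence three
  summands; the 2 stems from the two orders of the contracted pair. Only pairs with the same xor are
  linked, so the 28 entries fall into seven blocks of four.\<close>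

lemma contract_components:
  assumes "skew8 w"
  shows
    "contract w 0 1 = 2 * (w 2 3 - w 4 5 - w 6 7)"
    "contract w 0 2 = 2 * (- w 1 3 - w 4 6 + w 5 7)"
    "contract w 0 3 = 2 * (w 1 2 - w 4 7 - w 5 6)"
    "contract w 0 4 = 2 * (w 1 5 + w 2 6 + w 3 7)"
    "contract w 0 5 = 2 * (- w 1 4 - w 2 7 + w 3 6)"
    "contract w 0 6 = 2 * (w 1 7 - w 2 4 - w 3 5)"
    "contract w 0 7 = 2 * (- w 1 6 + w 2 5 - w 3 4)"
    "contract w 1 2 = 2 * (w 0 3 - w 4 7 - w 5 6)"
    "contract w 1 3 = 2 * (- w 0 2 + w 4 6 - w 5 7)"
    "contract w 1 4 = 2 * (- w 0 5 + w 2 7 - w 3 6)"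
    "contract w 1 5 = 2 * (w 0 4 + w 2 6 + w 3 7)"
    "contract w 1 6 = 2 * (- w 0 7 - w 2 5 + w 3 4)"
    "contract w 1 7 = 2 * (w 0 6 - w 2 4 - w 3 5)"
    "contract w 2 3 = 2 * (w 0 1 - w 4 5 - w 6 7)"
    "contract w 2 4 = 2 * (- w 0 6 - w 1 7 + w 3 5)"
    "contract w 2 5 = 2 * (w 0 7 - w 1 6 - w 3 4)"
    "contract w 2 6 = 2 * (w 0 4 + w 1 5 + w 3 7)"
    "contract w 2 7 = 2 * (- w 0 5 + w 1 4 - w 3 6)"
    "contract w 3 4 = 2 * (- w 0 7 + w 1 6 - w 2 5)"
    "contract w 3 5 = 2 * (- w 0 6 - w 1 7 + w 2 4)"
    "contract w 3 6 = 2 * (w 0 5 - w 1 4 - w 2 7)"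
    "contract w 3 7 = 2 * (w 0 4 + w 1 5 + w 2 6)"
    "contract w 4 5 = 2 * (- w 0 1 - w 2 3 + w 6 7)"
    "contract w 4 6 = 2 * (- w 0 2 + w 1 3 - w 5 7)"
    "contract w 4 7 = 2 * (- w 0 3 - w 1 2 + w 5 6)"
    "contract w 5 6 = 2 * (- w 0 3 - w 1 2 + w 4 7)"
    "contract w 5 7 = 2 * (w 0 2 - w 1 3 - w 4 6)"
    "contract w 6 7 = 2 * (- w 0 1 - w 2 3 + w 4 5)"
  by (simp_all add: contract_def sum_lessThan_8 phi_simps skew8_order[OF assms]
      skew8_diag[OF assms] del: One_nat_def)

text \<open>In each block the eigenvalue 6 leaves one free entry, for which row 0 is taken:
  \<Lambda>2_7 has dimension 7. All explicit computations with \<xi> below reduce to the numbers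
  \<open>x i 0 a\<close>.\<close>

lemma eigen2_6_components:
  assumes "eigen2 6 w"
  shows "w 1 2 = w 0 3" "w 1 3 = -w 0 2" "w 1 4 = -w 0 5" "w 1 5 = w 0 4" "w 1 6 = -w 0 7"
    "w 1 7 = w 0 6" "w 2 3 = w 0 1" "w 2 4 = -w 0 6" "w 2 5 = w 0 7" "w 2 6 = w 0 4"
    "w 2 7 = -w 0 5" "w 3 4 = -w 0 7" "w 3 5 = -w 0 6" "w 3 6 = w 0 5" "w 3 7 = w 0 4"
    "w 4 5 = -w 0 1" "w 4 6 = -w 0 2" "w 4 7 = -w 0 3" "w 5 6 = -w 0 3" "w 5 7 = w 0 2"
    "w 6 7 = -w 0 1"
  using contract_components[OF eigen2_skew[OF assms]] by (simp_all add: eigen2_contract[OF assms])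

text \<open>In each block the four equations for the eigenvalue -2 are one and the same linear
  relation, so the equations of row 0 imply the rest.\<close>

lemma eigen2_m2I:
  assumes s: "skew8 w" and eq: "\<forall>a\<in>{1,2,3,4,5,6,7}. contract w 0 a = -2 * w 0 a"
  shows "eigen2 (-2) w"
proof -
  have eqs: "contract w 0 1 = -2 * w 0 1" "contract w 0 2 = -2 * w 0 2" "contract w 0 3 = -2 * w 0 3"
    "contract w 0 4 = -2 * w 0 4" "contract w 0 5 = -2 * w 0 5" "contract w 0 6 = -2 * w 0 6"
    "contract w 0 7 = -2 * w 0 7"
    using eq by simp_all
  note eqs' = eqs[unfolded contract_components[OF s]]
  have ord: "contract w i j = -2 * w i j" if "i < j" "j < 8" for i j
  proof -
    have "\<forall>i<8. \<forall>j<8. i < j \<longrightarrow> contract w i j = -2 * w i j"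
      using eqs' unfolding all_less_8 by (simp add: contract_components[OF s] del: One_nat_def)
    then show ?thesis using that by simp
  qed
  have "contract w i j = -2 * w i j" if "i < 8" "j < 8" for i j
  proof (cases i j rule: linorder_cases)
    case equal
    then show ?thesis using contract_swap[of w i i] skew8_diag[OF s that(1)] by simp
  next
    case greater
    then show ?thesis using ord[of j i] contract_swap[of w j i] skew8D[OF s, of i j] that by simp
  qed (use ord that in auto)
  then show ?thesis using s unfolding eigen2_def by blast
qed

section \<open>Commutators and the stabilizer of \<Phi>\<close>

lemma skew8_commutator:
  assumes "skew8 a" "skew8 b"
  shows "skew8 (commutator a b)"
  unfolding skew8_def commutator_def
proof (intro allI impI)
  fix k l :: nat assume "k < 8" "l < 8"
  have "b k m * a m l - a k m * b m l = - (b l m * a m k - a l m * b m k)" if "m < 8" for m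
    using skew8D[OF assms(1) that \<open>l < 8\<close>] skew8D[OF assms(2) that \<open>l < 8\<close>]
      skew8D[OF assms(1) that \<open>k < 8\<close>] skew8D[OF assms(2) that \<open>k < 8\<close>] by simp
  then show "(\<Sum>m<8. b k m * a m l - a k m * b m l) = - (\<Sum>m<8. b l m * a m k - a l m * b m k)"
    unfolding sum_negf[symmetric] by (intro sum.cong) auto
qed

text \<open>This is the symmetric pair property of so(8) and spin(7), the quotient Spin(8)/Spin(7)
  being the sphere S^7. It is checked on the seven free entries of \<open>a\<close> and
  \<open>b\<close>.\<close>

lemma commutator_eigen2_6:
  assumes a: "eigen2 6 a" and b: "eigen2 6 b"
  shows "eigen2 (-2) (commutator a b)"
proof -
  have s: "skew8 a" "skew8 b" using assms unfolding eigen2_def by auto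
  have sc: "skew8 (commutator a b)" by (rule skew8_commutator[OF s])
  note comps = eigen2_6_components[OF a] eigen2_6_components[OF b]
    skew8_order[OF s(1)] skew8_diag[OF s(1)] skew8_order[OF s(2)] skew8_diag[OF s(2)]
  show ?thesis
  proof (rule eigen2_m2I[OF sc])
    show "\<forall>a'\<in>{1,2,3,4,5,6,7}. contract (commutator a b) 0 a' = -2 * commutator a b 0 a'"
      by (simp add: contract_components[OF sc] commutator_def sum_lessThan_8 comps del: One_nat_def)
  qed
qed

lemma act_4:
  "act w [i, j, k, l] = (\<Sum>m<8. w i m * phi [m, j, k, l] + w j m * phi [i, m, k, l] +
    w k m * phi [i, j, m, l] + w l m * phi [i, j, k, m])"
  by (simp add: act_def eval_nat_numeral sum.distrib)

text \<open>Equivariance: contraction with \<Phi> commutes with the action of an element that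
  annihilates \<Phi>, so each eigenspace is preserved.\<close>

lemma commutator_eigen2_stabilizer:
  assumes G: "skew8 G" and stab: "\<And>i j k l. i < 8 \<Longrightarrow> j < 8 \<Longrightarrow> k < 8 \<Longrightarrow> l < 8 \<Longrightarrow> act G [i, j, k, l] = 0"
    and w: "eigen2 c w"
  shows "eigen2 c (commutator G w)"
proof -
  have s: "skew8 w" and ev: "\<And>i j. i < 8 \<Longrightarrow> j < 8 \<Longrightarrow> contract w i j = c * w i j"
    using w unfolding eigen2_def by auto
  have "contract (commutator G w) i j = c * commutator G w i j" if ij: "i < 8" "j < 8" for i j
  proof -
    \<comment> \<open>Both products are renamed so that \<open>w\<close> carries the pair
      \<open>k l\<close> and \<open>G\<close> acts on the fourth or third slot of
      \<open>phi\<close>; skewness of \<open>G\<close> supplies the sign in the second one.\<close>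
    have 1: "(\<Sum>k<8. \<Sum>l<8. \<Sum>m<8. phi [i, j, k, l] * (w k m * G m l)) =
        (\<Sum>k<8. \<Sum>l<8. \<Sum>m<8. w k l * (G l m * phi [i, j, k, m]))"
      by (rule sum.cong[OF refl], subst sum.swap) (simp add: mult_ac)
    have "(\<Sum>k<8. \<Sum>l<8. \<Sum>m<8. phi [i, j, k, l] * (G k m * w m l)) =
        (\<Sum>k<8. \<Sum>m<8. \<Sum>l<8. phi [i, j, k, l] * (G k m * w m l))"
      by (rule sum.cong[OF refl], subst sum.swap) simp
    also have "\<dots> = (\<Sum>m<8. \<Sum>k<8. \<Sum>l<8. phi [i, j, k, l] * (G k m * w m l))"
      by (rule sum.swap)
    also have "\<dots> = (\<Sum>k<8. \<Sum>l<8. \<Sum>m<8. - (w k l * (G k m * phi [i, j, m, l])))"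
    proof (rule sum.cong[OF refl])
      fix k :: nat assume "k \<in> {..<8}"
      then have "(\<Sum>m<8. \<Sum>l<8. phi [i, j, m, l] * (G m k * w k l)) =
          (\<Sum>m<8. \<Sum>l<8. - (w k l * (G k m * phi [i, j, m, l])))"
        by (intro sum.cong refl) (use skew8D[OF G, of k] in simp)
      then show "(\<Sum>m<8. \<Sum>l<8. phi [i, j, m, l] * (G m k * w k l)) =
          (\<Sum>l<8. \<Sum>m<8. - (w k l * (G k m * phi [i, j, m, l])))"
        by (subst sum.swap) simp
    qed
    finally have 2: "(\<Sum>k<8. \<Sum>l<8. \<Sum>m<8. phi [i, j, k, l] * (G k m * w m l)) = \<dots>" .
    have "contract (commutator G w) i j =
        (\<Sum>k<8. \<Sum>l<8. \<Sum>m<8. phi [i, j, k, l] * (w k m * G m l)) -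
        (\<Sum>k<8. \<Sum>l<8. \<Sum>m<8. phi [i, j, k, l] * (G k m * w m l))"
      by (simp add: contract_def commutator_def sum_distrib_left sum_subtractf right_diff_distrib)
    also have "\<dots> = (\<Sum>k<8. \<Sum>l<8. w k l * (\<Sum>m<8. G k m * phi [i, j, m, l] + G l m * phi [i, j, k, m]))"
      unfolding 1 2 by (simp add: sum_distrib_left sum.distrib sum_negf distrib_left)
    \<comment> \<open>Invariance of \<open>phi\<close> moves the action from the last two slots to
      the first two.\<close>
    also have "\<dots> = (\<Sum>k<8. \<Sum>l<8. w k l * - (\<Sum>m<8. G i m * phi [m, j, k, l] + G j m * phi [i, m, k, l]))"
    proof (intro sum.cong refl)
      fix k l :: nat assume "k \<in> {..<8}" "l \<in> {..<8}"
      then have "(\<Sum>m<8. G i m * phi [m, j, k, l] + G j m * phi [i, m, k, l]) +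
          (\<Sum>m<8. G k m * phi [i, j, m, l] + G l m * phi [i, j, k, m]) = 0"
        using stab[OF ij, of k l] by (simp add: act_4 sum.distrib)
      then have "(\<Sum>m<8. G k m * phi [i, j, m, l] + G l m * phi [i, j, k, m]) =
          - (\<Sum>m<8. G i m * phi [m, j, k, l] + G j m * phi [i, m, k, l])" by linarith
      then show "w k l * (\<Sum>m<8. G k m * phi [i, j, m, l] + G l m * phi [i, j, k, m]) =
          w k l * - (\<Sum>m<8. G i m * phi [m, j, k, l] + G j m * phi [i, m, k, l])" by (rule arg_cong)
    qed
    also have "\<dots> = - (\<Sum>k<8. \<Sum>l<8. \<Sum>m<8. G i m * (phi [m, j, k, l] * w k l) + G j m * (phi [i, m, k, l] * w k l))"
      by (simp add: sum_distrib_left sum_negf algebra_simps)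
    also have "(\<Sum>k<8. \<Sum>l<8. \<Sum>m<8. G i m * (phi [m, j, k, l] * w k l) + G j m * (phi [i, m, k, l] * w k l)) =
        (\<Sum>k<8. \<Sum>m<8. \<Sum>l<8. G i m * (phi [m, j, k, l] * w k l) + G j m * (phi [i, m, k, l] * w k l))"
      by (rule sum.cong[OF refl], rule sum.swap)
    also have "\<dots> = (\<Sum>m<8. \<Sum>k<8. \<Sum>l<8. G i m * (phi [m, j, k, l] * w k l) + G j m * (phi [i, m, k, l] * w k l))"
      by (rule sum.swap)
    also have "\<dots> = (\<Sum>m<8. G i m * contract w m j + G j m * contract w i m)"
      by (simp add: contract_def sum.distrib sum_distrib_left)
    also have "- \<dots> = (\<Sum>m<8. c * (w i m * G m j - G i m * w m j))"
      unfolding sum_negf[symmetric]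
      by (intro sum.cong refl) (use ev skew8D[OF G, of j] ij in \<open>simp add: algebra_simps\<close>)
    finally show ?thesis by (simp only: commutator_def[of G w i j] sum_distrib_left)
  qed
  then show ?thesis using skew8_commutator[OF G s] unfolding eigen2_def by blast
qed

text \<open>The inclusion of spin(7) in \<Lambda>2_21: each of the seven block relations of
  \<open>eigen2_m2I\<close> is, up to sign, one component of the invariance condition.\<close>

lemma stabilizer_eigen2:
  assumes s: "skew8 G" and stab: "\<And>i j k l. i < 8 \<Longrightarrow> j < 8 \<Longrightarrow> k < 8 \<Longrightarrow> l < 8 \<Longrightarrow> act G [i, j, k, l] = 0"
  shows "eigen2 (-2) G"
proof -
  \<comment> \<open>A quadruple whose xor is a non-zero \<open>a\<close> is not a term of \<Phi>,
    and its equation involves just the four entries of \<open>G\<close> with xor \<open>a\<close>.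
    The quadruples are listed for \<open>a\<close> = 1, ..., 7.\<close>
  have "act G [0, 2, 4, 7] = 0" "act G [0, 1, 4, 7] = 0" "act G [0, 1, 4, 6] = 0" "act G [0, 1, 2, 7] = 0"
    "act G [0, 1, 2, 6] = 0" "act G [0, 1, 2, 5] = 0" "act G [0, 1, 2, 4] = 0"
    by (rule stab; simp)+
  note eqs = this[unfolded act_4 sum_lessThan_8, simplified phi_simps skew8_order[OF s] skew8_diag[OF s]]
  show ?thesis
  proof (rule eigen2_m2I[OF s])
    show "\<forall>a\<in>{1,2,3,4,5,6,7}. contract G 0 a = -2 * G 0 a"
      using eqs by (simp add: contract_components[OF s] skew8_order[OF s] skew8_diag[OF s] del: One_nat_def)
  qed
qed


text \<open>Components of \<open>\<star>\<close> and of \<open>d\<Phi>\<close>, the latter for the Levi-Civita connection \<open>nabS - \<xi>\<close> with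
  \<open>\<Phi>\<close> parallel for \<open>nabS\<close>; here \<open>x i j k = g(\<xi>\<^sub>i e\<^sub>j, e\<^sub>k)\<close>.\<close>

definition star :: "(nat list \<Rightarrow> real) \<Rightarrow> nat list \<Rightarrow> real" where
  "star F js = F (filter (\<lambda>i. i \<notin> set js) [0..<8]) * csign [0..<8] (filter (\<lambda>i. i \<notin> set js) [0..<8] @ js)"

definition dphi :: "(nat \<Rightarrow> nat \<Rightarrow> nat \<Rightarrow> real) \<Rightarrow> nat list \<Rightarrow> real" where
  "dphi x js = (\<Sum>i<length js. (-1) ^ i * act (x (js ! i)) (nths js (- {i})))"

text \<open>The codifferential of \<Phi>, with \<star>\<Phi> = \<Phi> already inserted.\<close>

definition delta :: "(nat \<Rightarrow> nat \<Rightarrow> nat \<Rightarrow> real) \<Rightarrow> nat list \<Rightarrow> real" where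
  "delta x js = - star (dphi x) js"

lemma upt_0_8: "[0..<8] = [0, 1, 2, 3, 4, 5, 6, 7::nat]"
  by (simp add: upt_rec)

lemma dphi_5:
  "dphi x [a, b, c, d, e] = act (x a) [b, c, d, e] - act (x b) [a, c, d, e] + act (x c) [a, b, d, e]
    - act (x d) [a, b, c, e] + act (x e) [a, b, c, d]"
  by (simp add: dphi_def eval_nat_numeral nths_Cons)

text \<open>The 56 components of \<delta>\<Phi> in terms of the 8 * 7 free coefficients of \<xi>.
  Source and target of this linear map have the same dimension.\<close>

lemma delta_components:
  assumes "\<And>i. i < 8 \<Longrightarrow> eigen2 6 (x i)"
  shows
    "delta x [0, 1, 2] = 4 * (x 4 0 7 + x 5 0 6 - x 6 0 5 - x 7 0 4)"
    "delta x [0, 1, 3] = 4 * (- x 4 0 6 + x 5 0 7 + x 6 0 4 - x 7 0 5)"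
    "delta x [0, 1, 4] = 4 * (- x 2 0 7 + x 3 0 6 - x 6 0 3 + x 7 0 2)"
    "delta x [0, 1, 5] = 4 * (- x 2 0 6 - x 3 0 7 + x 6 0 2 + x 7 0 3)"
    "delta x [0, 1, 6] = 4 * (x 2 0 5 - x 3 0 4 + x 4 0 3 - x 5 0 2)"
    "delta x [0, 1, 7] = 4 * (x 2 0 4 + x 3 0 5 - x 4 0 2 - x 5 0 3)"
    "delta x [0, 2, 3] = 4 * (x 4 0 5 - x 5 0 4 + x 6 0 7 - x 7 0 6)"
    "delta x [0, 2, 4] = 4 * (x 1 0 7 - x 3 0 5 + x 5 0 3 - x 7 0 1)"
    "delta x [0, 2, 5] = 4 * (x 1 0 6 + x 3 0 4 - x 4 0 3 - x 6 0 1)"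
    "delta x [0, 2, 6] = 4 * (- x 1 0 5 - x 3 0 7 + x 5 0 1 + x 7 0 3)"
    "delta x [0, 2, 7] = 4 * (- x 1 0 4 + x 3 0 6 + x 4 0 1 - x 6 0 3)"
    "delta x [0, 3, 4] = 4 * (- x 1 0 6 + x 2 0 5 - x 5 0 2 + x 6 0 1)"
    "delta x [0, 3, 5] = 4 * (x 1 0 7 - x 2 0 4 + x 4 0 2 - x 7 0 1)"
    "delta x [0, 3, 6] = 4 * (x 1 0 4 + x 2 0 7 - x 4 0 1 - x 7 0 2)"
    "delta x [0, 3, 7] = 4 * (- x 1 0 5 - x 2 0 6 + x 5 0 1 + x 6 0 2)"
    "delta x [0, 4, 5] = 4 * (x 2 0 3 - x 3 0 2 - x 6 0 7 + x 7 0 6)"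
    "delta x [0, 4, 6] = 4 * (- x 1 0 3 + x 3 0 1 + x 5 0 7 - x 7 0 5)"
    "delta x [0, 4, 7] = 4 * (x 1 0 2 - x 2 0 1 - x 5 0 6 + x 6 0 5)"
    "delta x [0, 5, 6] = 4 * (x 1 0 2 - x 2 0 1 - x 4 0 7 + x 7 0 4)"
    "delta x [0, 5, 7] = 4 * (x 1 0 3 - x 3 0 1 + x 4 0 6 - x 6 0 4)"
    "delta x [0, 6, 7] = 4 * (x 2 0 3 - x 3 0 2 - x 4 0 5 + x 5 0 4)"
    "delta x [1, 2, 3] = 4 * (x 4 0 4 + x 5 0 5 + x 6 0 6 + x 7 0 7)"
    "delta x [1, 2, 4] = 4 * (- x 0 0 7 - x 3 0 4 - x 5 0 2 + x 6 0 1)"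
    "delta x [1, 2, 5] = 4 * (- x 0 0 6 - x 3 0 5 + x 4 0 2 - x 7 0 1)"
    "delta x [1, 2, 6] = 4 * (x 0 0 5 - x 3 0 6 - x 4 0 1 - x 7 0 2)"
    "delta x [1, 2, 7] = 4 * (x 0 0 4 - x 3 0 7 + x 5 0 1 + x 6 0 2)"
    "delta x [1, 3, 4] = 4 * (x 0 0 6 + x 2 0 4 - x 5 0 3 + x 7 0 1)"
    "delta x [1, 3, 5] = 4 * (- x 0 0 7 + x 2 0 5 + x 4 0 3 + x 6 0 1)"
    "delta x [1, 3, 6] = 4 * (- x 0 0 4 + x 2 0 6 - x 5 0 1 - x 7 0 3)"
    "delta x [1, 3, 7] = 4 * (x 0 0 5 + x 2 0 7 - x 4 0 1 + x 6 0 3)"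
    "delta x [1, 4, 5] = 4 * (- x 2 0 2 - x 3 0 3 - x 6 0 6 - x 7 0 7)"
    "delta x [1, 4, 6] = 4 * (x 0 0 3 + x 2 0 1 + x 5 0 6 - x 7 0 4)"
    "delta x [1, 4, 7] = 4 * (- x 0 0 2 + x 3 0 1 + x 5 0 7 + x 6 0 4)"
    "delta x [1, 5, 6] = 4 * (- x 0 0 2 + x 3 0 1 - x 4 0 6 - x 7 0 5)"
    "delta x [1, 5, 7] = 4 * (- x 0 0 3 - x 2 0 1 - x 4 0 7 + x 6 0 5)"
    "delta x [1, 6, 7] = 4 * (- x 2 0 2 - x 3 0 3 - x 4 0 4 - x 5 0 5)"
    "delta x [2, 3, 4] = 4 * (- x 0 0 5 - x 1 0 4 - x 6 0 3 + x 7 0 2)"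
    "delta x [2, 3, 5] = 4 * (x 0 0 4 - x 1 0 5 + x 6 0 2 + x 7 0 3)"
    "delta x [2, 3, 6] = 4 * (- x 0 0 7 - x 1 0 6 + x 4 0 3 - x 5 0 2)"
    "delta x [2, 3, 7] = 4 * (x 0 0 6 - x 1 0 7 - x 4 0 2 - x 5 0 3)"
    "delta x [2, 4, 5] = 4 * (- x 0 0 3 + x 1 0 2 + x 6 0 5 + x 7 0 4)"
    "delta x [2, 4, 6] = 4 * (- x 1 0 1 - x 3 0 3 - x 5 0 5 - x 7 0 7)"
    "delta x [2, 4, 7] = 4 * (x 0 0 1 + x 3 0 2 - x 5 0 4 + x 6 0 7)"
    "delta x [2, 5, 6] = 4 * (x 0 0 1 + x 3 0 2 + x 4 0 5 - x 7 0 6)"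
    "delta x [2, 5, 7] = 4 * (x 1 0 1 + x 3 0 3 + x 4 0 4 + x 6 0 6)"
    "delta x [2, 6, 7] = 4 * (- x 0 0 3 + x 1 0 2 - x 4 0 7 - x 5 0 6)"
    "delta x [3, 4, 5] = 4 * (x 0 0 2 + x 1 0 3 - x 6 0 4 + x 7 0 5)"
    "delta x [3, 4, 6] = 4 * (- x 0 0 1 + x 2 0 3 + x 5 0 4 + x 7 0 6)"
    "delta x [3, 4, 7] = 4 * (- x 1 0 1 - x 2 0 2 - x 5 0 5 - x 6 0 6)"
    "delta x [3, 5, 6] = 4 * (- x 1 0 1 - x 2 0 2 - x 4 0 4 - x 7 0 7)"
    "delta x [3, 5, 7] = 4 * (x 0 0 1 - x 2 0 3 + x 4 0 5 + x 6 0 7)"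
    "delta x [3, 6, 7] = 4 * (x 0 0 2 + x 1 0 3 + x 4 0 6 - x 5 0 7)"
    "delta x [4, 5, 6] = 4 * (x 0 0 7 + x 1 0 6 - x 2 0 5 + x 3 0 4)"
    "delta x [4, 5, 7] = 4 * (- x 0 0 6 + x 1 0 7 - x 2 0 4 - x 3 0 5)"
    "delta x [4, 6, 7] = 4 * (x 0 0 5 + x 1 0 4 + x 2 0 7 - x 3 0 6)"
    "delta x [5, 6, 7] = 4 * (- x 0 0 4 + x 1 0 5 + x 2 0 6 + x 3 0 7)"
  by (simp_all add: delta_def star_def upt_0_8 dphi_5 act_4 sum_lessThan_8 phi_simps
      skew8_order[OF eigen2_skew[OF assms]] skew8_diag[OF eigen2_skew[OF assms]]
      eigen2_6_components[OF assms] del: One_nat_def)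

text \<open>The components of T in the overview.\<close>

definition trace8 :: "(nat \<Rightarrow> nat \<Rightarrow> nat \<Rightarrow> real) \<Rightarrow> nat \<Rightarrow> real" where
  "trace8 x l = (\<Sum>j<8. x j j l)"

definition wedge_phi :: "(nat list \<Rightarrow> real) \<Rightarrow> nat list \<Rightarrow> real" where
  "wedge_phi F = shuffle_sum (\<lambda>ys zs. phi ys * F zs)"

section \<open>Hodge star, wedge products and norms on components\<close>

lemma ksubs_numeral:
  "ksubs (numeral n) [] = []"
  "ksubs (numeral n) (x # xs) = map ((#) x) (ksubs (pred_numeral n) xs) @ ksubs (numeral n) xs"
  "ksubs 1 [] = []"
  "ksubs 1 (x # xs) = [x] # ksubs 1 xs"
  by (simp_all add: numeral_eq_Suc)

lemma pick_eq_0: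
  "(\<And>zs. Suc (length zs) = length js \<Longrightarrow> c zs = 0) \<Longrightarrow> pick i c js = 0"
proof (induction js arbitrary: c)
  case (Cons j js)
  have "pick i (\<lambda>zs. c (j # zs)) js = 0" by (rule Cons.IH) (use Cons.prems in simp)
  then show ?case using Cons.prems[of js] by simp
qed simp

lemma csign_length: "length js \<noteq> length is \<Longrightarrow> csign is js = 0"
  by (induction "is" arbitrary: js) (auto intro!: pick_eq_0)

lemma phi_length: "length js \<noteq> 4 \<Longrightarrow> phi js = 0"
  unfolding phi_def spin7_terms_def by (simp add: csign_length del: csign.simps)

lemma star_phi: "js \<in> set (ksubs 4 [0..<8]) \<Longrightarrow> star phi js = phi js"
proof -
  have "\<forall>js\<in>set (ksubs 4 [0..<8]). star phi js = phi js"
    by (simp add: upt_0_8 ksubs_numeral star_def phi_table del: One_nat_def)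
  then show "js \<in> set (ksubs 4 [0..<8]) \<Longrightarrow> star phi js = phi js" by blast
qed

lemma star_wedge_phi_2:
  assumes "\<And>i j. i < 8 \<Longrightarrow> j < 8 \<Longrightarrow> F [i, j] = - F [j, i]" "i < 8" "j < 8" "i < j"
  shows "star (wedge_phi F) [i, j] = contract (\<lambda>k l. F [k, l]) i j / 2"
proof -
  have s: "skew8 (\<lambda>k l. F [k, l])" using assms(1) unfolding skew8_def by blast
  have "\<forall>i<8. \<forall>j<8. i < j \<longrightarrow> star (wedge_phi F) [i, j] = contract (\<lambda>k l. F [k, l]) i j / 2"
    unfolding all_less_8
    by (simp add: upt_0_8 star_def wedge_phi_def phi_length phi_table contract_components[OF s]
      del: One_nat_def)
  then show ?thesis using assms by blast
qed

text \<open>As \<star>\<Phi> = \<Phi>, the form \<star>(\<Phi> \<and> \<eta>) is the interior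
  product of the dual vector of \<eta> with \<Phi>.\<close>

lemma star_wedge_phi_1:
  "js \<in> set (ksubs 3 [0..<8]) \<Longrightarrow> star (wedge_phi F) js = (\<Sum>n<8. phi (n # js) * F [n])"
proof -
  have "\<forall>js\<in>set (ksubs 3 [0..<8]). star (wedge_phi F) js = (\<Sum>n<8. phi (n # js) * F [n])"
    by (simp add: upt_0_8 ksubs_numeral star_def wedge_phi_def phi_length phi_simps sum_lessThan_8
      del: One_nat_def)
  then show "js \<in> set (ksubs 3 [0..<8]) \<Longrightarrow> star (wedge_phi F) js = (\<Sum>n<8. phi (n # js) * F [n])" by blast
qed


text \<open>Each index lies in seven of the fourteen terms of \<Phi>, and the sign is that of
  \<star>\<star> = -1 in odd degree. Since the factor is not 0, the map detects the
  \<Lambda>3_8-part of a 3-form.\<close>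

lemma star_wedge_phi_3:
  assumes "\<And>js. js \<in> set (ksubs 3 [0..<8]) \<Longrightarrow> F js = (\<Sum>n<8. phi (n # js) * f n)" "c < 8"
  shows "star (wedge_phi F) [c] = - 7 * f c"
proof -
  have "\<forall>js\<in>set (ksubs 3 [0..<8]). F js = (\<Sum>n<8. phi (n # js) * f n)" using assms(1) by blast
  then have "\<forall>c<8. star (wedge_phi F) [c] = - 7 * f c"
    unfolding all_less_8
    by (simp add: upt_0_8 ksubs_numeral star_def wedge_phi_def phi_length phi_simps sum_lessThan_8
        del: One_nat_def)
  then show ?thesis using assms(2) by blast
qed

text \<open>The order of the factors is immaterial because \<Phi> has even degree. The first form
  matches the definition of \<theta> and yields \<theta> = 16/7 T; the second serves the projection
  to \<Lambda>3_48.\<close>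

lemma star_delta_wedge_phi:
  assumes "\<And>i. i < 8 \<Longrightarrow> eigen2 6 (x i)" "c < 8"
  shows "star (shuffle_sum (\<lambda>ys zs. delta x ys * phi zs)) [c] = 16 * trace8 x c"
    and "star (wedge_phi (delta x)) [c] = 16 * trace8 x c"
proof -
  note s = eigen2_skew[OF assms(1)]
  note ord = skew8_order[OF s] and diag = skew8_diag[OF s] and comps = eigen2_6_components[OF assms(1)]
  note simps = upt_0_8 star_def wedge_phi_def phi_length phi_table delta_components[OF assms(1)]
    trace8_def sum_lessThan_8 ord diag comps
  have "\<forall>c<8. star (shuffle_sum (\<lambda>ys zs. delta x ys * phi zs)) [c] = 16 * trace8 x c"
    unfolding all_less_8 by (simp add: simps del: One_nat_def)
  then show "star (shuffle_sum (\<lambda>ys zs. delta x ys * phi zs)) [c] = 16 * trace8 x c" using assms(2) by blast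
  have "\<forall>c<8. star (wedge_phi (delta x)) [c] = 16 * trace8 x c"
    unfolding all_less_8 by (simp add: simps del: One_nat_def)
  then show "star (wedge_phi (delta x)) [c] = 16 * trace8 x c" using assms(2) by blast
qed

lemma sum_list_partition:
  fixes h :: "'a \<Rightarrow> nat"
  shows "(\<And>x. x \<in> set xs \<Longrightarrow> h x < n) \<Longrightarrow>
    (\<Sum>x\<leftarrow>xs. F x) = (\<Sum>r<n. \<Sum>x\<leftarrow>filter (\<lambda>x. h x = r) xs. F x :: real)"
proof (induction xs)
  case (Cons x xs)
  have "(\<Sum>r<n. \<Sum>y\<leftarrow>filter (\<lambda>y. h y = r) (x # xs). F y) =
      (\<Sum>r<n. (if r = h x then F x else 0) + (\<Sum>y\<leftarrow>filter (\<lambda>y. h y = r) xs. F y))"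
    by (rule sum.cong) auto
  then show ?case using Cons by (simp add: sum.distrib)
qed simp

text \<open>The terms of \<open>\<Phi>\<close> are the sets \<open>{i, j, k, l}\<close> with \<open>xor\<close> equal to \<open>0\<close>, apart from their
  signs.  Hence \<open>\<delta>\<Phi>\<close> is block diagonal for the grading of index lists by \<open>xor\<close>.\<close>

lemma sum_triples_blocks:
  "(\<Sum>js\<leftarrow>ksubs 3 [0..<8]. F js) =
    (\<Sum>r<8. \<Sum>js\<leftarrow>filter (\<lambda>js. foldr xor js 0 = r) (ksubs 3 [0..<8]). F js :: real)"
proof (rule sum_list_partition)
  have "\<forall>js\<in>set (ksubs 3 [0..<8]). foldr xor js 0 < (8::nat)"
    by (simp add: upt_0_8 ksubs_numeral del: One_nat_def)
  then show "foldr xor js 0 < (8::nat)" if "js \<in> set (ksubs 3 [0..<8])" for js using that by blast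
qed

text \<open>Reindexing by an involution of the indices below 8.\<close>

lemma sum_xor_lessThan_8:
  fixes k :: nat
  shows "k < 8 \<Longrightarrow> (\<Sum>m<8. f m) = (\<Sum>r<8. f (xor k r) :: real)"
proof -
  have "\<forall>k<8. (\<Sum>m<8. f m) = (\<Sum>r<8. f (xor k r))"
    unfolding all_less_8 by (simp add: sum_lessThan_8 del: One_nat_def)
  then show "k < 8 \<Longrightarrow> (\<Sum>m<8. f m) = (\<Sum>r<8. f (xor k r))" by blast
qed

text \<open>The left side is an invariant quadratic form in \<xi>, hence a combination of |T|^2 and
  C; 48 and 16 are its coefficients.\<close>

lemma delta_norm2:
  assumes "\<And>i. i < 8 \<Longrightarrow> eigen2 6 (x i)"
  shows "(\<Sum>js\<leftarrow>ksubs 3 [0..<8]. (delta x js)\<^sup>2) =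
    48 * (\<Sum>l<8. (trace8 x l)\<^sup>2) + 16 * (\<Sum>i<8. \<Sum>j<8. \<Sum>m<8. x i j m * x j i m)"
proof -
  note s = eigen2_skew[OF assms(1)]
  note ord = skew8_order[OF s] and diag = skew8_diag[OF s] and comps = eigen2_6_components[OF assms(1)]
  \<comment> \<open>The block of xor \<open>r\<close> involves only the seven coefficients
    \<open>x i 0 a\<close> with \<open>xor i a = r\<close>, so each polynomial identity stays small.
    On the right this fixes the third index as the xor of \<open>i\<close>, \<open>j\<close> and
    \<open>r\<close>.\<close>
  have "\<forall>r<8. (\<Sum>js\<leftarrow>filter (\<lambda>js. foldr xor js 0 = r) (ksubs 3 [0..<8]). (delta x js)\<^sup>2) =
      48 * (trace8 x r)\<^sup>2 + 16 * (\<Sum>i<8. \<Sum>j<8. x i j (xor (xor i j) r) * x j i (xor (xor i j) r))"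
    unfolding all_less_8
    by (intro conjI; simp add: upt_0_8 ksubs_numeral delta_components[OF assms(1)]
      trace8_def sum_lessThan_8 ord diag comps del: One_nat_def;
      simp add: power2_eq_square algebra_simps del: One_nat_def)
  then have "(\<Sum>js\<leftarrow>ksubs 3 [0..<8]. (delta x js)\<^sup>2) = (\<Sum>r<8. 48 * (trace8 x r)\<^sup>2 +
      16 * (\<Sum>i<8. \<Sum>j<8. x i j (xor (xor i j) r) * x j i (xor (xor i j) r)))"
    unfolding sum_triples_blocks by simp
  also have "\<dots> = 48 * (\<Sum>l<8. (trace8 x l)\<^sup>2) +
      16 * (\<Sum>r<8. \<Sum>i<8. \<Sum>j<8. x i j (xor (xor i j) r) * x j i (xor (xor i j) r))"
    by (simp add: sum.distrib sum_distrib_left)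
  also have "(\<Sum>r<8. \<Sum>i<8. \<Sum>j<8. x i j (xor (xor i j) r) * x j i (xor (xor i j) r)) =
      (\<Sum>i<8. \<Sum>r<8. \<Sum>j<8. x i j (xor (xor i j) r) * x j i (xor (xor i j) r))"
    by (rule sum.swap)
  also have "\<dots> = (\<Sum>i<8. \<Sum>j<8. \<Sum>r<8. x i j (xor (xor i j) r) * x j i (xor (xor i j) r))"
    by (rule sum.cong[OF refl], rule sum.swap)
  also have "\<dots> = (\<Sum>i<8. \<Sum>j<8. \<Sum>m<8. x i j m * x j i m)"
  proof (rule sum.cong[OF refl], rule sum.cong[OF refl])
    fix i j :: nat assume "i \<in> {..<8}" "j \<in> {..<8}"
    moreover have "\<forall>i<8. \<forall>j<8. xor i j < (8::nat)" unfolding all_less_8 by simp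
    ultimately show "(\<Sum>r<8. x i j (xor (xor i j) r) * x j i (xor (xor i j) r)) = (\<Sum>m<8. x i j m * x j i m)"
      using sum_xor_lessThan_8[of "xor i j" "\<lambda>m. x i j m * x j i m"] by simp
  qed
  finally show ?thesis .
qed

text \<open>The cross term of |\<delta>\<Phi> + \<star>(\<Phi> \<and> \<theta>)|^2. By
  \<star>\<star> = -1 in odd degree, pairing with \<star>(\<Phi> \<and> f) is minus the adjoint of F
  \<mapsto> \<star>(\<Phi> \<and> F), so -16 matches the 16 of
  \<open>star_delta_wedge_phi\<close>.\<close>

lemma delta_inner:
  assumes "\<And>i. i < 8 \<Longrightarrow> eigen2 6 (x i)"
  shows "(\<Sum>js\<leftarrow>ksubs 3 [0..<8]. delta x js * (\<Sum>n<8. phi (n # js) * f n)) =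
    - 16 * (\<Sum>l<8. trace8 x l * f l)"
proof -
  note s = eigen2_skew[OF assms(1)]
  note ord = skew8_order[OF s] and diag = skew8_diag[OF s] and comps = eigen2_6_components[OF assms(1)]
  have "\<forall>r<8. (\<Sum>js\<leftarrow>filter (\<lambda>js. foldr xor js 0 = r) (ksubs 3 [0..<8]).
      delta x js * (\<Sum>n<8. phi (n # js) * f n)) = - 16 * (trace8 x r * f r)"
    unfolding all_less_8
    by (intro conjI; simp add: upt_0_8 ksubs_numeral delta_components[OF assms(1)] phi_simps
      trace8_def sum_lessThan_8 ord diag comps del: One_nat_def;
      simp add: algebra_simps del: One_nat_def)
  then show ?thesis unfolding sum_triples_blocks by (simp add: sum_distrib_left)
qed

text \<open>Each triple lies in exactly one term of \<Phi>, so the inner sum has a single non-zero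
  summand, and each index completes seven triples.\<close>

lemma phi_norm2:
  "(\<Sum>js\<leftarrow>ksubs 3 [0..<8]. (\<Sum>n<8. phi (n # js) * f n)\<^sup>2) = 7 * (\<Sum>l<8. (f l)\<^sup>2)"
  by (simp add: upt_0_8 ksubs_numeral phi_simps sum_lessThan_8 del: One_nat_def)

lemma complement_singleton: "c < 8 \<Longrightarrow> length (filter (\<lambda>i. i \<notin> set [c]) [0..<8]) = 7"
proof -
  assume "c < 8"
  have "length (filter (\<lambda>i. i \<notin> set [c]) [0..<8]) = card ({..<8} - {c})"
    by (subst distinct_card[symmetric]) (auto intro!: arg_cong[where f=card])
  also have "\<dots> = 7" using \<open>c < 8\<close> by simp
  finally show ?thesis .
qed

section \<open>The intrinsic torsion of a Spin(7)-structure\<close>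

locale spin7_geometry =
  fixes A :: "'m::{t2_space,second_countable_topology} chart set"
    and g :: "'m metric"
    and \<Phi> :: "'m \<Rightarrow> 'm form"
    and nab nabS :: "'m connection"
  assumes atlas: "smooth_atlas A"
    and metric: "riemannian_metric A g"
    and struct: "spin7_structure A g \<Phi>"
    and lc: "levi_civita A g nab"
    and minimal: "minimal_spin7_connection A g \<Phi> nab nabS"
begin

section \<open>Connections and adapted frames\<close>

lemma metric_connections: "metric_connection A g nab" "metric_connection A g nabS"
  using lc minimal unfolding levi_civita_def minimal_spin7_connection_def by blast+

lemma affine_connections: "affine_connection A nab" "affine_connection A nabS"
  using metric_connections unfolding metric_connection_def by blast+

lemma affine_connectionD:
  assumes "affine_connection A N" "q \<in> W" "u \<in> tangent_space A q" "v \<in> tangent_space A q"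
    "smooth_vf A W Y" "smooth_vf A W Z" "smooth_fun A W h"
  shows "N q u Y \<in> tangent_space A q"
    and "N q (\<lambda>h. a * u h + b * v h) Y = (\<lambda>h. a * N q u Y h + b * N q v Y h)"
    and "N q u (\<lambda>q h. Y q h + Z q h) = (\<lambda>h. N q u Y h + N q u Z h)"
    and "N q u (\<lambda>q f. h q * Y q f) = (\<lambda>f. u h * Y q f + h q * N q u Y f)"
  using assms(1)[unfolded affine_connection_def, THEN conjunct1, THEN spec[of _ W], THEN spec[of _ q],
      THEN spec[of _ u], THEN spec[of _ v], THEN spec[of _ Y], THEN spec[of _ Z], THEN spec[of _ h],
      THEN spec[of _ a], THEN spec[of _ b]] assms(2-7)
  by simp_all

lemma affine_tangent:
  assumes "affine_connection A N" "q \<in> W" "u \<in> tangent_space A q" "smooth_vf A W Y"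
  shows "N q u Y \<in> tangent_space A q"
  by (rule affine_connectionD(1)[OF assms(1-3,3,4,4) smooth_fun_const[OF smooth_vfD(1,2)[OF assms(4)]]])

lemma affine_direction:
  assumes "affine_connection A N" "q \<in> W" "u \<in> tangent_space A q" "v \<in> tangent_space A q" "smooth_vf A W Y"
  shows "N q (\<lambda>h. a * u h + b * v h) Y = (\<lambda>h. a * N q u Y h + b * N q v Y h)"
  by (rule affine_connectionD(2)[OF assms(1-5,5) smooth_fun_const[OF smooth_vfD(1,2)[OF assms(5)]]])

lemma affine_add:
  assumes "affine_connection A N" "q \<in> W" "u \<in> tangent_space A q" "smooth_vf A W Y" "smooth_vf A W Z"
  shows "N q u (\<lambda>q h. Y q h + Z q h) = (\<lambda>h. N q u Y h + N q u Z h)"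
  by (rule affine_connectionD(3)[OF assms(1-3,3-5) smooth_fun_const[OF smooth_vfD(1,2)[OF assms(5)]]])

lemma affine_cmult:
  assumes "affine_connection A N" "q \<in> W" "u \<in> tangent_space A q" "smooth_vf A W Y"
  shows "N q u (\<lambda>q h. c * Y q h) = (\<lambda>h. c * N q u Y h)"
proof -
  have W: "open W" "W \<subseteq> points A" using smooth_vfD(1,2)[OF assms(4)] by blast+
  have "N q u (\<lambda>q h. c * Y q h) = (\<lambda>h. u (\<lambda>q. c) * Y q h + c * N q u Y h)"
    by (rule affine_connectionD(4)[OF assms(1-3,3,4,4) smooth_fun_const[OF W]])
  moreover have "u (\<lambda>q. c) = 0"
    using tangent_apply_const[OF assms(3)] open_points[OF atlas] W assms(2) by blast
  ultimately show ?thesis by simp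
qed

lemma affine_lincomb:
  assumes "affine_connection A N" "q \<in> W" "u \<in> tangent_space A q" "smooth_vf A W Y" "smooth_vf A W Z"
  shows "N q u (\<lambda>q h. a * Y q h + b * Z q h) = (\<lambda>h. a * N q u Y h + b * N q u Z h)"
proof -
  have "smooth_vf A W (\<lambda>q h. a * Y q h)" "smooth_vf A W (\<lambda>q h. b * Z q h)"
    using smooth_vf_lincomb[OF atlas assms(4,4), of a 0] smooth_vf_lincomb[OF atlas assms(5,5), of b 0] by simp_all
  from affine_add[OF assms(1-3) this] show ?thesis
    by (simp only: affine_cmult[OF assms(1-3,4)] affine_cmult[OF assms(1-3,5)])
qed

lemma affine_smooth:
  "affine_connection A N \<Longrightarrow> smooth_vf A W X \<Longrightarrow> smooth_vf A W Y \<Longrightarrow> smooth_vf A W (\<lambda>q. N q (X q) Y)"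
  unfolding affine_connection_def by blast

lemma metric_compatible:
  "metric_connection A g N \<Longrightarrow> q \<in> W \<Longrightarrow> u \<in> tangent_space A q \<Longrightarrow> smooth_vf A W Y \<Longrightarrow> smooth_vf A W Z \<Longrightarrow>
    u (\<lambda>q. g q (Y q) (Z q)) = g q (N q u Y) (Z q) + g q (Y q) (N q u Z)"
  unfolding metric_connection_def by blast

lemma torsion_free:
  "q \<in> W \<Longrightarrow> smooth_vf A W X \<Longrightarrow> smooth_vf A W Y \<Longrightarrow>
    lie_bracket A X Y q = (\<lambda>f. nab q (X q) Y f - nab q (Y q) X f)"
  using lc unfolding levi_civita_def by metis

lemma Phi_alt_form: "q \<in> points A \<Longrightarrow> alt_form A q 4 (\<Phi> q)"
  using struct unfolding spin7_structure_def smooth_form_def by blast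

lemma adapted_frame_onD:
  assumes "adapted_frame_on A g \<Phi> W e"
  shows "i < 8 \<Longrightarrow> smooth_vf A W (e i)" "open W" "W \<subseteq> points A"
    "q \<in> W \<Longrightarrow> orthonormal_frame A g q (\<lambda>i. e i q)"
proof -
  show *: "i < 8 \<Longrightarrow> smooth_vf A W (e i)" for i using assms unfolding adapted_frame_on_def by blast
  show "open W" "W \<subseteq> points A" using smooth_vfD(1,2)[OF *[of 0]] by auto
  show "q \<in> W \<Longrightarrow> orthonormal_frame A g q (\<lambda>i. e i q)"
    using assms smooth_vfD(3)[OF *] unfolding adapted_frame_on_def orthonormal_frame_def by auto
qed

lemma Phi_frame:
  assumes "adapted_frame_on A g \<Phi> W e" "q \<in> W" "set js \<subseteq> {..<8}"
  shows "\<Phi> q (map (\<lambda>i. e i q) js) = phi js"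
proof -
  have *: "coframe_form A g q (\<lambda>i. e i q) is (map (\<lambda>i. e i q) js) = csign is js"
    if "set is \<subseteq> {..<8}" for "is"
    by (rule coframe_form_frame[OF adapted_frame_onD(4)[OF assms(1,2)] that assms(3)])
  have "\<Phi> q = spin7_model A g q (\<lambda>i. e i q)" using assms unfolding adapted_frame_on_def by blast
  then show ?thesis by (simp add: spin7_model_def phi_def spin7_terms_def * del: csign.simps)
qed

lemma adapted_frame_exists:
  assumes "q \<in> points A"
  obtains W where "q \<in> W" "adapted_frame_on A g \<Phi> W (adapted_frame A g \<Phi> q)"
proof -
  have "\<exists>e W. q \<in> W \<and> adapted_frame_on A g \<Phi> W e"
    using struct assms unfolding spin7_structure_def by blast
  then have "\<exists>W. q \<in> W \<and> adapted_frame_on A g \<Phi> W (adapted_frame A g \<Phi> q)"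
    unfolding adapted_frame_def by (rule someI_ex)
  then show ?thesis using that by blast
qed

lemma frame_at_frame: "q \<in> points A \<Longrightarrow> orthonormal_frame A g q (frame_at A g \<Phi> q)"
proof -
  assume "q \<in> points A"
  then obtain W where W: "q \<in> W" "adapted_frame_on A g \<Phi> W (adapted_frame A g \<Phi> q)"
    by (rule adapted_frame_exists)
  have "frame_at A g \<Phi> q = (\<lambda>i. adapted_frame A g \<Phi> q i q)" by (simp add: frame_at_def fun_eq_iff)
  then show ?thesis using adapted_frame_onD(4)[OF W(2,1)] by simp
qed

lemma Phi_frame_at: "q \<in> points A \<Longrightarrow> set js \<subseteq> {..<8} \<Longrightarrow> \<Phi> q (map (frame_at A g \<Phi> q) js) = phi js"
proof -
  assume q: "q \<in> points A" and js: "set js \<subseteq> {..<8}"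
  obtain W where W: "q \<in> W" "adapted_frame_on A g \<Phi> W (adapted_frame A g \<Phi> q)"
    by (rule adapted_frame_exists[OF q])
  have "frame_at A g \<Phi> q = (\<lambda>i. adapted_frame A g \<Phi> q i q)" by (simp add: frame_at_def fun_eq_iff)
  then show ?thesis using Phi_frame[OF W(2,1) js] by simp
qed

section \<open>The difference tensor \<xi>\<close>

lemma extension_exists:
  assumes "q \<in> points A" "v \<in> tangent_space A q"
  shows "\<exists>Y W. q \<in> W \<and> smooth_vf A W Y \<and> Y q = v"
proof -
  obtain W where W: "q \<in> W" "adapted_frame_on A g \<Phi> W (adapted_frame A g \<Phi> q)"
    by (rule adapted_frame_exists[OF assms(1)])
  obtain a where a: "v = (\<lambda>f. \<Sum>i<8. a i * adapted_frame A g \<Phi> q i q f)"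
    using orthonormal_frameD(2)[OF adapted_frame_onD(4)[OF W(2,1)] assms(2)] by blast
  have "smooth_vf A W (\<lambda>r f. \<Sum>i<8. a i * adapted_frame A g \<Phi> q i r f)"
    using adapted_frame_onD[OF W(2)] by (intro smooth_vf_sum[OF atlas]) auto
  then show ?thesis
    by (intro exI[of _ "\<lambda>r f. \<Sum>i<8. a i * adapted_frame A g \<Phi> q i r f"] exI[of _ W])
      (simp add: W(1) a)
qed

lemma extension_exists_list:
  assumes "q \<in> points A" "set vs \<subseteq> tangent_space A q"
  shows "\<exists>Xs W. q \<in> W \<and> open W \<and> W \<subseteq> points A \<and> (\<forall>X\<in>set Xs. smooth_vf A W X) \<and> map (\<lambda>X. X q) Xs = vs"
  using assms(2)
proof (induction vs)
  case Nil
  then show ?case using assms(1) open_points[OF atlas] by (intro exI[of _ "[]"] exI[of _ "points A"]) auto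
next
  case (Cons v vs)
  obtain Xs W where W: "q \<in> W" "open W" "W \<subseteq> points A" "\<forall>X\<in>set Xs. smooth_vf A W X" "map (\<lambda>X. X q) Xs = vs"
    using Cons by auto
  obtain Y W' where Y: "q \<in> W'" "smooth_vf A W' Y" "Y q = v"
    using extension_exists[OF assms(1), of v] Cons.prems by auto
  have o: "open (W \<inter> W')" using W(2) smooth_vfD(1)[OF Y(2)] by blast
  have "\<forall>X\<in>set (Y # Xs). smooth_vf A (W \<inter> W') X"
    using W(4) Y(2) smooth_vf_subset[OF _ o] by auto
  then show ?case using W Y o by (intro exI[of _ "Y # Xs"] exI[of _ "W \<inter> W'"]) auto
qed

text \<open>Evaluated on a chosen extension of \<open>v\<close>; \<open>xi_eq\<close> shows that the
  choice does not matter. The extension does not depend on \<open>u\<close>, which makes linearity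
  in \<open>u\<close> immediate.\<close>

definition xi :: "'m \<Rightarrow> 'm tvec \<Rightarrow> 'm tvec \<Rightarrow> 'm tvec" where
  "xi q u v = (let Y = SOME Y. \<exists>W. q \<in> W \<and> smooth_vf A W Y \<and> Y q = v
     in (\<lambda>f. nabS q u Y f - nab q u Y f))"

lemma xi_extension:
  assumes "q \<in> points A" "v \<in> tangent_space A q"
  obtains W Y where "q \<in> W" "smooth_vf A W Y" "Y q = v" "\<forall>u. xi q u v = (\<lambda>f. nabS q u Y f - nab q u Y f)"
proof -
  have "\<exists>W. q \<in> W \<and> smooth_vf A W (SOME Y. \<exists>W. q \<in> W \<and> smooth_vf A W Y \<and> Y q = v) \<and>
      (SOME Y. \<exists>W. q \<in> W \<and> smooth_vf A W Y \<and> Y q = v) q = v"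
    using extension_exists[OF assms] by (rule someI_ex)
  then show ?thesis using that unfolding xi_def Let_def by blast
qed

lemma difference_tangent:
  assumes "q \<in> W" "smooth_vf A W Y" "u \<in> tangent_space A q"
  shows "(\<lambda>f. nabS q u Y f - nab q u Y f) \<in> tangent_space A q"
  using tangent_lincomb[OF affine_tangent[OF affine_connections(2) assms(1,3,2)]
      affine_tangent[OF affine_connections(1) assms(1,3,2)], of 1 "-1"] by simp

lemma xi_tangent:
  assumes "q \<in> points A" "u \<in> tangent_space A q" "v \<in> tangent_space A q"
  shows "xi q u v \<in> tangent_space A q"
proof -
  obtain W Y where "q \<in> W" "smooth_vf A W Y" "Y q = v" "\<forall>u. xi q u v = (\<lambda>f. nabS q u Y f - nab q u Y f)"
    by (rule xi_extension[OF assms(1,3)])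
  then show ?thesis using difference_tangent assms(2) by simp
qed

text \<open>The 2-form provided by the minimal connection sees only the value \<open>Y q\<close>.
  Tensoriality of \<xi> thus comes with the \<Lambda>2_7 condition and not from the Leibniz
  rule.\<close>

lemma xi_form:
  assumes "q \<in> points A" "u \<in> tangent_space A q"
  obtains \<omega> where "\<omega> \<in> Lambda2_7 A g \<Phi> q"
    "\<forall>W Y w. q \<in> W \<longrightarrow> smooth_vf A W Y \<longrightarrow> w \<in> tangent_space A q \<longrightarrow>
      g q (\<lambda>f. nabS q u Y f - nab q u Y f) w = \<omega> [Y q, w]"
    "\<forall>v\<in>tangent_space A q. \<forall>w\<in>tangent_space A q. g q (xi q u v) w = \<omega> [v, w]"
proof -
  obtain \<omega> where \<omega>: "\<omega> \<in> Lambda2_7 A g \<Phi> q"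
    "\<forall>W Y. q \<in> W \<and> smooth_vf A W Y \<longrightarrow> (\<forall>w\<in>tangent_space A q.
      g q (\<lambda>f. nabS q u Y f - nab q u Y f) w = \<omega> [Y q, w])"
    using minimal[unfolded minimal_spin7_connection_def, THEN conjunct2, THEN conjunct2,
      THEN bspec[OF _ assms(1)], THEN bspec[OF _ assms(2)]] by blast
  have "g q (xi q u v) w = \<omega> [v, w]" if v: "v \<in> tangent_space A q" and w: "w \<in> tangent_space A q" for v w
  proof -
    obtain W Y where Y: "q \<in> W" "smooth_vf A W Y" "Y q = v" "\<forall>u. xi q u v = (\<lambda>f. nabS q u Y f - nab q u Y f)"
      by (rule xi_extension[OF assms(1) v])
    then have "g q (\<lambda>f. nabS q u Y f - nab q u Y f) w = \<omega> [Y q, w]" using \<omega>(2) w by blast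
    then show ?thesis using Y(3,4) by simp
  qed
  then show ?thesis using that[OF \<omega>(1)] \<omega>(2) by blast
qed

lemma xi_eq:
  assumes "q \<in> W" "smooth_vf A W Y" "u \<in> tangent_space A q"
  shows "(\<lambda>f. nabS q u Y f - nab q u Y f) = xi q u (Y q)"
proof -
  have q: "q \<in> points A" and Y: "Y q \<in> tangent_space A q" using assms smooth_vfD[OF assms(2)] by blast+
  obtain \<omega> where \<omega>: "\<omega> \<in> Lambda2_7 A g \<Phi> q"
    "\<forall>W Y w. q \<in> W \<longrightarrow> smooth_vf A W Y \<longrightarrow> w \<in> tangent_space A q \<longrightarrow>
      g q (\<lambda>f. nabS q u Y f - nab q u Y f) w = \<omega> [Y q, w]"
    "\<forall>v\<in>tangent_space A q. \<forall>w\<in>tangent_space A q. g q (xi q u v) w = \<omega> [v, w]"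
    by (rule xi_form[OF q assms(3)])
  show ?thesis
  proof (rule metric_frame_eqI[OF metric q difference_tangent[OF assms] xi_tangent[OF q assms(3) Y]])
    fix w assume "w \<in> tangent_space A q"
    then show "g q (\<lambda>f. nabS q u Y f - nab q u Y f) w = g q (xi q u (Y q)) w"
      using \<omega>(2)[rule_format, OF assms(1,2)] \<omega>(3) Y by simp
  qed
qed

lemma xi_lin_direction:
  assumes "q \<in> points A" "u \<in> tangent_space A q" "v \<in> tangent_space A q" "w \<in> tangent_space A q"
  shows "xi q (\<lambda>f. a * u f + b * v f) w = (\<lambda>f. a * xi q u w f + b * xi q v w f)"
proof -
  obtain W Y where Y: "q \<in> W" "smooth_vf A W Y" "Y q = w" "\<forall>u. xi q u w = (\<lambda>f. nabS q u Y f - nab q u Y f)"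
    by (rule xi_extension[OF assms(1,4)])
  show ?thesis
    unfolding Y(4)[rule_format] affine_direction[OF affine_connections(1) Y(1) assms(2,3) Y(2)]
      affine_direction[OF affine_connections(2) Y(1) assms(2,3) Y(2)]
    by (simp add: fun_eq_iff algebra_simps)
qed

lemma Lambda2_7_alt_form: "\<omega> \<in> Lambda2_7 A g \<Phi> q \<Longrightarrow> alt_form A q 2 \<omega>"
  unfolding Lambda2_7_def by blast

lemma xi_lin:
  assumes "q \<in> points A" "u \<in> tangent_space A q" "v \<in> tangent_space A q" "w \<in> tangent_space A q"
  shows "xi q u (\<lambda>f. a * v f + b * w f) = (\<lambda>f. a * xi q u v f + b * xi q u w f)"
proof -
  obtain \<omega> where \<omega>: "\<omega> \<in> Lambda2_7 A g \<Phi> q"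
    "\<forall>W Y w. q \<in> W \<longrightarrow> smooth_vf A W Y \<longrightarrow> w \<in> tangent_space A q \<longrightarrow>
      g q (\<lambda>f. nabS q u Y f - nab q u Y f) w = \<omega> [Y q, w]"
    "\<forall>v\<in>tangent_space A q. \<forall>w\<in>tangent_space A q. g q (xi q u v) w = \<omega> [v, w]"
    by (rule xi_form[OF assms(1,2)])
  note xt = xi_tangent[OF assms(1,2)]
  have l: "(\<lambda>f. a * v f + b * w f) \<in> tangent_space A q" using assms by (intro tangent_lincomb)
  show ?thesis
  proof (rule metric_frame_eqI[OF metric assms(1)])
    show "xi q u (\<lambda>f. a * v f + b * w f) \<in> tangent_space A q" by (rule xt[OF l])
    show "(\<lambda>f. a * xi q u v f + b * xi q u w f) \<in> tangent_space A q"
      using assms by (intro tangent_lincomb xt)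
    fix z assume z: "z \<in> tangent_space A q"
    have "\<omega> ([] @ (\<lambda>f. a * v f + b * w f) # [z]) = a * \<omega> ([] @ v # [z]) + b * \<omega> ([] @ w # [z])"
      by (rule alt_form_lin[OF Lambda2_7_alt_form[OF \<omega>(1)]]) (use assms z in auto)
    then show "g q (xi q u (\<lambda>f. a * v f + b * w f)) z = g q (\<lambda>f. a * xi q u v f + b * xi q u w f) z"
      using riemannian_metricD(1)[OF metric assms(1) xt[OF assms(3)] xt[OF assms(4)] z, of a b]
        \<omega>(3)[rule_format, OF l z] \<omega>(3)[rule_format, OF assms(3) z] \<omega>(3)[rule_format, OF assms(4) z] by simp
  qed
qed

end

lemma linear_on_tangent_sum:
  fixes L :: "'m::topological_space tvec \<Rightarrow> real"
  assumes "\<And>u v a b. u \<in> tangent_space A q \<Longrightarrow> v \<in> tangent_space A q \<Longrightarrow>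
      L (\<lambda>f. a * u f + b * v f) = a * L u + b * L v"
    "finite J" "\<And>j. j \<in> J \<Longrightarrow> u j \<in> tangent_space A q"
  shows "L (\<lambda>f. \<Sum>j\<in>J. a j * u j f) = (\<Sum>j\<in>J. a j * L (u j))"
  using assms(2,3)
proof (induction J rule: finite_induct)
  case empty
  then show ?case using assms(1)[OF tangent_zero tangent_zero, of 0 0] by simp
next
  case (insert j J)
  then show ?case
    using assms(1)[OF _ tangent_sum[of J u A q a], of "u j" "a j" 1] by simp
qed

text \<open>The transition matrix \<open>M\<close> is orthogonal, so the metric trace of a bilinear
  \<open>B\<close> is intrinsic. This is the means by which identities pass between
  \<open>frame_at\<close> and smooth frames.\<close>

lemma trace_frame_independent:
  assumes e: "orthonormal_frame A g q e" and f: "orthonormal_frame A g q f"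
    and m: "riemannian_metric A g" and q: "q \<in> points A"
    and lin: "\<And>u v w a b. u \<in> tangent_space A q \<Longrightarrow> v \<in> tangent_space A q \<Longrightarrow> w \<in> tangent_space A q \<Longrightarrow>
      B (\<lambda>h. a * u h + b * v h) w = a * B u w + b * B v w"
    "\<And>u v w a b. u \<in> tangent_space A q \<Longrightarrow> v \<in> tangent_space A q \<Longrightarrow> w \<in> tangent_space A q \<Longrightarrow>
      B w (\<lambda>h. a * u h + b * v h) = a * B w u + b * B w v"
  shows "(\<Sum>i<8. B (e i) (e i)) = (\<Sum>i<8. B (f i) (f i) :: real)"
proof -
  note eT = orthonormal_frameD(1)[OF e] and fT = orthonormal_frameD(1)[OF f]
  define M where "M i k = g q (e i) (f k)" for i k
  have exp: "e i = (\<lambda>h. \<Sum>k<8. M i k * f k h)" if "i < 8" for i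
    unfolding M_def by (rule frame_expansion[OF f m q eT[OF that]])
  have B: "B (e i) (e i) = (\<Sum>k<8. \<Sum>l<8. M i k * M i l * B (f k) (f l))" if i: "i < 8" for i
  proof -
    have "B (e i) (e i) = (\<Sum>k<8. M i k * B (f k) (e i))"
      by (subst (1) exp[OF i], rule linear_on_tangent_sum[where L = "\<lambda>u. B u (e i)" and q = q and A = A])
        (rule lin(1)[OF _ _ eT[OF i]], simp_all add: fT)
    also have "\<dots> = (\<Sum>k<8. M i k * (\<Sum>l<8. M i l * B (f k) (f l)))"
    proof (rule sum.cong[OF refl])
      fix k :: nat assume k: "k \<in> {..<8}"
      have "B (f k) (e i) = (\<Sum>l<8. M i l * B (f k) (f l))"
        by (subst exp[OF i], rule linear_on_tangent_sum[where L = "\<lambda>u. B (f k) u" and q = q and A = A])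
          (rule lin(2), use k in \<open>simp_all add: fT\<close>)
      then show "M i k * B (f k) (e i) = M i k * (\<Sum>l<8. M i l * B (f k) (f l))" by simp
    qed
    finally show ?thesis by (simp add: sum_distrib_left mult.assoc)
  qed
  have orth: "(\<Sum>i<8. M i k * M i l) = (if k = l then 1 else 0)" if kl: "k < 8" "l < 8" for k l
  proof -
    have "g q (f k) (f l) = (\<Sum>i<8. g q (f k) (e i) * g q (e i) (f l))"
      by (subst frame_expansion[OF e m q fT[OF kl(1)]], rule metric_sum[OF m q])
        (use eT fT[OF kl(2)] in auto)
    also have "\<dots> = (\<Sum>i<8. M i k * M i l)"
      unfolding M_def
      by (rule sum.cong[OF refl]) (use riemannian_metricD(2)[OF m q fT[OF kl(1)] eT eT] in auto)
    finally show ?thesis using orthonormal_frameD(3)[OF f kl] by simp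
  qed
  have "(\<Sum>i<8. B (e i) (e i)) = (\<Sum>i<8. \<Sum>k<8. \<Sum>l<8. M i k * M i l * B (f k) (f l))"
    using B by simp
  also have "\<dots> = (\<Sum>k<8. \<Sum>i<8. \<Sum>l<8. M i k * M i l * B (f k) (f l))" by (rule sum.swap)
  also have "\<dots> = (\<Sum>k<8. \<Sum>l<8. \<Sum>i<8. M i k * M i l * B (f k) (f l))"
    by (rule sum.cong[OF refl], rule sum.swap)
  also have "\<dots> = (\<Sum>k<8. \<Sum>l<8. (if k = l then 1 else 0) * B (f k) (f l))"
    by (intro sum.cong refl) (use orth in \<open>simp add: sum_distrib_right[symmetric]\<close>)
  also have "\<dots> = (\<Sum>k<8. \<Sum>l<8. if k = l then B (f k) (f l) else 0)"
    by (intro sum.cong refl) simp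
  finally show ?thesis by simp
qed

context spin7_geometry
begin

section \<open>The eigenvalue equation for \<xi> in adapted frames\<close>

definition xic :: "'m \<Rightarrow> (nat \<Rightarrow> 'm tvec) \<Rightarrow> nat \<Rightarrow> nat \<Rightarrow> nat \<Rightarrow> real" where
  "xic q e i j k = g q (xi q (e i) (e j)) (e k)"

lemma xi_frame:
  assumes "orthonormal_frame A g q e" "q \<in> points A" "i < 8" "j < 8"
  shows "xi q (e i) (e j) = (\<lambda>f. \<Sum>m<8. xic q e i j m * e m f)"
  unfolding xic_def
  by (rule frame_expansion[OF assms(1) metric assms(2) xi_tangent[OF assms(2)]])
    (use orthonormal_frameD(1)[OF assms(1)] assms in auto)

lemma wedge_Phi_frame:
  assumes "q \<in> points A" "set js \<subseteq> {..<8}"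
  shows "wedge (\<Phi> q) \<beta> (map (frame_at A g \<Phi> q) js) = wedge_phi (\<lambda>js. \<beta> (map (frame_at A g \<Phi> q) js)) js"
  unfolding wedge_eq_shuffle_sum shuffle_sum_map wedge_phi_def
proof (rule shuffle_sum_cong)
  fix ys zs assume "set ys \<union> set zs = set js"
  then have "set ys \<subseteq> {..<8}" using assms(2) by blast
  then show "\<Phi> q (map (frame_at A g \<Phi> q) ys) * \<beta> (map (frame_at A g \<Phi> q) zs) =
      phi ys * \<beta> (map (frame_at A g \<Phi> q) zs)"
    by (simp add: Phi_frame_at[OF assms(1)])
qed

lemma hodge_star:
  assumes "q \<in> points A" "distinct js" "set js \<subseteq> {..<8}"
  shows "hodge A g \<Phi> q \<omega> (map (frame_at A g \<Phi> q) js) = star (\<lambda>js. \<omega> (map (frame_at A g \<Phi> q) js)) js"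
  unfolding star_def by (rule hodge_frame[OF frame_at_frame[OF assms(1)] metric assms])

lemma star_cong:
  assumes "\<And>js. set js \<subseteq> {..<8} \<Longrightarrow> F js = G js"
  shows "star F js = star G js"
  unfolding star_def using assms[of "filter (\<lambda>i. i \<notin> set js) [0..<8]"] by auto

lemma hodge_wedge_Phi_frame:
  assumes "q \<in> points A" "distinct js" "set js \<subseteq> {..<8}"
  shows "hodge A g \<Phi> q (wedge (\<Phi> q) \<beta>) (map (frame_at A g \<Phi> q) js) =
    star (wedge_phi (\<lambda>js. \<beta> (map (frame_at A g \<Phi> q) js))) js"
  unfolding hodge_star[OF assms] by (rule star_cong) (rule wedge_Phi_frame[OF assms(1)])

lemma two_form_swap: "alt_form A q 2 \<omega> \<Longrightarrow> \<omega> [v, w] = - \<omega> [w, v]"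
  using antisym_formD[OF alt_form_antisym, of A q 2 \<omega> "[]" v w "[]"] by simp

lemma Lambda2_7_contract_frame_at:
  assumes q: "q \<in> points A" and \<omega>: "\<omega> \<in> Lambda2_7 A g \<Phi> q" and ij: "i < 8" "j < 8"
  defines "f \<equiv> frame_at A g \<Phi> q"
  shows "contract (\<lambda>k l. \<omega> [f k, f l]) i j = 6 * \<omega> [f i, f j]"
proof -
  note alt = Lambda2_7_alt_form[OF \<omega>]
  have less: "contract (\<lambda>k l. \<omega> [f k, f l]) i j = 6 * \<omega> [f i, f j]" if "i < j" "j < 8" for i j
  proof -
    have "hodge A g \<Phi> q (wedge (\<Phi> q) \<omega>) (map f [i, j]) = 3 * \<omega> (map f [i, j])"
      using \<omega> unfolding Lambda2_7_def by (auto simp: fun_eq_iff)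
    moreover have "hodge A g \<Phi> q (wedge (\<Phi> q) \<omega>) (map f [i, j]) = star (wedge_phi (\<lambda>js. \<omega> (map f js))) [i, j]"
      unfolding f_def by (rule hodge_wedge_Phi_frame[OF q]) (use that in auto)
    moreover have "star (wedge_phi (\<lambda>js. \<omega> (map f js))) [i, j] = contract (\<lambda>k l. \<omega> (map f [k, l])) i j / 2"
    proof (rule star_wedge_phi_2)
      show "\<omega> (map f [i, j]) = - \<omega> (map f [j, i])" for i j
        using two_form_swap[OF alt, of "f i" "f j"] by simp
    qed (use that in auto)
    ultimately show ?thesis by simp
  qed
  show ?thesis
  proof (cases i j rule: linorder_cases)
    case equal
    then show ?thesis
      using contract_swap[of "\<lambda>k l. \<omega> [f k, f l]" i i] two_form_swap[OF alt, of "f i" "f i"] by simp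
  next
    case greater
    then show ?thesis
      using less[of j i] contract_swap[of "\<lambda>k l. \<omega> [f k, f l]" i j] two_form_swap[OF alt, of "f i" "f j"] ij by simp
  qed (use less ij in auto)
qed

lemma phi_pairs: "phi [k, l, i, j] = phi [i, j, k, l]"
proof -
  have "phi [k, l, i, j] = phi [k, i, j, l]"
    using antisym_formD[OF antisym_phi, of "[k]" l i "[j]"] antisym_formD[OF antisym_phi, of "[k, i]" l j "[]"]
    by simp
  also have "\<dots> = phi [i, j, k, l]"
    using antisym_formD[OF antisym_phi, of "[]" k i "[j, l]"] antisym_formD[OF antisym_phi, of "[i]" k j "[l]"]
    by simp
  finally show ?thesis .
qed

text \<open>Both sides are 2-forms in (v, w), so they are compared on the frame. Once
  \<open>v\<close> and \<open>w\<close> are free, the summation frame can be exchanged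
  separately.\<close>

lemma Lambda2_7_contract_vectors:
  assumes q: "q \<in> points A" and \<omega>: "\<omega> \<in> Lambda2_7 A g \<Phi> q"
    and vw: "v \<in> tangent_space A q" "w \<in> tangent_space A q"
  defines "f \<equiv> frame_at A g \<Phi> q"
  shows "(\<Sum>k<8. \<Sum>l<8. \<omega> [f k, f l] * \<Phi> q [f k, f l, v, w]) = 6 * \<omega> [v, w]"
proof -
  note frame = frame_at_frame[OF q, folded f_def]
  define \<alpha> where "\<alpha> vs = (\<Sum>p\<in>{..<8} \<times> {..<8}. \<omega> [f (fst p), f (snd p)] * \<Phi> q ([f (fst p), f (snd p)] @ vs))" for vs
  have "alt_form A q 2 (\<lambda>vs. \<Phi> q ([f (fst p), f (snd p)] @ vs))" if "p \<in> {..<8} \<times> {..<8}" for p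
    using alt_form_append[OF Phi_alt_form[OF q], of "[f (fst p), f (snd p)]"] orthonormal_frameD(1)[OF frame] that
    by auto
  then have "alt_form A q 2 \<alpha>" unfolding \<alpha>_def by (intro alt_form_sum_forms) auto
  moreover have "alt_form A q 2 (\<lambda>vs. 6 * \<omega> vs + 0 * \<omega> vs)"
    by (rule alt_form_lincomb[OF Lambda2_7_alt_form[OF \<omega>] Lambda2_7_alt_form[OF \<omega>]])
  moreover have "\<alpha> (map f js) = 6 * \<omega> (map f js) + 0 * \<omega> (map f js)"
    if js: "js \<in> set (ksubs 2 [0..<8])" "set js \<subseteq> {..<8}" for js
  proof -
    have "\<forall>js\<in>set (ksubs 2 [0..<8::nat]). length js = 2" by (simp add: upt_0_8 ksubs_numeral del: One_nat_def)
    then obtain i j where ij: "js = [i, j]" using js(1) by (auto simp: numeral_2_eq_2 length_Suc_conv)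
    have "\<alpha> (map f js) = (\<Sum>k<8. \<Sum>l<8. \<omega> [f k, f l] * \<Phi> q (map f [k, l, i, j]))"
      by (simp add: \<alpha>_def ij sum.cartesian_product case_prod_beta)
    also have "\<dots> = (\<Sum>k<8. \<Sum>l<8. phi [i, j, k, l] * \<omega> [f k, f l])"
    proof (intro sum.cong refl)
      fix k l :: nat assume "k \<in> {..<8}" "l \<in> {..<8}"
      then have "\<Phi> q (map f [k, l, i, j]) = phi [k, l, i, j]"
        unfolding f_def using js(2) ij by (intro Phi_frame_at[OF q]) auto
      then show "\<omega> [f k, f l] * \<Phi> q (map f [k, l, i, j]) = phi [i, j, k, l] * \<omega> [f k, f l]"
        using phi_pairs[of k l i j] by simp
    qed
    also have "\<dots> = 6 * \<omega> [f i, f j]"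
      using Lambda2_7_contract_frame_at[OF q \<omega>, of i j] js(2) ij by (simp add: contract_def f_def)
    finally show ?thesis using ij by simp
  qed
  ultimately have "\<alpha> = (\<lambda>vs. 6 * \<omega> vs + 0 * \<omega> vs)" by (rule alt_form_frame_eqI[OF frame])
  then have "\<alpha> [v, w] = 6 * \<omega> [v, w]" by simp
  then show ?thesis by (simp add: \<alpha>_def sum.cartesian_product case_prod_beta)
qed

text \<open>\<Lambda>2_7 is defined through \<open>frame_at\<close>, but the equation is needed in a
  smooth adapted frame. The contraction is a double metric trace and so the same in every
  orthonormal frame.\<close>

lemma Lambda2_7_contract:
  assumes q: "q \<in> points A" and \<omega>: "\<omega> \<in> Lambda2_7 A g \<Phi> q" and e: "orthonormal_frame A g q e"
    and vw: "v \<in> tangent_space A q" "w \<in> tangent_space A q"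
  shows "(\<Sum>k<8. \<Sum>l<8. \<omega> [e k, e l] * \<Phi> q [e k, e l, v, w]) = 6 * \<omega> [v, w]"
proof -
  define f where "f = frame_at A g \<Phi> q"
  note frame = frame_at_frame[OF q, folded f_def]
  note alt = Lambda2_7_alt_form[OF \<omega>] and Alt = Phi_alt_form[OF q]
  note eT = orthonormal_frameD(1)[OF e] and fT = orthonormal_frameD(1)[OF frame]
  have l: "\<omega> [\<lambda>h. a * x h + b * y h, z] = a * \<omega> [x, z] + b * \<omega> [y, z]"
    "\<omega> [z, \<lambda>h. a * x h + b * y h] = a * \<omega> [z, x] + b * \<omega> [z, y]"
    "\<Phi> q [\<lambda>h. a * x h + b * y h, z, v, w] = a * \<Phi> q [x, z, v, w] + b * \<Phi> q [y, z, v, w]"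
    "\<Phi> q [z, \<lambda>h. a * x h + b * y h, v, w] = a * \<Phi> q [z, x, v, w] + b * \<Phi> q [z, y, v, w]"
    if "x \<in> tangent_space A q" "y \<in> tangent_space A q" "z \<in> tangent_space A q" for x y z a b
    using alt_form_lin[OF alt, of "[]" "[z]" x y a b] alt_form_lin[OF alt, of "[z]" "[]" x y a b]
      alt_form_lin[OF Alt, of "[]" "[z, v, w]" x y a b] alt_form_lin[OF Alt, of "[z]" "[v, w]" x y a b] that vw
    by simp_all
  text \<open>The summand is linear in \<open>\<omega> [e k, -]\<close> and in \<open>\<Phi> [e k, -, v, w]\<close> separately, so each of the
    two traces may be moved to another orthonormal frame.\<close>
  have 1: "(\<Sum>k<8. \<Sum>l<8. \<omega> [e k, e l] * \<Phi> q [e k, e l, v, w]) =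
      (\<Sum>k<8. \<Sum>l<8. \<omega> [e k, f l] * \<Phi> q [e k, f l, v, w])"
    by (rule sum.cong[OF refl],
        rule trace_frame_independent[OF e frame metric q, where B = "\<lambda>x y. \<omega> [_, x] * \<Phi> q [_, y, v, w]"])
      (simp_all add: l eT algebra_simps)
  also have "\<dots> = (\<Sum>l<8. \<Sum>k<8. \<omega> [e k, f l] * \<Phi> q [e k, f l, v, w])" by (rule sum.swap)
  also have "\<dots> = (\<Sum>l<8. \<Sum>k<8. \<omega> [f k, f l] * \<Phi> q [f k, f l, v, w])"
    by (rule sum.cong[OF refl],
        rule trace_frame_independent[OF e frame metric q, where B = "\<lambda>x y. \<omega> [x, _] * \<Phi> q [y, _, v, w]"])
      (simp_all add: l fT algebra_simps)
  also have "\<dots> = (\<Sum>k<8. \<Sum>l<8. \<omega> [f k, f l] * \<Phi> q [f k, f l, v, w])" by (rule sum.swap)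
  also have "\<dots> = 6 * \<omega> [v, w]"
    unfolding f_def by (rule Lambda2_7_contract_vectors[OF q \<omega> vw])
  finally show ?thesis .
qed

text \<open>Valid at every point of \<open>W\<close>, so that the equation can be differentiated
  along the frame.\<close>

lemma xic_eigen2:
  assumes W: "adapted_frame_on A g \<Phi> W e" "q \<in> W" and i: "i < 8"
  shows "eigen2 6 (xic q (\<lambda>i. e i q) i)"
proof -
  have q: "q \<in> points A" using adapted_frame_onD(3)[OF W(1)] W(2) by blast
  note frame = adapted_frame_onD(4)[OF W]
  note eT = orthonormal_frameD(1)[OF frame]
  obtain \<omega> where \<omega>: "\<omega> \<in> Lambda2_7 A g \<Phi> q"
    "\<forall>W Y w. q \<in> W \<longrightarrow> smooth_vf A W Y \<longrightarrow> w \<in> tangent_space A q \<longrightarrow>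
      g q (\<lambda>f. nabS q (e i q) Y f - nab q (e i q) Y f) w = \<omega> [Y q, w]"
    "\<forall>v\<in>tangent_space A q. \<forall>w\<in>tangent_space A q. g q (xi q (e i q) v) w = \<omega> [v, w]"
    by (rule xi_form[OF q eT[OF i]])
  have x: "xic q (\<lambda>i. e i q) i j k = \<omega> [e j q, e k q]" if "j < 8" "k < 8" for j k
    using \<omega>(3) eT that by (simp add: xic_def)
  have "contract (xic q (\<lambda>i. e i q) i) j k = 6 * xic q (\<lambda>i. e i q) i j k" if jk: "j < 8" "k < 8" for j k
  proof -
    have "contract (xic q (\<lambda>i. e i q) i) j k =
        (\<Sum>m<8. \<Sum>l<8. \<omega> [e m q, e l q] * \<Phi> q [e m q, e l q, e j q, e k q])"
      unfolding contract_def
    proof (intro sum.cong refl)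
      fix m l :: nat assume ml: "m \<in> {..<8}" "l \<in> {..<8}"
      then have "\<Phi> q (map (\<lambda>i. e i q) [m, l, j, k]) = phi [m, l, j, k]"
        using jk by (intro Phi_frame[OF W]) auto
      then show "phi [j, k, m, l] * xic q (\<lambda>i. e i q) i m l =
          \<omega> [e m q, e l q] * \<Phi> q [e m q, e l q, e j q, e k q]"
        using x[of m l] ml phi_pairs[of m l j k] by simp
    qed
    also have "\<dots> = 6 * \<omega> [e j q, e k q]"
      by (rule Lambda2_7_contract[OF q \<omega>(1) frame eT[OF jk(1)] eT[OF jk(2)]])
    finally show ?thesis using x jk by simp
  qed
  moreover have "skew8 (xic q (\<lambda>i. e i q) i)"
    unfolding skew8_def
  proof (intro allI impI)
    fix j k :: nat assume jk: "j < 8" "k < 8"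
    show "xic q (\<lambda>i. e i q) i j k = - xic q (\<lambda>i. e i q) i k j"
      unfolding x[OF jk] x[OF jk(2,1)] by (rule two_form_swap[OF Lambda2_7_alt_form[OF \<omega>(1)]])
  qed
  ultimately show ?thesis unfolding eigen2_def by blast
qed


text \<open>An equality of forms at every point, which lets \<Phi> replace \<star>\<Phi> under the
  exterior derivative in \<open>codifferential\<close>.\<close>

lemma hodge_Phi: "q \<in> points A \<Longrightarrow> hodge A g \<Phi> q (\<Phi> q) = \<Phi> q"
proof -
  assume q: "q \<in> points A"
  have d: "\<forall>js\<in>set (ksubs 4 [0..<8::nat]). distinct js"
    by (simp add: upt_0_8 ksubs_numeral del: One_nat_def)
  show ?thesis
  proof (rule alt_form_frame_eqI[OF frame_at_frame[OF q] _ Phi_alt_form[OF q]])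
    show "alt_form A q 4 (hodge A g \<Phi> q (\<Phi> q))"
      using hodge_alt_form[OF frame_at_frame[OF q] metric q, of 4 "\<Phi> q"] alt_form_zero[OF Phi_alt_form[OF q]]
      by simp
    fix js :: "nat list" assume js: "js \<in> set (ksubs 4 [0..<8])" "set js \<subseteq> {..<8}"
    have "hodge A g \<Phi> q (\<Phi> q) (map (frame_at A g \<Phi> q) js) = star (\<lambda>js. \<Phi> q (map (frame_at A g \<Phi> q) js)) js"
      using d js by (intro hodge_star[OF q]) auto
    also have "\<dots> = star phi js" by (rule star_cong) (rule Phi_frame_at[OF q])
    finally show "hodge A g \<Phi> q (\<Phi> q) (map (frame_at A g \<Phi> q) js) = \<Phi> q (map (frame_at A g \<Phi> q) js)"
      using star_phi[OF js(1)] Phi_frame_at[OF q js(2)] by simp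
  qed
qed

lemma Phi_smooth:
  assumes "open W" "W \<subseteq> points A" "\<forall>X\<in>set Xs. smooth_vf A W X"
  shows "smooth_fun A W (\<lambda>q. \<Phi> q (map (\<lambda>X. X q) Xs))"
  using struct assms unfolding spin7_structure_def smooth_form_def by blast

text \<open>The covariant derivative of \<open>\<Phi>\<close> for \<open>nab = nabS - \<xi>\<close>, as \<open>\<Phi>\<close> is parallel for \<open>nabS\<close>.\<close>

definition nabla_Phi :: "'m \<Rightarrow> 'm tvec \<Rightarrow> 'm form" where
  "nabla_Phi q u vs = (\<Sum>k<length vs. \<Phi> q (vs[k := xi q u (vs ! k)]))"

lemma Phi_derivative:
  assumes "open W" "W \<subseteq> points A" "q \<in> W" "u \<in> tangent_space A q" "\<forall>Y\<in>set Ys. smooth_vf A W Y"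
  shows "u (\<lambda>r. \<Phi> r (map (\<lambda>Y. Y r) Ys)) = nabla_Phi q u (map (\<lambda>Y. Y q) Ys) +
    (\<Sum>k<length Ys. \<Phi> q ((map (\<lambda>Y. Y q) Ys)[k := nab q u (Ys ! k)]))"
proof -
  have q: "q \<in> points A" using assms by blast
  let ?vs = "map (\<lambda>Y. Y q) Ys"
  have vs: "set ?vs \<subseteq> tangent_space A q" using assms smooth_vfD(3) by fastforce
  have "parallel_form A nabS \<Phi>" using minimal unfolding minimal_spin7_connection_def by blast
  then have "u (\<lambda>r. \<Phi> r (map (\<lambda>Y. Y r) Ys)) = (\<Sum>k<length Ys. \<Phi> q (?vs[k := nabS q u (Ys ! k)]))"
    using assms unfolding parallel_form_def by simp
  also have "\<dots> = (\<Sum>k<length Ys. \<Phi> q (?vs[k := xi q u (?vs ! k)]) + \<Phi> q (?vs[k := nab q u (Ys ! k)]))"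
  proof (rule sum.cong[OF refl])
    fix k assume k: "k \<in> {..<length Ys}"
    then have Y: "smooth_vf A W (Ys ! k)" using assms by simp
    have x: "xi q u (?vs ! k) = (\<lambda>f. nabS q u (Ys ! k) f - nab q u (Ys ! k) f)"
      using xi_eq[OF assms(3) Y assms(4)] k by simp
    then have *: "nabS q u (Ys ! k) = (\<lambda>f. 1 * xi q u (?vs ! k) f + 1 * nab q u (Ys ! k) f)"
      by (simp add: fun_eq_iff)
    have "xi q u (?vs ! k) \<in> tangent_space A q" "nab q u (Ys ! k) \<in> tangent_space A q"
      unfolding x using difference_tangent[OF assms(3) Y assms(4)]
        affine_tangent[OF affine_connections(1) assms(3,4) Y] by auto
    moreover have "set (take k ?vs) \<subseteq> tangent_space A q" "set (drop (Suc k) ?vs) \<subseteq> tangent_space A q"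
      using vs set_take_subset set_drop_subset by (meson subset_trans)+
    ultimately have "\<Phi> q (take k ?vs @ nabS q u (Ys ! k) # drop (Suc k) ?vs) =
        1 * \<Phi> q (take k ?vs @ xi q u (?vs ! k) # drop (Suc k) ?vs) +
        1 * \<Phi> q (take k ?vs @ nab q u (Ys ! k) # drop (Suc k) ?vs)"
      unfolding * by (intro alt_form_lin[OF Phi_alt_form[OF q]])
    moreover have "k < length ?vs" using k by simp
    ultimately show "\<Phi> q (?vs[k := nabS q u (Ys ! k)]) =
        \<Phi> q (?vs[k := xi q u (?vs ! k)]) + \<Phi> q (?vs[k := nab q u (Ys ! k)])"
      by (simp only: upd_conv_take_nth_drop mult_1)
  qed
  finally show ?thesis by (simp add: nabla_Phi_def sum.distrib)
qed

text \<open>For a torsion-free connection d is the alternation of the covariant derivative; this is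
  that alternation for \<open>nab\<close>.\<close>

definition dPhi :: "'m \<Rightarrow> 'm form" where
  "dPhi q vs = (\<Sum>i<length vs. (-1) ^ i * nabla_Phi q (vs ! i) (nths vs (- {i})))"

text \<open>The derivatives of \<Phi> produce terms with a field nab_i X_j in one slot, and
  torsion-freeness writes each bracket as a difference of such fields. These terms cancel, leaving
  the alternated \<open>nabla_Phi\<close>.\<close>

lemma ext_deriv_fields_Phi_5:
  assumes W: "open W" "W \<subseteq> points A" "q \<in> W" and Xs: "\<forall>X\<in>set Xs. smooth_vf A W X" "length Xs = 5"
  shows "ext_deriv_fields A (\<lambda>r. hodge A g \<Phi> r (\<Phi> r)) Xs q = dPhi q (map (\<lambda>X. X q) Xs)"
proof -
  have q: "q \<in> points A" using W by blast
  let ?\<Psi> = "\<lambda>r. hodge A g \<Phi> r (\<Phi> r)"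
  define v where "v i = (Xs ! i) q" for i
  define M where "M i j = nab q (v i) (Xs ! j)" for i j
  obtain X0 X1 X2 X3 X4 where X: "Xs = [X0, X1, X2, X3, X4]"
    using Xs(2) by (auto simp: eval_nat_numeral length_Suc_conv)
  have sm: "smooth_vf A W (Xs ! i)" if "i < 5" for i using Xs that by simp
  have vT: "v i \<in> tangent_space A q" if "i < 5" for i
    unfolding v_def using smooth_vfD(3)[OF sm[OF that] W(3)] .
  have MT: "M i j \<in> tangent_space A q" if "i < 5" "j < 5" for i j
    unfolding M_def by (rule affine_tangent[OF affine_connections(1) W(3) vT[OF that(1)] sm[OF that(2)]])
  have first: "(Xs ! i) q (\<lambda>r. ?\<Psi> r (map (\<lambda>X. X r) (nths Xs (- {i})))) =
      nabla_Phi q (v i) (map (\<lambda>Y. Y q) (nths Xs (- {i}))) +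
      (\<Sum>k<length (nths Xs (- {i})). \<Phi> q ((map (\<lambda>Y. Y q) (nths Xs (- {i})))[k := nab q (v i) (nths Xs (- {i}) ! k)]))"
    if i: "i < 5" for i
  proof -
    have sub: "\<forall>Y\<in>set (nths Xs (- {i})). smooth_vf A W Y"
      using Xs(1) set_nths_subset by fast
    note s = Phi_smooth[OF W(1,2) sub]
    have eq: "\<Phi> r (map (\<lambda>X. X r) (nths Xs (- {i}))) = ?\<Psi> r (map (\<lambda>X. X r) (nths Xs (- {i})))"
      if "r \<in> W" for r using hodge_Phi[of r] that W(2) by auto
    have "(Xs ! i) q (\<lambda>r. ?\<Psi> r (map (\<lambda>X. X r) (nths Xs (- {i})))) =
        v i (\<lambda>r. \<Phi> r (map (\<lambda>X. X r) (nths Xs (- {i}))))"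
      unfolding v_def[symmetric]
      by (rule tangent_local[OF vT[OF i] W(3) smooth_fun_cong[OF atlas eq s] s]) (simp_all add: eq)
    then show ?thesis using Phi_derivative[OF W vT[OF i] sub] by simp
  qed
  have second: "?\<Psi> q (lie_bracket A (Xs ! i) (Xs ! j) q # ws) = \<Phi> q (M i j # ws) - \<Phi> q (M j i # ws)"
    if ij: "i < 5" "j < 5" and ws: "set ws \<subseteq> tangent_space A q" for i j ws
  proof -
    have "lie_bracket A (Xs ! i) (Xs ! j) q = (\<lambda>f. 1 * M i j f + (-1) * M j i f)"
      using torsion_free[OF W(3) sm[OF ij(1)] sm[OF ij(2)]] by (simp add: M_def v_def)
    moreover have "\<Phi> q ([] @ (\<lambda>f. 1 * M i j f + (-1) * M j i f) # ws) =
        1 * \<Phi> q ([] @ M i j # ws) + (-1) * \<Phi> q ([] @ M j i # ws)"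
      by (rule alt_form_lin[OF Phi_alt_form[OF q]]) (use ws MT ij in auto)
    ultimately show ?thesis using hodge_Phi[OF q] by simp
  qed
  note anti = antisym_formD[OF alt_form_antisym[OF Phi_alt_form[OF q]]]
  \<comment> \<open>The differentiated field is brought to the first slot, the normal form in which
    the terms cancel.\<close>
  have m1: "\<Phi> q [x, M i j, y, z] = - \<Phi> q [M i j, x, y, z]" for x y z i j
    using anti[of "[]" x "M i j" "[y, z]"] by simp
  have m2: "\<Phi> q [x, y, M i j, z] = \<Phi> q [M i j, x, y, z]" for x y z i j
    using anti[of "[x]" y "M i j" "[z]"] m1 by simp
  have m3: "\<Phi> q [x, y, z, M i j] = - \<Phi> q [M i j, x, y, z]" for x y z i j
    using anti[of "[x, y]" z "M i j" "[]"] m2 by simp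
  have Xi: "X0 q = v 0" "X1 q = v 1" "X2 q = v 2" "X3 q = v 3" "X4 q = v 4"
    by (simp_all add: X v_def eval_nat_numeral)
  have N: "nab q u X0 = nab q u (Xs ! 0)" "nab q u X1 = nab q u (Xs ! 1)" "nab q u X2 = nab q u (Xs ! 2)"
    "nab q u X3 = nab q u (Xs ! 3)" "nab q u X4 = nab q u (Xs ! 4)" for u
    by (simp_all add: X eval_nat_numeral)
  have five: "(\<Sum>i<5. F i) = F 0 + F 1 + F 2 + F 3 + F (4::nat)" for F :: "nat \<Rightarrow> real"
    by (simp add: eval_nat_numeral)
  have two: "(\<Sum>j<5. \<Sum>i<j. G i j) = G 0 1 + (G 0 2 + G 1 2) + (G 0 3 + G 1 3 + G 2 3) +
      (G 0 4 + G 1 4 + G 2 4 + G 3 (4::nat))" for G :: "nat \<Rightarrow> nat \<Rightarrow> real"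
    by (simp add: eval_nat_numeral)
  have nth5: "nths Xs (- {0}) = [X1, X2, X3, X4]" "nths Xs (- {1}) = [X0, X2, X3, X4]"
    "nths Xs (- {2}) = [X0, X1, X3, X4]" "nths Xs (- {3}) = [X0, X1, X2, X4]" "nths Xs (- {4}) = [X0, X1, X2, X3]"
    "nths Xs (- {0, 1}) = [X2, X3, X4]" "nths Xs (- {0, 2}) = [X1, X3, X4]" "nths Xs (- {1, 2}) = [X0, X3, X4]"
    "nths Xs (- {0, 3}) = [X1, X2, X4]" "nths Xs (- {1, 3}) = [X0, X2, X4]" "nths Xs (- {2, 3}) = [X0, X1, X4]"
    "nths Xs (- {0, 4}) = [X1, X2, X3]" "nths Xs (- {1, 4}) = [X0, X2, X3]" "nths Xs (- {2, 4}) = [X0, X1, X3]"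
    "nths Xs (- {3, 4}) = [X0, X1, X2]"
    by (simp_all add: X nths_Cons eval_nat_numeral)
  have four: "(\<Sum>k<4. F k) = F 0 + F 1 + F 2 + F (3::nat)" for F :: "nat \<Rightarrow> real"
    by (simp add: eval_nat_numeral)
  have upd: "[a, b, c, d][0 := x] = [x, b, c, d]" "[a, b, c, d][1 := x] = [a, x, c, d]"
    "[a, b, c, d][2 := x] = [a, b, x, d]" "[a, b, c, d][3 := x] = [a, b, c, x]" for a b c d x :: "'m tvec"
    by (simp_all add: eval_nat_numeral)
  have nth4: "[a, b, c, d] ! 0 = a" "[a, b, c, d] ! 1 = b" "[a, b, c, d] ! 2 = c" "[a, b, c, d] ! 3 = d"
    for a b c d :: "'m vfield"
    by (simp_all add: eval_nat_numeral)
  have l4: "length [a, b, c, d] = 4" for a b c d :: "'m vfield" by simp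
  have firsts: "(\<Sum>i<5. (-1) ^ i * (Xs ! i) q (\<lambda>r. ?\<Psi> r (map (\<lambda>X. X r) (nths Xs (- {i}))))) =
      dPhi q (map (\<lambda>X. X q) Xs) + (\<Sum>i<5. (-1) ^ i * (\<Sum>k<length (nths Xs (- {i})).
        \<Phi> q ((map (\<lambda>Y. Y q) (nths Xs (- {i})))[k := nab q (v i) (nths Xs (- {i}) ! k)])))"
  proof -
    have "(\<Sum>i<5. (-1) ^ i * nabla_Phi q (v i) (map (\<lambda>Y. Y q) (nths Xs (- {i})))) = dPhi q (map (\<lambda>X. X q) Xs)"
      unfolding dPhi_def by (rule sum.cong) (use Xs(2) in \<open>simp_all add: v_def nths_map\<close>)
    then show ?thesis using first by (simp add: distrib_left sum.distrib)
  qed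
  have "(\<Sum>i<5. (-1) ^ i * (\<Sum>k<length (nths Xs (- {i})).
        \<Phi> q ((map (\<lambda>Y. Y q) (nths Xs (- {i})))[k := nab q (v i) (nths Xs (- {i}) ! k)]))) +
      (\<Sum>j<5. \<Sum>i<j. (-1) ^ (i + j) * ?\<Psi> q (lie_bracket A (Xs ! i) (Xs ! j) q # map (\<lambda>X. X q) (nths Xs (- {i, j})))) = 0"
    unfolding two unfolding five nth5 l4 four list.map upd nth4 Xi N M_def[symmetric] m1 m2 m3
    by (simp add: second vT del: One_nat_def)
  then show ?thesis unfolding ext_deriv_fields_def Xs(2) using firsts by linarith
qed


text \<open>\<open>ext_deriv\<close> accepts lists of any length, so its degree has to be proved
  before \<open>hodge_alt_form\<close> applies to it.\<close>

lemma ext_deriv_fields_Phi_other: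
  assumes W: "open W" "W \<subseteq> points A" "q \<in> W" and Xs: "\<forall>X\<in>set Xs. smooth_vf A W X" "length Xs \<noteq> 5"
  shows "ext_deriv_fields A (\<lambda>r. hodge A g \<Phi> r (\<Phi> r)) Xs q = 0"
proof -
  have zero: "hodge A g \<Phi> r (\<Phi> r) vs = 0" if "r \<in> W" "length vs \<noteq> 4" for r vs
    using hodge_Phi[of r] alt_form_zero[OF Phi_alt_form[of r], of vs] that W(2) by auto
  have c1: "length (nths Xs (- {i})) = length Xs - 1" if "i < length Xs" for i
  proof -
    have "{k. k < length Xs \<and> k \<in> - {i}} = {..<length Xs} - {i}" by auto
    then show ?thesis using that by (simp add: length_nths)
  qed
  have c2: "length (nths Xs (- {i, j})) = length Xs - 2" if "i < j" "j < length Xs" for i j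
  proof -
    have "{k. k < length Xs \<and> k \<in> - {i, j}} = {..<length Xs} - {i, j}" by auto
    moreover have "card ({..<length Xs} - {i, j}) = length Xs - 2"
      using that by (subst card_Diff_subset) auto
    ultimately show ?thesis by (simp add: length_nths)
  qed
  have "(Xs ! i) q (\<lambda>r. hodge A g \<Phi> r (\<Phi> r) (map (\<lambda>X. X r) (nths Xs (- {i})))) = 0" if i: "i < length Xs" for i
  proof -
    have u: "(Xs ! i) q \<in> tangent_space A q" using Xs i W smooth_vfD(3) nth_mem by blast
    have l: "length (map (\<lambda>X. X r) (nths Xs (- {i}))) \<noteq> 4" for r using c1[OF i] Xs(2) i by simp
    have c: "smooth_fun A W (\<lambda>r. 0)" by (rule smooth_fun_const[OF W(1,2)])
    have eq: "0 = hodge A g \<Phi> r (\<Phi> r) (map (\<lambda>X. X r) (nths Xs (- {i})))" if "r \<in> W" for r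
      using zero[OF that l] by simp
    have "(Xs ! i) q (\<lambda>r. 0) = (Xs ! i) q (\<lambda>r. hodge A g \<Phi> r (\<Phi> r) (map (\<lambda>X. X r) (nths Xs (- {i}))))"
      by (rule tangent_local[OF u W(3) c smooth_fun_cong[OF atlas eq c]]) (simp_all add: eq)
    moreover have "(Xs ! i) q (\<lambda>r. 0) = 0"
      using tangent_apply_const[OF u _ open_points[OF atlas], of 0] W by blast
    ultimately show ?thesis by simp
  qed
  moreover have "hodge A g \<Phi> q (\<Phi> q)
      (lie_bracket A (Xs ! i) (Xs ! j) q # map (\<lambda>X. X q) (nths Xs (- {i, j}))) = 0"
    if "i < j" "j < length Xs" for i j
    using c2[OF that] that Xs(2) by (intro zero[OF W(3)]) auto
  ultimately show ?thesis unfolding ext_deriv_fields_def by simp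
qed

lemma ext_deriv_Phi:
  assumes q: "q \<in> points A" and vs: "set vs \<subseteq> tangent_space A q"
  shows "ext_deriv A (\<lambda>r. hodge A g \<Phi> r (\<Phi> r)) q vs = (if length vs = 5 then dPhi q vs else 0)"
proof -
  have val: "ext_deriv_fields A (\<lambda>r. hodge A g \<Phi> r (\<Phi> r)) Xs q = (if length vs = 5 then dPhi q vs else 0)"
    if "q \<in> W" "\<forall>X\<in>set Xs. smooth_vf A W X" "open W" "W \<subseteq> points A" "map (\<lambda>X. X q) Xs = vs" for W Xs
  proof (cases "length vs = 5")
    case True
    then have "length Xs = 5" using that(5) by auto
    from ext_deriv_fields_Phi_5[OF that(3,4,1,2) this] show ?thesis using that(5) True by simp
  next
    case False
    then have "length Xs \<noteq> 5" using that(5) by auto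
    from ext_deriv_fields_Phi_other[OF that(3,4,1,2) this] show ?thesis using False by simp
  qed
  \<comment> \<open>One extension exists, so the condition under \<open>THE\<close> is not vacuous
    and determines \<open>r\<close>.\<close>
  obtain Xs W where X: "q \<in> W" "open W" "W \<subseteq> points A" "\<forall>X\<in>set Xs. smooth_vf A W X" "map (\<lambda>X. X q) Xs = vs"
    using extension_exists_list[OF q vs] by blast
  have "(THE r. \<forall>W Xs. q \<in> W \<and> (\<forall>X\<in>set Xs. smooth_vf A W X) \<and> open W \<and> W \<subseteq> points A \<and>
      map (\<lambda>X. X q) Xs = vs \<longrightarrow> ext_deriv_fields A (\<lambda>r. hodge A g \<Phi> r (\<Phi> r)) Xs q = r) =
      (if length vs = 5 then dPhi q vs else 0)"
  proof (rule the_equality)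
    show "\<forall>W Xs. q \<in> W \<and> (\<forall>X\<in>set Xs. smooth_vf A W X) \<and> open W \<and> W \<subseteq> points A \<and>
        map (\<lambda>X. X q) Xs = vs \<longrightarrow> ext_deriv_fields A (\<lambda>r. hodge A g \<Phi> r (\<Phi> r)) Xs q =
        (if length vs = 5 then dPhi q vs else 0)"
    proof (intro allI impI, elim conjE)
      fix W Xs assume "q \<in> W" "\<forall>X\<in>set Xs. smooth_vf A W X" "open W" "W \<subseteq> points A" "map (\<lambda>X. X q) Xs = vs"
      then show "ext_deriv_fields A (\<lambda>r. hodge A g \<Phi> r (\<Phi> r)) Xs q = (if length vs = 5 then dPhi q vs else 0)"
        by (rule val)
    qed
  next
    fix r assume "\<forall>W Xs. q \<in> W \<and> (\<forall>X\<in>set Xs. smooth_vf A W X) \<and> open W \<and> W \<subseteq> points A \<and>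
        map (\<lambda>X. X q) Xs = vs \<longrightarrow> ext_deriv_fields A (\<lambda>r. hodge A g \<Phi> r (\<Phi> r)) Xs q = r"
    from this[THEN spec[of _ W], THEN spec[of _ Xs]]
    have "ext_deriv_fields A (\<lambda>r. hodge A g \<Phi> r (\<Phi> r)) Xs q = r" using X by simp
    then show "r = (if length vs = 5 then dPhi q vs else 0)" using val[OF X(1,4,2,3,5)] by simp
  qed
  then show ?thesis using vs unfolding ext_deriv_def by simp
qed

lemma nabla_Phi_frame_at:
  assumes q: "q \<in> points A" and js: "set js \<subseteq> {..<8}" and i: "i < 8"
  defines "f \<equiv> frame_at A g \<Phi> q"
  shows "nabla_Phi q (f i) (map f js) = act (xic q f i) js"
proof -
  note frame = frame_at_frame[OF q, folded f_def]
  have "\<Phi> q ((map f js)[k := xi q (f i) (map f js ! k)]) = (\<Sum>m<8. xic q f i (js ! k) m * phi (js[k := m]))"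
    if k: "k < length js" for k
  proof -
    have jk: "js ! k < 8" using js k nth_mem by blast
    have sub: "set (take k js) \<subseteq> {..<8}" "set (drop (Suc k) js) \<subseteq> {..<8}"
      using js set_take_subset set_drop_subset by (meson subset_trans)+
    have "\<Phi> q ((map f js)[k := xi q (f i) (map f js ! k)]) =
        \<Phi> q (map f (take k js) @ (\<lambda>h. \<Sum>m<8. xic q f i (js ! k) m * f m h) # map f (drop (Suc k) js))"
      using k xi_frame[OF frame q i jk] by (simp add: upd_conv_take_nth_drop take_map drop_map)
    also have "\<dots> = (\<Sum>m<8. xic q f i (js ! k) m * \<Phi> q (map f (take k js) @ f m # map f (drop (Suc k) js)))"
      using frame_map_subset[OF frame] sub orthonormal_frameD(1)[OF frame]
      by (intro alt_form_sum[OF Phi_alt_form[OF q]]) auto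
    also have "\<dots> = (\<Sum>m<8. xic q f i (js ! k) m * phi (js[k := m]))"
    proof (rule sum.cong[OF refl])
      fix m :: nat assume "m \<in> {..<8}"
      then have "\<Phi> q (map f (take k js @ m # drop (Suc k) js)) = phi (take k js @ m # drop (Suc k) js)"
        unfolding f_def using sub by (intro Phi_frame_at[OF q]) auto
      then show "xic q f i (js ! k) m * \<Phi> q (map f (take k js) @ f m # map f (drop (Suc k) js)) =
          xic q f i (js ! k) m * phi (js[k := m])"
        using k by (simp add: upd_conv_take_nth_drop)
    qed
    finally show ?thesis .
  qed
  then show ?thesis by (simp add: nabla_Phi_def act_def)
qed

lemma dPhi_frame_at:
  assumes q: "q \<in> points A" and js: "set js \<subseteq> {..<8}"
  defines "f \<equiv> frame_at A g \<Phi> q"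
  shows "dPhi q (map f js) = dphi (xic q f) js"
proof -
  have "nabla_Phi q (map f js ! i) (nths (map f js) (- {i})) = act (xic q f (js ! i)) (nths js (- {i}))"
    if i: "i < length js" for i
  proof -
    have "set (nths js (- {i})) \<subseteq> {..<8}" using js set_nths_subset by fast
    moreover have "js ! i < 8" using js i nth_mem by blast
    ultimately show ?thesis
      using nabla_Phi_frame_at[OF q, of "nths js (- {i})" "js ! i"] i unfolding f_def by (simp add: nths_map)
  qed
  then show ?thesis by (simp add: dPhi_def dphi_def)
qed

section \<open>Codifferential and Lee form\<close>

lemma codifferential_alt_form:
  assumes q: "q \<in> points A"
  shows "alt_form A q 3 (codifferential A g \<Phi> \<Phi> q)"
proof -
  have "ext_deriv A (\<lambda>r. hodge A g \<Phi> r (\<Phi> r)) q vs = 0" if "length vs \<noteq> 5" for vs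
  proof (cases "set vs \<subseteq> tangent_space A q")
    case True
    then show ?thesis using ext_deriv_Phi[OF q] that by simp
  qed (simp add: ext_deriv_def)
  then have "alt_form A q 3 (hodge A g \<Phi> q (ext_deriv A (\<lambda>r. hodge A g \<Phi> r (\<Phi> r)) q))"
    using hodge_alt_form[OF frame_at_frame[OF q] metric q, of 5] by simp
  from alt_form_lincomb[OF this this, of "-1" 0] show ?thesis by (simp add: codifferential_def[abs_def])
qed

lemma codifferential_frame_at:
  assumes q: "q \<in> points A" and js: "distinct js" "set js \<subseteq> {..<8}" "length js = 3"
  defines "f \<equiv> frame_at A g \<Phi> q"
  shows "codifferential A g \<Phi> \<Phi> q (map f js) = delta (xic q f) js"
proof -
  let ?c = "filter (\<lambda>i. i \<notin> set js) [0..<8]"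
  have sub: "set ?c \<subseteq> {..<8}" by auto
  have "length ?c = card ({..<8} - set js)"
    by (subst distinct_card[symmetric]) (auto intro!: arg_cong[where f=card])
  also have "\<dots> = 5" using js by (subst card_Diff_subset) (auto simp: distinct_card)
  finally have l: "length ?c = 5" .
  have "ext_deriv A (\<lambda>r. hodge A g \<Phi> r (\<Phi> r)) q (map f ?c) = dphi (xic q f) ?c"
    using ext_deriv_Phi[OF q frame_map_subset[OF frame_at_frame[OF q] sub]] l dPhi_frame_at[OF q sub]
    unfolding f_def by simp
  then show ?thesis
    unfolding codifferential_def f_def hodge_star[OF q js(1,2)] delta_def star_def by simp
qed

lemma wedge_codifferential_frame_at:
  assumes q: "q \<in> points A" and js: "distinct js" "set js \<subseteq> {..<8}" "length js = 7"
  defines "f \<equiv> frame_at A g \<Phi> q"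
  shows "wedge (codifferential A g \<Phi> \<Phi> q) (\<Phi> q) (map f js) =
    shuffle_sum (\<lambda>ys zs. delta (xic q f) ys * phi zs) js"
  unfolding wedge_eq_shuffle_sum shuffle_sum_map
proof (rule shuffle_sum_cong)
  fix ys zs assume l: "length ys + length zs = length js" and s: "set ys \<union> set zs = set js"
  have sub: "set ys \<subseteq> {..<8}" "set zs \<subseteq> {..<8}" using s js(2) by auto
  have P: "\<Phi> q (map f zs) = phi zs" unfolding f_def by (rule Phi_frame_at[OF q sub(2)])
  show "codifferential A g \<Phi> \<Phi> q (map f ys) * \<Phi> q (map f zs) = delta (xic q f) ys * phi zs"
  proof (cases "length zs = 4")
    case True
    \<comment> \<open>Counting: \<open>js\<close> has no repetitions and is covered by
      \<open>ys\<close> and \<open>zs\<close>, whose lengths add up to its length, so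
      \<open>ys\<close> has none either, as \<open>codifferential_frame_at\<close> requires.\<close>
    have "length js \<le> card (set ys) + card (set zs)"
      using card_Un_le[of "set ys" "set zs"] s js(1) by (simp add: distinct_card)
    then have "card (set ys) = length ys"
      using card_length[of ys] card_length[of zs] l by linarith
    then have "distinct ys" by (rule card_distinct)
    then show ?thesis
      using codifferential_frame_at[OF q, of ys] sub l True js(3) P unfolding f_def by simp
  next
    case False
    then show ?thesis using P phi_length by simp
  qed
qed

lemma lee_form_alt_form:
  assumes q: "q \<in> points A"
  shows "alt_form A q 1 (lee_form A g \<Phi> q)"
proof -
  have w: "alt_form A q 7 (wedge (codifferential A g \<Phi> \<Phi> q) (\<Phi> q))"
    using alt_form_wedge[OF codifferential_alt_form[OF q] Phi_alt_form[OF q]] by simp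
  have "alt_form A q (8 - 7) (hodge A g \<Phi> q (wedge (codifferential A g \<Phi> \<Phi> q) (\<Phi> q)))"
    by (rule hodge_alt_form[OF frame_at_frame[OF q] metric q]) (auto intro: alt_form_zero[OF w])
  then have h: "alt_form A q 1 (hodge A g \<Phi> q (wedge (codifferential A g \<Phi> \<Phi> q) (\<Phi> q)))" by simp
  from alt_form_lincomb[OF h h, of "1/7" 0] show ?thesis by (simp add: lee_form_def[abs_def])
qed

lemma xic_frame_at_eigen2:
  assumes q: "q \<in> points A" and i: "i < 8"
  shows "eigen2 6 (xic q (frame_at A g \<Phi> q) i)"
proof -
  obtain W where W: "q \<in> W" "adapted_frame_on A g \<Phi> W (adapted_frame A g \<Phi> q)"
    by (rule adapted_frame_exists[OF q])
  have "frame_at A g \<Phi> q = (\<lambda>i. adapted_frame A g \<Phi> q i q)" by (simp add: frame_at_def fun_eq_iff)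
  then show ?thesis using xic_eigen2[OF W(2,1) i] by simp
qed

lemma lee_form_frame_at:
  assumes q: "q \<in> points A" and c: "c < 8"
  defines "f \<equiv> frame_at A g \<Phi> q"
  shows "lee_form A g \<Phi> q [f c] = 16 / 7 * trace8 (xic q f) c"
proof -
  let ?c = "filter (\<lambda>i. i \<notin> set [c]) [0..<8]"
  have "wedge (codifferential A g \<Phi> \<Phi> q) (\<Phi> q) (map f ?c) =
      shuffle_sum (\<lambda>ys zs. delta (xic q f) ys * phi zs) ?c"
    unfolding f_def
    by (rule wedge_codifferential_frame_at[OF q _ _ complement_singleton[OF c]]) auto
  then have "star (\<lambda>js. wedge (codifferential A g \<Phi> \<Phi> q) (\<Phi> q) (map f js)) [c] =
      star (shuffle_sum (\<lambda>ys zs. delta (xic q f) ys * phi zs)) [c]" by (simp only: star_def)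
  also have "\<dots> = 16 * trace8 (xic q f) c"
    unfolding f_def by (rule star_delta_wedge_phi(1)[OF xic_frame_at_eigen2[OF q] c])
  finally show ?thesis
    using hodge_star[OF q, of "[c]" "wedge (codifferential A g \<Phi> \<Phi> q) (\<Phi> q)"] c
    by (simp add: lee_form_def f_def)
qed

text \<open>Stated for every orthonormal frame: along a smooth frame the dual field becomes visibly
  smooth, although \<open>lee_form\<close> itself is evaluated in frames chosen pointwise.\<close>

lemma sharp_lee_form:
  assumes q: "q \<in> points A" and e: "orthonormal_frame A g q e"
  shows "sharp A g (lee_form A g \<Phi>) q = (\<lambda>h. \<Sum>j<8. 16 / 7 * xi q (e j) (e j) h)"
proof -
  define f where "f = frame_at A g \<Phi> q"
  note frame = frame_at_frame[OF q, folded f_def]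
  note eT = orthonormal_frameD(1)[OF e] and fT = orthonormal_frameD(1)[OF frame]
  have xiT: "(\<lambda>h. \<Sum>j<8. 16 / 7 * xi q (e j) (e j) h) \<in> tangent_space A q"
    using xi_tangent[OF q] eT by (intro tangent_sum) auto
  have lee: "lee_form A g \<Phi> q [w] = g q (\<lambda>h. \<Sum>j<8. 16 / 7 * xi q (e j) (e j) h) w"
    if w: "w \<in> tangent_space A q" for w
  proof -
    define a where "a c = g q w (f c)" for c
    have wf: "w = (\<lambda>h. \<Sum>c<8. a c * f c h)" unfolding a_def by (rule frame_expansion[OF frame metric q w])
    \<comment> \<open>The trace of \<xi> is moved to the frame \<open>f\<close>, in which the Lee
      form is known.\<close>
    have tr: "trace8 (xic q f) c = (\<Sum>j<8. g q (xi q (e j) (e j)) (f c))" if c: "c < 8" for c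
    proof -
      have "(\<Sum>j<8. g q (xi q (e j) (e j)) (f c)) = (\<Sum>j<8. g q (xi q (f j) (f j)) (f c))"
        by (rule trace_frame_independent[OF e frame metric q, where B = "\<lambda>u v. g q (xi q u v) (f c)"])
          (simp_all add: xi_lin_direction[OF q] xi_lin[OF q] riemannian_metricD(1)[OF metric q _ _ fT[OF c]] xi_tangent[OF q])
      then show ?thesis by (simp add: trace8_def xic_def)
    qed
    have "lee_form A g \<Phi> q [w] = lee_form A g \<Phi> q ([] @ (\<lambda>h. \<Sum>c<8. a c * f c h) # [])" using wf by simp
    also have "\<dots> = (\<Sum>c<8. a c * lee_form A g \<Phi> q [f c])"
      using alt_form_sum[OF lee_form_alt_form[OF q], of "[]" "[]" "{..<8}" f a] fT by simp
    also have "\<dots> = (\<Sum>c<8. a c * (16 / 7 * (\<Sum>j<8. g q (xi q (e j) (e j)) (f c))))"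
      by (rule sum.cong[OF refl]) (use lee_form_frame_at[OF q] tr in \<open>simp add: f_def\<close>)
    also have "\<dots> = (\<Sum>c<8. a c * g q (\<lambda>h. \<Sum>j<8. 16 / 7 * xi q (e j) (e j) h) (f c))"
    proof (rule sum.cong[OF refl])
      fix c :: nat assume c: "c \<in> {..<8}"
      have "g q (\<lambda>h. \<Sum>j<8. 16 / 7 * xi q (e j) (e j) h) (f c) = (\<Sum>j<8. 16 / 7 * g q (xi q (e j) (e j)) (f c))"
        by (rule metric_sum[OF metric q]) (use xi_tangent[OF q] eT fT c in auto)
      then show "a c * (16 / 7 * (\<Sum>j<8. g q (xi q (e j) (e j)) (f c))) =
          a c * g q (\<lambda>h. \<Sum>j<8. 16 / 7 * xi q (e j) (e j) h) (f c)"
        by (simp add: sum_distrib_left)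
    qed
    also have "\<dots> = (\<Sum>c<8. a c * g q (f c) (\<lambda>h. \<Sum>j<8. 16 / 7 * xi q (e j) (e j) h))"
      by (rule sum.cong[OF refl]) (use riemannian_metricD(2)[OF metric q xiT _ xiT] fT in auto)
    also have "\<dots> = g q w (\<lambda>h. \<Sum>j<8. 16 / 7 * xi q (e j) (e j) h)"
      by (subst wf, rule metric_sum[OF metric q, symmetric]) (use fT xiT in auto)
    also have "\<dots> = g q (\<lambda>h. \<Sum>j<8. 16 / 7 * xi q (e j) (e j) h) w"
      by (rule riemannian_metricD(2)[OF metric q w xiT xiT])
    finally show ?thesis .
  qed
  show ?thesis
    unfolding sharp_def
  proof (rule the_equality)
    show "(\<lambda>h. \<Sum>j<8. 16 / 7 * xi q (e j) (e j) h) \<in> tangent_space A q \<and>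
        (\<forall>w\<in>tangent_space A q. g q (\<lambda>h. \<Sum>j<8. 16 / 7 * xi q (e j) (e j) h) w = lee_form A g \<Phi> q [w])"
      using xiT lee by simp
    fix v assume "v \<in> tangent_space A q \<and> (\<forall>w\<in>tangent_space A q. g q v w = lee_form A g \<Phi> q [w])"
    then show "v = (\<lambda>h. \<Sum>j<8. 16 / 7 * xi q (e j) (e j) h)"
      using xiT lee by (intro metric_frame_eqI[OF metric q]) auto
  qed
qed

end

section \<open>The decomposition of 3-forms\<close>

lemma ksubs_props: "distinct xs \<Longrightarrow> js \<in> set (ksubs k xs) \<Longrightarrow> distinct js \<and> length js = k \<and> set js \<subseteq> set xs"
proof (induction k xs arbitrary: js rule: ksubs.induct)
  case (3 k x xs)
  consider ys where "js = x # ys" "ys \<in> set (ksubs k xs)" | "js \<in> set (ksubs (Suc k) xs)"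
    using "3.prems"(2) by auto
  then show ?case
  proof cases
    case 1
    then show ?thesis using "3.IH"(1)[of ys] "3.prems"(1) by auto
  next
    case 2
    then show ?thesis using "3.IH"(2)[of js] "3.prems"(1) by auto
  qed
qed simp_all

lemma ksubs_8:
  assumes "js \<in> set (ksubs k [0..<8])"
  shows "distinct js" "length js = k" "set js \<subseteq> {..<8}"
  using ksubs_props[OF _ assms] by auto

text \<open>An increasing list of length 7 omits a single index and the sign is not 0, so
  \<open>star\<close> loses no component of a 7-form.\<close>

lemma ksubs_7_complement:
  assumes "js \<in> set (ksubs 7 [0..<8])"
  obtains c where "c < 8" "js = filter (\<lambda>i. i \<notin> set [c]) [0..<8]" "csign [0..<8] (js @ [c]) \<noteq> 0"
proof -
  have ex: "(\<exists>i<8. P i) \<longleftrightarrow> P 0 \<or> P 1 \<or> P 2 \<or> P 3 \<or> P 4 \<or> P 5 \<or> P 6 \<or> P (7::nat)" for P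
    using all_less_8[of "\<lambda>i. \<not> P i"] by blast
  have "\<forall>js\<in>set (ksubs 7 [0..<8]). \<exists>c<8. js = filter (\<lambda>i. i \<notin> set [c]) [0..<8] \<and> csign [0..<8] (js @ [c]) \<noteq> 0"
    unfolding ex by (simp add: upt_0_8 ksubs_numeral del: One_nat_def)
  then show ?thesis using assms that by blast
qed

lemma wedge_phi_cong:
  assumes "distinct js" "set js \<subseteq> {..<8}" "length js = 7"
    "\<And>zs. distinct zs \<Longrightarrow> set zs \<subseteq> {..<8} \<Longrightarrow> length zs = 3 \<Longrightarrow> F zs = G zs"
  shows "wedge_phi F js = wedge_phi G js"
  unfolding wedge_phi_def
proof (rule shuffle_sum_cong)
  fix ys zs assume l: "length ys + length zs = length js" and s: "set ys \<union> set zs = set js"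
  show "phi ys * F zs = phi ys * G zs"
  proof (cases "length ys = 4")
    case True
    have "length js \<le> card (set ys) + card (set zs)"
      using card_Un_le[of "set ys" "set zs"] s assms(1) by (simp add: distinct_card)
    then have "card (set zs) = length zs"
      using card_length[of ys] card_length[of zs] l by linarith
    then have "distinct zs" by (rule card_distinct)
    moreover have "set zs \<subseteq> {..<8}" using s assms(2) by blast
    ultimately show ?thesis using assms(4)[of zs] l True assms(3) by simp
  next
    case False
    then show ?thesis using phi_length by simp
  qed
qed

lemma star_wedge_phi_cong:
  assumes "c < 8" "\<And>zs. distinct zs \<Longrightarrow> set zs \<subseteq> {..<8} \<Longrightarrow> length zs = 3 \<Longrightarrow> F zs = G zs"
  shows "star (wedge_phi F) [c] = star (wedge_phi G) [c]"
proof -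
  let ?c = "filter (\<lambda>i. i \<notin> set [c]) [0..<8]"
  have "wedge_phi F ?c = wedge_phi G ?c"
    by (rule wedge_phi_cong[OF _ _ complement_singleton[OF assms(1)] assms(2)]) auto
  then show ?thesis by (simp only: star_def)
qed

lemma star_wedge_phi_lincomb:
  "star (wedge_phi (\<lambda>js. a * F js + b * G js)) js = a * star (wedge_phi F) js + b * star (wedge_phi G) js"
proof -
  have "wedge_phi (\<lambda>js. a * F js + b * G js) is = a * wedge_phi F is + b * wedge_phi G is" for "is"
    unfolding wedge_phi_def shuffle_sum_lincomb[symmetric] by (simp add: algebra_simps)
  then show ?thesis unfolding star_def by (simp add: algebra_simps)
qed

context spin7_geometry
begin

lemma hodge_wedge_one_form:
  assumes q: "q \<in> points A" and b: "alt_form A q 1 \<beta>"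
  shows "alt_form A q 3 (hodge A g \<Phi> q (wedge (\<Phi> q) \<beta>))"
    and "js \<in> set (ksubs 3 [0..<8]) \<Longrightarrow> hodge A g \<Phi> q (wedge (\<Phi> q) \<beta>) (map (frame_at A g \<Phi> q) js) =
      (\<Sum>n<8. phi (n # js) * \<beta> [frame_at A g \<Phi> q n])"
proof -
  have w: "alt_form A q 5 (wedge (\<Phi> q) \<beta>)" using alt_form_wedge[OF Phi_alt_form[OF q] b] by simp
  have "alt_form A q (8 - 5) (hodge A g \<Phi> q (wedge (\<Phi> q) \<beta>))"
    by (rule hodge_alt_form[OF frame_at_frame[OF q] metric q]) (auto intro: alt_form_zero[OF w])
  then show "alt_form A q 3 (hodge A g \<Phi> q (wedge (\<Phi> q) \<beta>))" by simp
  show "hodge A g \<Phi> q (wedge (\<Phi> q) \<beta>) (map (frame_at A g \<Phi> q) js) =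
      (\<Sum>n<8. phi (n # js) * \<beta> [frame_at A g \<Phi> q n])" if "js \<in> set (ksubs 3 [0..<8])"
    using hodge_wedge_Phi_frame[OF q ksubs_8(1,3)[OF that], of \<beta>]
      star_wedge_phi_1[OF that, of "\<lambda>js. \<beta> (map (frame_at A g \<Phi> q) js)"] by simp
qed

lemma Lambda3_48_iff:
  assumes q: "q \<in> points A" and \<gamma>: "alt_form A q 3 \<gamma>"
  shows "\<gamma> \<in> Lambda3_48 A \<Phi> q \<longleftrightarrow> (\<forall>c<8. star (wedge_phi (\<lambda>js. \<gamma> (map (frame_at A g \<Phi> q) js))) [c] = 0)"
    (is "_ \<longleftrightarrow> ?R")
proof
  assume "\<gamma> \<in> Lambda3_48 A \<Phi> q"
  then have "wedge (\<Phi> q) \<gamma> = (\<lambda>vs. 0)" unfolding Lambda3_48_def by blast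
  then have "hodge A g \<Phi> q (wedge (\<Phi> q) \<gamma>) vs = 0" for vs by (simp add: hodge_def Let_def)
  then show ?R using hodge_wedge_Phi_frame[OF q, of "[_]" \<gamma>] by simp
next
  assume R: ?R
  have w: "alt_form A q 7 (wedge (\<Phi> q) \<gamma>)" using alt_form_wedge[OF Phi_alt_form[OF q] \<gamma>] by simp
  have "wedge (\<Phi> q) \<gamma> = (\<lambda>vs. 0)"
  proof (rule alt_form_frame_eqI[OF frame_at_frame[OF q] w alt_form_const_zero])
    fix js :: "nat list" assume js: "js \<in> set (ksubs 7 [0..<8])" "set js \<subseteq> {..<8}"
    obtain c where c: "c < 8" "js = filter (\<lambda>i. i \<notin> set [c]) [0..<8]" "csign [0..<8] (js @ [c]) \<noteq> 0"
      by (rule ksubs_7_complement[OF js(1)])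
    have "star (wedge_phi (\<lambda>js. \<gamma> (map (frame_at A g \<Phi> q) js))) [c] = 0" using R c(1) by blast
    then have "wedge_phi (\<lambda>js. \<gamma> (map (frame_at A g \<Phi> q) js)) js = 0"
      using c(3) unfolding star_def c(2)[symmetric] by simp
    then show "wedge (\<Phi> q) \<gamma> (map (frame_at A g \<Phi> q) js) = 0"
      using wedge_Phi_frame[OF q js(2), of \<gamma>] by simp
  qed
  then show "\<gamma> \<in> Lambda3_48 A \<Phi> q" using \<gamma> unfolding Lambda3_48_def by blast
qed

text \<open>The map F \<mapsto> \<star>(\<Phi> \<and> F) takes \<delta>\<Phi> to 16 T = 7 \<theta>
  and \<star>(\<Phi> \<and> \<theta>) to -7 \<theta>. The sum of the two forms is therefore in its
  kernel, which is \<Lambda>3_48.\<close>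

lemma component3_48_codifferential:
  assumes q: "q \<in> points A"
  shows "component3_48 A g \<Phi> q (codifferential A g \<Phi> \<Phi> q) =
    (\<lambda>vs. 1 * codifferential A g \<Phi> \<Phi> q vs + 1 * hodge A g \<Phi> q (wedge (\<Phi> q) (lee_form A g \<Phi> q)) vs)"
proof -
  define f where "f = frame_at A g \<Phi> q"
  note frame = frame_at_frame[OF q, folded f_def]
  define \<delta> where "\<delta> = codifferential A g \<Phi> \<Phi> q"
  define \<theta> where "\<theta> = lee_form A g \<Phi> q"
  define H where "H \<beta> = hodge A g \<Phi> q (wedge (\<Phi> q) \<beta>)" for \<beta>
  define \<gamma> where "\<gamma> = (\<lambda>vs. 1 * \<delta> vs + 1 * H \<theta> vs)"
  have \<delta>: "alt_form A q 3 \<delta>" unfolding \<delta>_def by (rule codifferential_alt_form[OF q])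
  have \<theta>: "alt_form A q 1 \<theta>" unfolding \<theta>_def by (rule lee_form_alt_form[OF q])
  note H = hodge_wedge_one_form[OF q, folded H_def f_def]
  have \<gamma>: "alt_form A q 3 \<gamma>" unfolding \<gamma>_def by (rule alt_form_lincomb[OF \<delta> H(1)[OF \<theta>]])
  note L48 = Lambda3_48_iff[OF q, folded f_def]
  have "star (wedge_phi (\<lambda>js. \<gamma> (map f js))) [c] = 0" if c: "c < 8" for c
  proof -
    have "star (wedge_phi (\<lambda>js. \<delta> (map f js))) [c] = star (wedge_phi (delta (xic q f))) [c]"
      unfolding \<delta>_def f_def by (rule star_wedge_phi_cong[OF c codifferential_frame_at[OF q]])
    also have "\<dots> = 16 * trace8 (xic q f) c"
      unfolding f_def by (rule star_delta_wedge_phi(2)[OF xic_frame_at_eigen2[OF q] c])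
    finally have 1: "star (wedge_phi (\<lambda>js. \<delta> (map f js))) [c] = 16 * trace8 (xic q f) c" .
    have "star (wedge_phi (\<lambda>js. H \<theta> (map f js))) [c] = - 7 * \<theta> [f c]"
      by (rule star_wedge_phi_3[OF H(2)[OF \<theta>] c])
    also have "\<dots> = - 16 * trace8 (xic q f) c"
      unfolding \<theta>_def f_def lee_form_frame_at[OF q c] by simp
    finally show ?thesis unfolding \<gamma>_def star_wedge_phi_lincomb 1 by simp
  qed
  then have g48: "\<gamma> \<in> Lambda3_48 A \<Phi> q" using L48[OF \<gamma>] by blast
  define \<beta> where "\<beta> = (\<lambda>vs. - 1 * \<theta> vs + 0 * \<theta> vs)"
  have \<beta>: "alt_form A q 1 \<beta>" unfolding \<beta>_def by (rule alt_form_lincomb[OF \<theta> \<theta>])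
  have diff: "(\<lambda>vs. \<delta> vs - \<gamma> vs) = H \<beta>"
  proof (rule alt_form_frame_eqI[OF frame _ H(1)[OF \<beta>]])
    show "alt_form A q 3 (\<lambda>vs. \<delta> vs - \<gamma> vs)" using alt_form_lincomb[OF \<delta> \<gamma>, of 1 "-1"] by simp
    fix js :: "nat list" assume "js \<in> set (ksubs 3 [0..<8])"
    then show "\<delta> (map f js) - \<gamma> (map f js) = H \<beta> (map f js)"
      using H(2)[OF \<theta>] H(2)[OF \<beta>] by (simp add: \<gamma>_def \<beta>_def sum_negf)
  qed
  have "component3_48 A g \<Phi> q \<delta> = \<gamma>"
    unfolding component3_48_def
  proof (rule the_equality)
    show "\<gamma> \<in> Lambda3_48 A \<Phi> q \<and> (\<lambda>vs. \<delta> vs - \<gamma> vs) \<in> Lambda3_8 A g \<Phi> q"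
      using g48 \<beta> unfolding diff unfolding Lambda3_8_def H_def by blast
    fix \<gamma>' assume *: "\<gamma>' \<in> Lambda3_48 A \<Phi> q \<and> (\<lambda>vs. \<delta> vs - \<gamma>' vs) \<in> Lambda3_8 A g \<Phi> q"
    then obtain \<beta>' where \<beta>': "alt_form A q 1 \<beta>'" "(\<lambda>vs. \<delta> vs - \<gamma>' vs) = H \<beta>'"
      unfolding Lambda3_8_def H_def by blast
    have \<gamma>': "alt_form A q 3 \<gamma>'" using * unfolding Lambda3_48_def by blast
    \<comment> \<open>Two candidates differ by an element of \<Lambda>3_8 whose wedge product with
      \<Phi> vanishes; the factor -7 forces it to be 0.\<close>
    have D: "1 * \<gamma>' (map f js) + (-1) * \<gamma> (map f js) = (\<Sum>n<8. phi (n # js) * (\<beta> [f n] - \<beta>' [f n]))"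
      if "js \<in> set (ksubs 3 [0..<8])" for js
      using fun_cong[OF \<beta>'(2), of "map f js"] fun_cong[OF diff, of "map f js"] H(2)[OF \<beta> that] H(2)[OF \<beta>'(1) that]
      by (simp add: right_diff_distrib sum_subtractf)
    have "\<beta> [f c] - \<beta>' [f c] = 0" if c: "c < 8" for c
    proof -
      have "- 7 * (\<beta> [f c] - \<beta>' [f c]) = star (wedge_phi (\<lambda>js. 1 * \<gamma>' (map f js) + (-1) * \<gamma> (map f js))) [c]"
        by (rule star_wedge_phi_3[OF D c, symmetric])
      also have "\<dots> = 0"
        unfolding star_wedge_phi_lincomb using L48[OF \<gamma>] L48[OF \<gamma>'] g48 * c by simp
      finally show ?thesis by simp
    qed
    then have "\<gamma>' (map f js) = \<gamma> (map f js)" if "js \<in> set (ksubs 3 [0..<8])" for js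
      using D[OF that] by simp
    then show "\<gamma>' = \<gamma>" by (intro alt_form_frame_eqI[OF frame \<gamma>' \<gamma>])
  qed
  then show ?thesis unfolding \<gamma>_def \<delta>_def \<theta>_def H_def .
qed

lemma lee_form_norm2:
  assumes q: "q \<in> points A"
  shows "form_norm2 A g \<Phi> q (lee_form A g \<Phi> q) = 256 / 49 * (\<Sum>l<8. (trace8 (xic q (frame_at A g \<Phi> q)) l)\<^sup>2)"
proof -
  have "form_norm2 A g \<Phi> q (lee_form A g \<Phi> q) = (\<Sum>l<8. (lee_form A g \<Phi> q [frame_at A g \<Phi> q l])\<^sup>2)"
    unfolding form_norm2_frame[OF lee_form_alt_form[OF q]]
    by (simp add: upt_0_8 ksubs_numeral sum_lessThan_8 del: One_nat_def)
  also have "\<dots> = (\<Sum>l<8. 256 / 49 * (trace8 (xic q (frame_at A g \<Phi> q)) l)\<^sup>2)"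
    by (rule sum.cong[OF refl]) (simp add: lee_form_frame_at[OF q] power2_eq_square)
  finally show ?thesis by (simp add: sum_distrib_left)
qed

lemma component3_48_norm2:
  assumes q: "q \<in> points A"
  defines "x \<equiv> xic q (frame_at A g \<Phi> q)"
  shows "form_norm2 A g \<Phi> q (component3_48 A g \<Phi> q (codifferential A g \<Phi> \<Phi> q)) =
    80 / 7 * (\<Sum>l<8. (trace8 x l)\<^sup>2) + 16 * (\<Sum>i<8. \<Sum>j<8. \<Sum>m<8. x i j m * x j i m)"
proof -
  define f where "f = frame_at A g \<Phi> q"
  define t where "t n = 16 / 7 * trace8 x n" for n
  note eig = xic_frame_at_eigen2[OF q, folded x_def]
  have alt: "alt_form A q 3 (component3_48 A g \<Phi> q (codifferential A g \<Phi> \<Phi> q))"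
    unfolding component3_48_codifferential[OF q]
    by (rule alt_form_lincomb[OF codifferential_alt_form[OF q] hodge_wedge_one_form(1)[OF q lee_form_alt_form[OF q]]])
  have val: "(component3_48 A g \<Phi> q (codifferential A g \<Phi> \<Phi> q) (map f js))\<^sup>2 =
      (delta x js)\<^sup>2 + 2 * (delta x js * (\<Sum>n<8. phi (n # js) * t n)) + (\<Sum>n<8. phi (n # js) * t n)\<^sup>2"
    if js: "js \<in> set (ksubs 3 [0..<8])" for js
  proof -
    have "codifferential A g \<Phi> \<Phi> q (map f js) = delta x js"
      unfolding f_def x_def by (rule codifferential_frame_at[OF q ksubs_8(1,3,2)[OF js]])
    moreover have "hodge A g \<Phi> q (wedge (\<Phi> q) (lee_form A g \<Phi> q)) (map f js) = (\<Sum>n<8. phi (n # js) * t n)"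
      unfolding f_def hodge_wedge_one_form(2)[OF q lee_form_alt_form[OF q] js]
      by (rule sum.cong[OF refl]) (simp add: lee_form_frame_at[OF q] t_def x_def)
    ultimately show ?thesis
      unfolding component3_48_codifferential[OF q] by (simp add: power2_sum)
  qed
  have "form_norm2 A g \<Phi> q (component3_48 A g \<Phi> q (codifferential A g \<Phi> \<Phi> q)) =
      (\<Sum>js\<leftarrow>ksubs 3 [0..<8]. (delta x js)\<^sup>2 + 2 * (delta x js * (\<Sum>n<8. phi (n # js) * t n)) +
        (\<Sum>n<8. phi (n # js) * t n)\<^sup>2)"
    unfolding form_norm2_frame[OF alt] f_def[symmetric] using val by (simp cong: map_cong)
  also have "\<dots> = (\<Sum>js\<leftarrow>ksubs 3 [0..<8]. (delta x js)\<^sup>2) +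
      2 * (\<Sum>js\<leftarrow>ksubs 3 [0..<8]. delta x js * (\<Sum>n<8. phi (n # js) * t n)) +
      (\<Sum>js\<leftarrow>ksubs 3 [0..<8]. (\<Sum>n<8. phi (n # js) * t n)\<^sup>2)"
    by (simp only: sum_list_addf sum_list_const_mult)
  \<comment> \<open>With t = 16/7 T the coefficient of |T|^2 is 48 - 32 * 16/7 + 7 * 256/49 =
    80/7.\<close>
  also have "\<dots> = 48 * (\<Sum>l<8. (trace8 x l)\<^sup>2) + 16 * (\<Sum>i<8. \<Sum>j<8. \<Sum>m<8. x i j m * x j i m) +
      2 * (- 16 * (\<Sum>l<8. trace8 x l * t l)) + 7 * (\<Sum>l<8. (t l)\<^sup>2)"
    by (simp only: delta_norm2[OF eig] delta_inner[OF eig] phi_norm2)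
  also have "(\<Sum>l<8. trace8 x l * t l) = 16 / 7 * (\<Sum>l<8. (trace8 x l)\<^sup>2)"
    unfolding sum_distrib_left t_def by (rule sum.cong) (simp_all add: power2_eq_square)
  also have "(\<Sum>l<8. (t l)\<^sup>2) = 256 / 49 * (\<Sum>l<8. (trace8 x l)\<^sup>2)"
    unfolding sum_distrib_left t_def by (rule sum.cong) (simp_all add: power2_eq_square)
  finally show ?thesis by simp
qed

end

section \<open>Scalar curvatures\<close>

lemma skew8_lincomb: "skew8 a \<Longrightarrow> skew8 b \<Longrightarrow> skew8 (\<lambda>k l. s * a k l + t * b k l)"
proof -
  assume a: "skew8 a" and b: "skew8 b"
  show "skew8 (\<lambda>k l. s * a k l + t * b k l)"
    unfolding skew8_def
  proof (intro allI impI)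
    fix i j :: nat assume ij: "i < 8" "j < 8"
    show "s * a i j + t * b i j = - (s * a j i + t * b j i)"
      unfolding skew8D[OF a ij] skew8D[OF b ij] by simp
  qed
qed

lemma contract_lincomb:
  "contract (\<lambda>k l. s * a k l + t * b k l) i j = s * contract a i j + t * contract b i j"
  unfolding contract_def by (simp add: sum_distrib_left sum.distrib algebra_simps)

lemma eigen2_lincomb: "eigen2 c a \<Longrightarrow> eigen2 c b \<Longrightarrow> eigen2 c (\<lambda>k l. s * a k l + t * b k l)"
  unfolding eigen2_def by (simp add: skew8_lincomb contract_lincomb algebra_simps)

lemma eigen2_sum:
  assumes "finite J" "\<And>j. j \<in> J \<Longrightarrow> eigen2 c (a j)"
  shows "eigen2 c (\<lambda>k l. \<Sum>j\<in>J. s j * a j k l)"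
  using assms
proof (induction J rule: finite_induct)
  case empty
  then show ?case by (simp add: eigen2_def skew8_def contract_def)
next
  case (insert j J)
  then show ?case
    using eigen2_lincomb[of c "a j" "\<lambda>k l. \<Sum>j\<in>J. s j * a j k l" "s j" 1] by simp
qed

lemma sum_rotate3:
  "(\<Sum>i<n. \<Sum>j<n. \<Sum>m<n. F i j m) = (\<Sum>i<n. \<Sum>j<n. \<Sum>m<n. F j m (i::nat) :: real)"
proof -
  have "(\<Sum>i<n. \<Sum>j<n. \<Sum>m<n. F j m i) = (\<Sum>j<n. \<Sum>i<n. \<Sum>m<n. F j m i)" by (rule sum.swap)
  also have "\<dots> = (\<Sum>j<n. \<Sum>m<n. \<Sum>i<n. F j m i)" by (rule sum.cong[OF refl], rule sum.swap)
  finally show ?thesis by simp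
qed

lemma sum_swap23:
  "(\<Sum>i<n. \<Sum>j<n. \<Sum>m<n. F i j m) = (\<Sum>i<n. \<Sum>j<n. \<Sum>m<n. F i m (j::nat) :: real)"
  by (rule sum.cong[OF refl], rule sum.swap)

text \<open>Here \<open>G\<close> and \<open>G - x\<close> are the connection coefficients of \<open>nabS\<close> and \<open>nab\<close> in an adapted frame,
  \<open>dG\<close> and \<open>dx\<close> are derivatives along the frame (the first index is the direction), and \<open>c\<close> are the
  structure functions of the frame.  The \<open>-2\<close>-eigenspace contains the curvature of \<open>nabS\<close> and
  the commutators of \<open>x\<close>, the \<open>6\<close>-eigenspace contains the covariant derivative of \<open>x\<close>, so the
  contracted Bianchi identity expresses the scalar curvature of \<open>nabS\<close> through \<open>x\<close>.\<close>

lemma scalar_curvature_algebra: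
  fixes G x :: "nat \<Rightarrow> nat \<Rightarrow> nat \<Rightarrow> real" and dG dx :: "nat \<Rightarrow> nat \<Rightarrow> nat \<Rightarrow> nat \<Rightarrow> real"
  assumes G: "\<And>i. i < 8 \<Longrightarrow> skew8 (G i)"
    and stab: "\<And>m i j k l. m < 8 \<Longrightarrow> i < 8 \<Longrightarrow> j < 8 \<Longrightarrow> k < 8 \<Longrightarrow> l < 8 \<Longrightarrow> act (G m) [i, j, k, l] = 0"
    and x: "\<And>i. i < 8 \<Longrightarrow> eigen2 6 (x i)"
    and dG: "\<And>i j. i < 8 \<Longrightarrow> j < 8 \<Longrightarrow> eigen2 (-2) (dG i j)"
    and dx: "\<And>i j. i < 8 \<Longrightarrow> j < 8 \<Longrightarrow> eigen2 6 (dx i j)"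
    and c: "\<And>i j m. c i j m = (G i j m - x i j m) - (G j i m - x j i m)"
    and RS: "\<And>i j k l. RS i j k l = dG i j k l - dG j i k l + commutator (G i) (G j) k l - (\<Sum>m<8. c i j m * G m k l)"
    and R: "\<And>i j k l. R i j k l = (dG i j k l - dx i j k l) - (dG j i k l - dx j i k l) +
      commutator (\<lambda>k l. G i k l - x i k l) (\<lambda>k l. G j k l - x j k l) k l - (\<Sum>m<8. c i j m * (G m k l - x m k l))"
    and bianchi: "(\<Sum>i<8. \<Sum>j<8. contract (R i j) i j) = 0"
  defines "d \<equiv> (\<Sum>i<8. \<Sum>j<8. dx i j j i) - (\<Sum>i<8. \<Sum>m<8. trace8 x m * (G i i m - x i i m))"
    and "T2 \<equiv> (\<Sum>l<8. (trace8 x l)\<^sup>2)" and "C \<equiv> (\<Sum>i<8. \<Sum>j<8. \<Sum>m<8. x i j m * x j i m)"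
  shows "(\<Sum>i<8. \<Sum>j<8. R i j j i) = - 8 * d + 8 * T2 - 8 * C"
    and "(\<Sum>i<8. \<Sum>j<8. RS i j j i) - (\<Sum>i<8. \<Sum>j<8. R i j j i) = 2 * d - T2 + C"
proof -
  \<comment> \<open>\<open>E i j\<close> is the \<open>nabS\<close>-derivative along e_i of the
    endomorphism \<xi>_j, \<open>K i j\<close> is [\<xi>_i, \<xi>_j], and \<open>Y i j\<close> is
    \<xi> in the direction [e_i, e_j]. So \<open>E i j - E j i - Y i j\<close> is the covariant
    exterior derivative of \<xi>.\<close>
  define E where "E i j k l = 1 * dx i j k l + 1 * commutator (G i) (x j) k l" for i j k l
  define K where "K i j = commutator (x i) (x j)" for i j
  define Y where "Y i j k l = (\<Sum>m<8. c i j m * x m k l)" for i j k l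
  have xs: "skew8 (x i)" if "i < 8" for i using x[OF that] unfolding eigen2_def by blast
  have G2: "eigen2 (-2) (G i)" if "i < 8" for i by (rule stabilizer_eigen2[OF G[OF that] stab[OF that]])
  have E: "eigen2 6 (E i j)" if "i < 8" "j < 8" for i j
    unfolding E_def
    by (rule eigen2_lincomb[OF dx[OF that] commutator_eigen2_stabilizer[OF G[OF that(1)] stab[OF that(1)] x[OF that(2)]]])
  have K: "eigen2 (-2) (K i j)" if "i < 8" "j < 8" for i j
    unfolding K_def by (rule commutator_eigen2_6[OF x[OF that(1)] x[OF that(2)]])
  have Y: "eigen2 6 (Y i j)" for i j
    unfolding Y_def by (rule eigen2_sum) (use x in auto)
  have RS2: "eigen2 (-2) (RS i j)" if "i < 8" "j < 8" for i j
  proof -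
    have "eigen2 (-2) (\<lambda>k l. 1 * (1 * (1 * dG i j k l + (-1) * dG j i k l) + 1 * commutator (G i) (G j) k l) +
        (-1) * (\<Sum>m<8. c i j m * G m k l))"
      by (rule eigen2_lincomb[OF eigen2_lincomb[OF eigen2_lincomb[OF dG[OF that] dG[OF that(2,1)]]
            commutator_eigen2_stabilizer[OF G[OF that(1)] stab[OF that(1)] G2[OF that(2)]]] eigen2_sum])
        (use G2 in auto)
    moreover have "RS i j = (\<lambda>k l. 1 * (1 * (1 * dG i j k l + (-1) * dG j i k l) + 1 * commutator (G i) (G j) k l) +
        (-1) * (\<Sum>m<8. c i j m * G m k l))" by (simp add: fun_eq_iff RS)
    ultimately show ?thesis by simp
  qed
  have comm: "commutator (\<lambda>k l. G i k l - x i k l) (\<lambda>k l. G j k l - x j k l) k l =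
      commutator (G i) (G j) k l - commutator (G i) (x j) k l + commutator (G j) (x i) k l + K i j k l" for i j k l
    unfolding commutator_def K_def sum.distrib[symmetric] sum_subtractf[symmetric]
    by (rule sum.cong[OF refl]) (simp add: algebra_simps)
  \<comment> \<open>The curvature of a changed connection: minus the covariant exterior derivative
    of \<xi>, plus the quadratic term.\<close>
  have decomp: "R i j k l = RS i j k l - (E i j k l - E j i k l) + K i j k l + Y i j k l" for i j k l
    unfolding R RS comm E_def Y_def by (simp add: right_diff_distrib sum_subtractf)
  \<comment> \<open>For entries skew in the last two indices this contraction is minus the one that
    defines scalar curvature.\<close>
  define r where "r F = (\<Sum>i<8. \<Sum>j<8. F i j i j)" for F :: "nat \<Rightarrow> nat \<Rightarrow> nat \<Rightarrow> nat \<Rightarrow> real"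
  define e where "e = (\<Sum>i<8. \<Sum>j<8. E i j i j - E j i i j)"
  have r1: "r R = r RS - e + r K + r Y"
    unfolding r_def e_def by (simp add: decomp sum.distrib sum_subtractf)
  have con: "contract (R i j) i j = -2 * RS i j i j - 6 * (E i j i j - E j i i j) - 2 * K i j i j + 6 * Y i j i j"
    if ij: "i < 8" "j < 8" for i j
  proof -
    have "R i j = (\<lambda>k l. 1 * (1 * (1 * RS i j k l + (-1) * (1 * E i j k l + (-1) * E j i k l)) + 1 * K i j k l) + 1 * Y i j k l)"
      by (simp add: decomp fun_eq_iff)
    then have "contract (R i j) i j = contract (RS i j) i j - (contract (E i j) i j - contract (E j i) i j) +
        contract (K i j) i j + contract (Y i j) i j"
      by (simp only: contract_lincomb) simp
    then show ?thesis
      using RS2[OF ij] E[OF ij] E[OF ij(2,1)] K[OF ij] Y[of i j] ij unfolding eigen2_def by simp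
  qed
  \<comment> \<open>The contracted Bianchi identity, with weight -2 for terms in spin(7) and 6 for
    terms in \<Lambda>2_7: the second linear equation besides \<open>r1\<close>.\<close>
  have r2: "-2 * r RS - 6 * e - 2 * r K + 6 * r Y = 0"
  proof -
    have "(\<Sum>i<8. \<Sum>j<8. contract (R i j) i j) =
        (\<Sum>i<8. \<Sum>j<8. -2 * RS i j i j - 6 * (E i j i j - E j i i j) - 2 * K i j i j + 6 * Y i j i j)"
      by (intro sum.cong refl con) auto
    also have "\<dots> = -2 * r RS - 6 * e - 2 * r K + 6 * r Y"
      unfolding r_def e_def by (simp add: sum_distrib_left sum.distrib sum_subtractf sum_negf)
    finally show ?thesis using bianchi by simp
  qed
  have C': "(\<Sum>i<8. \<Sum>j<8. \<Sum>m<8. x i j m * x m i j) = - C"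
  proof -
    have "(\<Sum>i<8. \<Sum>j<8. \<Sum>m<8. x i j m * x m i j) = (\<Sum>i<8. \<Sum>m<8. \<Sum>j<8. x i j m * x m i j)"
      by (rule sum.cong[OF refl], rule sum.swap)
    also have "\<dots> = (\<Sum>i<8. \<Sum>m<8. \<Sum>j<8. - (x i m j * x m i j))"
    proof (intro sum.cong refl)
      fix i m j :: nat assume "i \<in> {..<8}" "m \<in> {..<8}" "j \<in> {..<8}"
      then have "x i j m = - x i m j" by (intro skew8D[OF xs]) auto
      then show "x i j m * x m i j = - (x i m j * x m i j)" by simp
    qed
    finally show ?thesis by (simp add: C_def sum_negf)
  qed
  have T2: "T2 = (\<Sum>i<8. \<Sum>j<8. \<Sum>m<8. x i i m * x j j m)"
  proof -
    have "T2 = (\<Sum>l<8. \<Sum>i<8. \<Sum>j<8. x i i l * x j j l)"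
      by (simp add: T2_def trace8_def power2_eq_square sum_product)
    then show ?thesis using sum_rotate3[of "\<lambda>i j m. x i i m * x j j m" 8] by simp
  qed
  have rK: "r K = T2 - C"
  proof -
    have "r K = (\<Sum>i<8. \<Sum>j<8. \<Sum>m<8. x i i m * x j j m - x i j m * x j i m)"
      unfolding r_def K_def commutator_def
    proof (intro sum.cong refl)
      fix i j m :: nat assume ijm: "i \<in> {..<8}" "j \<in> {..<8}" "m \<in> {..<8}"
      have "x i m j = - x i j m" "x j m j = - x j j m" by (rule skew8D[OF xs]; use ijm in simp)+
      then show "x j i m * x i m j - x i i m * x j m j = x i i m * x j j m - x i j m * x j i m" by simp
    qed
    then show ?thesis by (simp add: T2 C_def sum_subtractf)
  qed
  have GT: "(\<Sum>i<8. \<Sum>j<8. \<Sum>m<8. G i i m * x j j m) = (\<Sum>i<8. \<Sum>m<8. trace8 x m * G i i m)"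
    by (rule sum.cong[OF refl], subst sum.swap) (simp add: trace8_def sum_distrib_left mult.commute)
  have xT: "(\<Sum>i<8. \<Sum>m<8. trace8 x m * x i i m) = T2"
    by (subst sum.swap) (simp add: T2_def power2_eq_square trace8_def sum_distrib_left)
  \<comment> \<open>Apart from the products that belong to \<open>d\<close>, the only surviving
    product of connection coefficients with \<xi>. It enters \<open>e\<close> and \<open>r Y\<close>
    with the same coefficient 2, so \<open>e - r Y\<close> is free of it.\<close>
  define Q where "Q = (\<Sum>i<8. \<Sum>j<8. \<Sum>m<8. G i j m * x m i j)"
  have e: "e = -2 * (\<Sum>i<8. \<Sum>j<8. dx i j j i) + 2 * (\<Sum>i<8. \<Sum>m<8. trace8 x m * G i i m) + 2 * Q"
  proof -
    have "(\<Sum>i<8. \<Sum>j<8. E j i i j) = (\<Sum>i<8. \<Sum>j<8. E i j j i)" by (rule sum.swap)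
    also have "\<dots> = (\<Sum>i<8. \<Sum>j<8. - E i j i j)"
    proof (intro sum.cong refl)
      fix i j :: nat assume ij: "i \<in> {..<8}" "j \<in> {..<8}"
      have "skew8 (E i j)" using E[of i j] ij unfolding eigen2_def by auto
      then show "E i j j i = - E i j i j" using skew8D[of "E i j" j i] ij by auto
    qed
    finally have "e = 2 * (\<Sum>i<8. \<Sum>j<8. E i j i j)"
      unfolding e_def by (simp add: sum_subtractf sum_negf)
    also have "(\<Sum>i<8. \<Sum>j<8. E i j i j) =
        (\<Sum>i<8. \<Sum>j<8. - dx i j j i + (\<Sum>m<8. x j i m * G i m j + G i i m * x j j m))"
    proof (intro sum.cong refl)
      fix i j :: nat assume ij: "i \<in> {..<8}" "j \<in> {..<8}"
      have "skew8 (dx i j)" using dx[of i j] ij unfolding eigen2_def by auto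
      then have "dx i j i j = - dx i j j i" using skew8D[of "dx i j" i j] ij by auto
      moreover have "commutator (G i) (x j) i j = (\<Sum>m<8. x j i m * G i m j + G i i m * x j j m)"
        unfolding commutator_def
      proof (rule sum.cong[OF refl])
        fix m :: nat assume "m \<in> {..<8}"
        then have "x j m j = - x j j m" using ij by (intro skew8D[OF xs]) auto
        then show "x j i m * G i m j - G i i m * x j m j = x j i m * G i m j + G i i m * x j j m" by simp
      qed
      ultimately show "E i j i j = - dx i j j i + (\<Sum>m<8. x j i m * G i m j + G i i m * x j j m)"
        by (simp add: E_def)
    qed
    also have "\<dots> = - (\<Sum>i<8. \<Sum>j<8. dx i j j i) + (\<Sum>i<8. \<Sum>j<8. \<Sum>m<8. x j i m * G i m j) +
        (\<Sum>i<8. \<Sum>j<8. \<Sum>m<8. G i i m * x j j m)"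
      by (simp add: sum.distrib sum_subtractf)
    also have "(\<Sum>i<8. \<Sum>j<8. \<Sum>m<8. x j i m * G i m j) = Q"
      unfolding Q_def by (subst sum_swap23) (simp add: mult.commute)
    finally show ?thesis unfolding GT by simp
  qed
  have rY: "r Y = 2 * Q + 2 * C"
  proof -
    have 1: "(\<Sum>i<8. \<Sum>j<8. \<Sum>m<8. (G j i m - x j i m) * x m i j) = - (\<Sum>i<8. \<Sum>j<8. \<Sum>m<8. (G i j m - x i j m) * x m i j)"
    proof -
      have "(\<Sum>i<8. \<Sum>j<8. \<Sum>m<8. (G j i m - x j i m) * x m i j) =
          (\<Sum>i<8. \<Sum>j<8. \<Sum>m<8. (G i j m - x i j m) * x m j i)" by (rule sum.swap)
      also have "\<dots> = (\<Sum>i<8. \<Sum>j<8. \<Sum>m<8. - ((G i j m - x i j m) * x m i j))"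
      proof (intro sum.cong refl)
        fix i j m :: nat assume "i \<in> {..<8}" "j \<in> {..<8}" "m \<in> {..<8}"
        then have "x m j i = - x m i j" using skew8D[OF xs, of m j i] by auto
        then show "(G i j m - x i j m) * x m j i = - ((G i j m - x i j m) * x m i j)" by simp
      qed
      finally show ?thesis by (simp add: sum_negf)
    qed
    have "r Y = (\<Sum>i<8. \<Sum>j<8. \<Sum>m<8. (G i j m - x i j m) * x m i j) - (\<Sum>i<8. \<Sum>j<8. \<Sum>m<8. (G j i m - x j i m) * x m i j)"
      unfolding r_def Y_def c by (simp add: left_diff_distrib sum_subtractf)
    also have "\<dots> = 2 * (\<Sum>i<8. \<Sum>j<8. \<Sum>m<8. (G i j m - x i j m) * x m i j)" unfolding 1 by simp
    also have "(\<Sum>i<8. \<Sum>j<8. \<Sum>m<8. (G i j m - x i j m) * x m i j) = Q + C"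
      using C' by (simp add: Q_def left_diff_distrib sum_subtractf)
    finally show ?thesis by simp
  qed
  have d: "d = (\<Sum>i<8. \<Sum>j<8. dx i j j i) - (\<Sum>i<8. \<Sum>m<8. trace8 x m * G i i m) + T2"
    unfolding d_def using xT by (simp add: right_diff_distrib sum_subtractf)
  have scal: "(\<Sum>i<8. \<Sum>j<8. F i j j i) = - r F" if "\<And>i j. i < 8 \<Longrightarrow> j < 8 \<Longrightarrow> skew8 (F i j)" for F
    unfolding r_def sum_negf[symmetric]
  proof (intro sum.cong refl)
    fix i j :: nat assume "i \<in> {..<8}" "j \<in> {..<8}"
    then show "F i j j i = - F i j i j" using skew8D[OF that[of i j], of j i] by auto
  qed
  have sR: "(\<Sum>i<8. \<Sum>j<8. R i j j i) = - r R"
  proof (rule scal)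
    fix i j :: nat assume ij: "i < 8" "j < 8"
    have "skew8 (\<lambda>k l. 1 * (1 * (1 * RS i j k l + (-1) * (1 * E i j k l + (-1) * E j i k l)) + 1 * K i j k l) + 1 * Y i j k l)"
      by (intro skew8_lincomb) (use RS2[OF ij] E[OF ij] E[OF ij(2,1)] K[OF ij] Y[of i j] in \<open>auto simp: eigen2_def\<close>)
    moreover have "R i j = (\<lambda>k l. 1 * (1 * (1 * RS i j k l + (-1) * (1 * E i j k l + (-1) * E j i k l)) + 1 * K i j k l) + 1 * Y i j k l)"
      by (simp add: decomp fun_eq_iff)
    ultimately show "skew8 (R i j)" by simp
  qed
  have sRS: "(\<Sum>i<8. \<Sum>j<8. RS i j j i) = - r RS"
    by (rule scal) (use RS2 in \<open>auto simp: eigen2_def\<close>)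
  \<comment> \<open>Elimination from \<open>r1\<close> and \<open>r2\<close> gives
    \<open>r R = 4 * (r Y - e)\<close> and \<open>r RS = 3 * (r Y - e) - r K\<close>, where
    \<open>r Y - e\<close> equals \<open>2 * d - 2 * T2 + 2 * C\<close>.\<close>
  show "(\<Sum>i<8. \<Sum>j<8. R i j j i) = - 8 * d + 8 * T2 - 8 * C"
    using sR r1 r2 rK e rY d by linarith
  show "(\<Sum>i<8. \<Sum>j<8. RS i j j i) - (\<Sum>i<8. \<Sum>j<8. R i j j i) = 2 * d - T2 + C"
    using sR sRS r1 r2 rK e rY d by linarith
qed

section \<open>Connection coefficients and curvature in an adapted frame\<close>

lemma metric_smooth:
  "riemannian_metric A g \<Longrightarrow> smooth_vf A W X \<Longrightarrow> smooth_vf A W Y \<Longrightarrow> smooth_fun A W (\<lambda>q. g q (X q) (Y q))"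
  unfolding riemannian_metric_def by blast

lemma metric_parseval:
  assumes e: "orthonormal_frame A g q e" and m: "riemannian_metric A g" and q: "q \<in> points A"
    and u: "u \<in> tangent_space A q" and v: "v \<in> tangent_space A q"
  shows "g q u v = (\<Sum>m<8. g q u (e m) * g q v (e m))"
proof -
  note eT = orthonormal_frameD(1)[OF e]
  have "g q u v = (\<Sum>m<8. g q u (e m) * g q (e m) v)"
    by (subst frame_expansion[OF e m q u], rule metric_sum[OF m q]) (use eT v in auto)
  also have "\<dots> = (\<Sum>m<8. g q u (e m) * g q v (e m))"
    by (rule sum.cong[OF refl]) (use riemannian_metricD(2)[OF m q _ v v] eT in simp)
  finally show ?thesis .
qed

text \<open>The equations of an eigenspace are linear with constant coefficients, since \<Phi> has
  constant components in an adapted frame; hence they can be differentiated.\<close>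

lemma eigen2_derivative:
  assumes atlas: "smooth_atlas A" and u: "u \<in> tangent_space A p" and W: "p \<in> W" "open W" "W \<subseteq> points A"
    and sm: "\<And>k l. k < 8 \<Longrightarrow> l < 8 \<Longrightarrow> smooth_fun A W (\<lambda>q. F q k l)"
    and eig: "\<And>q. q \<in> W \<Longrightarrow> eigen2 c (F q)"
  shows "eigen2 c (\<lambda>k l. u (\<lambda>q. F q k l))"
proof -
  have scale: "u (\<lambda>q. a * f q) = a * u f" if "smooth_fun A W f" for a f
    using tangentD(3)[OF u smooth_atI[OF that W(1)]] .
  have scale_smooth: "smooth_fun A W (\<lambda>q. a * f q)" if "smooth_fun A W f" for a f
    using smooth_fun_lincomb[OF atlas that that, of a 0] by simp
  have "u (\<lambda>q. F q i j) = - u (\<lambda>q. F q j i)" if ij: "i < 8" "j < 8" for i j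
  proof -
    have "u (\<lambda>q. F q i j) = u (\<lambda>q. (-1) * F q j i)"
    proof (rule tangent_local[OF u W(1) sm[OF ij] scale_smooth[OF sm[OF ij(2,1)]]])
      fix q assume "q \<in> W"
      then have "skew8 (F q)" using eig unfolding eigen2_def by blast
      then show "F q i j = - 1 * F q j i" using skew8D[of "F q" i j] ij by simp
    qed
    then show ?thesis using scale[OF sm[OF ij(2,1)], of "-1"] by simp
  qed
  moreover have "contract (\<lambda>k l. u (\<lambda>q. F q k l)) i j = c * u (\<lambda>q. F q i j)" if ij: "i < 8" "j < 8" for i j
  proof -
    have s1: "smooth_fun A W (\<lambda>q. phi [i, j, k, l] * F q k l)" if "k \<in> {..<8}" "l \<in> {..<8}" for k l
      using scale_smooth[OF sm] that by simp
    have s2: "smooth_fun A W (\<lambda>q. \<Sum>l<8. phi [i, j, k, l] * F q k l)" if "k \<in> {..<8}" for k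
      using s1 that by (intro smooth_fun_sum[OF atlas W(2,3)]) auto
    have s3: "smooth_fun A W (\<lambda>q. \<Sum>k<8. \<Sum>l<8. phi [i, j, k, l] * F q k l)"
      by (rule smooth_fun_sum[OF atlas W(2,3)]) (use s2 in auto)
    have "contract (\<lambda>k l. u (\<lambda>q. F q k l)) i j = (\<Sum>k<8. \<Sum>l<8. u (\<lambda>q. phi [i, j, k, l] * F q k l))"
      unfolding contract_def by (intro sum.cong refl) (use scale[OF sm] in simp)
    also have "\<dots> = (\<Sum>k<8. u (\<lambda>q. \<Sum>l<8. phi [i, j, k, l] * F q k l))"
      by (rule sum.cong[OF refl], rule tangent_apply_sum[OF atlas u W(1) _ W(2,3), symmetric]) (use s1 in auto)
    also have "\<dots> = u (\<lambda>q. \<Sum>k<8. \<Sum>l<8. phi [i, j, k, l] * F q k l)"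
      by (rule tangent_apply_sum[OF atlas u W(1) _ W(2,3), symmetric]) (use s2 in auto)
    also have "\<dots> = u (\<lambda>q. c * F q i j)"
    proof (rule tangent_local[OF u W(1) s3 scale_smooth[OF sm[OF ij]]])
      fix q assume "q \<in> W"
      then show "(\<Sum>k<8. \<Sum>l<8. phi [i, j, k, l] * F q k l) = c * F q i j"
        using eig ij unfolding eigen2_def contract_def by blast
    qed
    finally show ?thesis using scale[OF sm[OF ij]] by simp
  qed
  ultimately show ?thesis unfolding eigen2_def skew8_def by blast
qed

context spin7_geometry
begin

definition coef :: "'m connection \<Rightarrow> (nat \<Rightarrow> 'm vfield) \<Rightarrow> 'm \<Rightarrow> nat \<Rightarrow> nat \<Rightarrow> nat \<Rightarrow> real" where
  "coef N e q i j k = g q (N q (e i q) (e j)) (e k q)"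

lemma connection_field:
  assumes "metric_connection A g N" "adapted_frame_on A g \<Phi> W e" "i < 8" "j < 8"
  shows "smooth_vf A W (\<lambda>q. N q (e i q) (e j))"
proof -
  have "affine_connection A N" using assms(1) unfolding metric_connection_def by blast
  then show ?thesis
    by (rule affine_smooth[OF _ adapted_frame_onD(1)[OF assms(2,3)] adapted_frame_onD(1)[OF assms(2,4)]])
qed

lemma coef_smooth:
  assumes "metric_connection A g N" "adapted_frame_on A g \<Phi> W e" "i < 8" "j < 8" "k < 8"
  shows "smooth_fun A W (\<lambda>q. coef N e q i j k)"
  unfolding coef_def
  by (rule metric_smooth[OF metric connection_field[OF assms(1-4)] adapted_frame_onD(1)[OF assms(2,5)]])

lemma coef_skew:
  assumes N: "metric_connection A g N" and ad: "adapted_frame_on A g \<Phi> W e" and q: "q \<in> W" and i: "i < 8"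
  shows "skew8 (coef N e q i)"
  unfolding skew8_def
proof (intro allI impI)
  fix j k :: nat assume jk: "j < 8" "k < 8"
  note sm = adapted_frame_onD(1)[OF ad] and W = adapted_frame_onD(2,3)[OF ad]
  note frame = adapted_frame_onD(4)[OF ad]
  have qp: "q \<in> points A" using W q by blast
  note eT = orthonormal_frameD(1)[OF frame[OF q]]
  have NT: "N q (e i q) (e j) \<in> tangent_space A q" "N q (e i q) (e k) \<in> tangent_space A q"
    using smooth_vfD(3)[OF connection_field[OF N ad i] q] jk by auto
  have "e i q (\<lambda>r. g r (e j r) (e k r)) = g q (N q (e i q) (e j)) (e k q) + g q (e j q) (N q (e i q) (e k))"
    by (rule metric_compatible[OF N q eT[OF i] sm[OF jk(1)] sm[OF jk(2)]])
  moreover have "e i q (\<lambda>r. g r (e j r) (e k r)) = e i q (\<lambda>r. if j = k then 1 else 0)"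
    by (rule tangent_local[OF eT[OF i] q metric_smooth[OF metric sm[OF jk(1)] sm[OF jk(2)]] smooth_fun_const[OF W]])
      (use orthonormal_frameD(3)[OF frame jk] in simp)
  moreover have "e i q (\<lambda>r. if j = k then 1 else 0) = 0"
    by (rule tangent_apply_const[OF eT[OF i] qp open_points[OF atlas]])
  moreover have "g q (e j q) (N q (e i q) (e k)) = g q (N q (e i q) (e k)) (e j q)"
    by (rule riemannian_metricD(2)[OF metric qp eT[OF jk(1)] NT(2) eT[OF jk(1)]])
  ultimately show "coef N e q i j k = - coef N e q i k j" by (simp add: coef_def)
qed

lemma lie_bracket_frame:
  assumes ad: "adapted_frame_on A g \<Phi> W e" and q: "q \<in> W" and ij: "i < 8" "j < 8"
  shows "lie_bracket A (e i) (e j) q \<in> tangent_space A q"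
    and "m < 8 \<Longrightarrow> g q (lie_bracket A (e i) (e j) q) (e m q) = coef nab e q i j m - coef nab e q j i m"
proof -
  note sm = adapted_frame_onD(1)[OF ad] and W = adapted_frame_onD(2,3)[OF ad]
  have qp: "q \<in> points A" using W q by blast
  note eT = orthonormal_frameD(1)[OF adapted_frame_onD(4)[OF ad q]]
  note NT = smooth_vfD(3)[OF connection_field[OF metric_connections(1) ad] q]
  have L: "lie_bracket A (e i) (e j) q = (\<lambda>f. 1 * nab q (e i q) (e j) f + (-1) * nab q (e j q) (e i) f)"
    using torsion_free[OF q sm[OF ij(1)] sm[OF ij(2)]] by simp
  show "lie_bracket A (e i) (e j) q \<in> tangent_space A q"
    unfolding L by (rule tangent_lincomb[OF NT[OF ij] NT[OF ij(2,1)]])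
  show "g q (lie_bracket A (e i) (e j) q) (e m q) = coef nab e q i j m - coef nab e q j i m" if m: "m < 8"
    unfolding L coef_def
    using riemannian_metricD(1)[OF metric qp NT[OF ij] NT[OF ij(2,1)] eT[OF m], of 1 "-1"] by simp
qed

text \<open>Metric compatibility trades the second derivative for the derivative of a coefficient
  minus a product of first derivatives. For either connection the bracket is expanded with the
  coefficients of \<open>nab\<close>, the torsion-free one.\<close>

lemma curvature_terms:
  assumes N: "metric_connection A g N" and ad: "adapted_frame_on A g \<Phi> W e" and q: "q \<in> W"
    and ijkl: "i < 8" "j < 8" "k < 8" "l < 8"
  shows "g q (N q (e i q) (\<lambda>r. N r (e j r) (e k))) (e l q) =
      e i q (\<lambda>r. coef N e r j k l) - (\<Sum>m<8. coef N e q j k m * coef N e q i l m)"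
    and "g q (N q (lie_bracket A (e i) (e j) q) (e k)) (e l q) =
      (\<Sum>m<8. (coef nab e q i j m - coef nab e q j i m) * coef N e q m k l)"
proof -
  note sm = adapted_frame_onD(1)[OF ad] and W = adapted_frame_onD(2,3)[OF ad]
  note frame = adapted_frame_onD(4)[OF ad q]
  have qp: "q \<in> points A" using W q by blast
  note eT = orthonormal_frameD(1)[OF frame]
  note cf = connection_field[OF N ad]
  have aff: "affine_connection A N" using N unfolding metric_connection_def by blast
  have "e i q (\<lambda>r. g r (N r (e j r) (e k)) (e l r)) =
      g q (N q (e i q) (\<lambda>r. N r (e j r) (e k))) (e l q) + g q (N q (e j q) (e k)) (N q (e i q) (e l))"
    by (rule metric_compatible[OF N q eT[OF ijkl(1)] cf[OF ijkl(2,3)] sm[OF ijkl(4)]])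
  moreover have "g q (N q (e j q) (e k)) (N q (e i q) (e l)) = (\<Sum>m<8. coef N e q j k m * coef N e q i l m)"
    unfolding coef_def
    by (rule metric_parseval[OF frame metric qp smooth_vfD(3)[OF cf[OF ijkl(2,3)] q] smooth_vfD(3)[OF cf[OF ijkl(1,4)] q]])
  ultimately show "g q (N q (e i q) (\<lambda>r. N r (e j r) (e k))) (e l q) =
      e i q (\<lambda>r. coef N e r j k l) - (\<Sum>m<8. coef N e q j k m * coef N e q i l m)"
    by (simp add: coef_def)
  define b where "b m = coef nab e q i j m - coef nab e q j i m" for m
  have "lie_bracket A (e i) (e j) q = (\<lambda>f. \<Sum>m<8. g q (lie_bracket A (e i) (e j) q) (e m q) * e m q f)"
    by (rule frame_expansion[OF frame metric qp lie_bracket_frame(1)[OF ad q ijkl(1,2)]])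
  then have L: "lie_bracket A (e i) (e j) q = (\<lambda>f. \<Sum>m<8. b m * e m q f)"
    using lie_bracket_frame(2)[OF ad q ijkl(1,2)] by (simp add: b_def)
  have "g q (N q (\<lambda>f. \<Sum>m<8. b m * e m q f) (e k)) (e l q) = (\<Sum>m<8. b m * g q (N q (e m q) (e k)) (e l q))"
  proof (rule linear_on_tangent_sum[where L = "\<lambda>u. g q (N q u (e k)) (e l q)" and q = q and A = A])
    fix u v a b assume uv: "u \<in> tangent_space A q" "v \<in> tangent_space A q"
    show "g q (N q (\<lambda>f. a * u f + b * v f) (e k)) (e l q) =
        a * g q (N q u (e k)) (e l q) + b * g q (N q v (e k)) (e l q)"
      unfolding affine_direction[OF aff q uv sm[OF ijkl(3)]]
      by (rule riemannian_metricD(1)[OF metric qp affine_tangent[OF aff q uv(1) sm[OF ijkl(3)]]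
            affine_tangent[OF aff q uv(2) sm[OF ijkl(3)]] eT[OF ijkl(4)]])
  qed (use eT in auto)
  then show "g q (N q (lie_bracket A (e i) (e j) q) (e k)) (e l q) =
      (\<Sum>m<8. (coef nab e q i j m - coef nab e q j i m) * coef N e q m k l)"
    unfolding L by (simp add: b_def coef_def)
qed

lemma curvature_tangent_lincomb:
  assumes N: "metric_connection A g N" and W: "q \<in> W" and XYZ: "smooth_vf A W X" "smooth_vf A W Y" "smooth_vf A W Z"
  shows "N q (X q) (\<lambda>r. N r (Y r) Z) \<in> tangent_space A q" "N q (lie_bracket A X Y q) Z \<in> tangent_space A q"
    "curvature A N X Y Z q = (\<lambda>f. 1 * (1 * N q (X q) (\<lambda>r. N r (Y r) Z) f + (-1) * N q (Y q) (\<lambda>r. N r (X r) Z) f) +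
      (-1) * N q (lie_bracket A X Y q) Z f)"
proof -
  have aff: "affine_connection A N" using N unfolding metric_connection_def by blast
  note XT = smooth_vfD(3)[OF XYZ(1) W] and YT = smooth_vfD(3)[OF XYZ(2) W]
  show "N q (X q) (\<lambda>r. N r (Y r) Z) \<in> tangent_space A q"
    by (rule affine_tangent[OF aff W XT affine_smooth[OF aff XYZ(2,3)]])
  have "lie_bracket A X Y q = (\<lambda>f. 1 * nab q (X q) Y f + (-1) * nab q (Y q) X f)"
    using torsion_free[OF W XYZ(1,2)] by simp
  then have "lie_bracket A X Y q \<in> tangent_space A q"
    using tangent_lincomb[OF affine_tangent[OF affine_connections(1) W XT XYZ(2)]
      affine_tangent[OF affine_connections(1) W YT XYZ(1)], of 1 "-1"] by simp
  then show "N q (lie_bracket A X Y q) Z \<in> tangent_space A q" by (rule affine_tangent[OF aff W _ XYZ(3)])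
  show "curvature A N X Y Z q = (\<lambda>f. 1 * (1 * N q (X q) (\<lambda>r. N r (Y r) Z) f + (-1) * N q (Y q) (\<lambda>r. N r (X r) Z) f) +
      (-1) * N q (lie_bracket A X Y q) Z f)"
    by (simp add: curvature_def)
qed

lemma curvature_tangent:
  assumes N: "metric_connection A g N" and W: "q \<in> W" and XYZ: "smooth_vf A W X" "smooth_vf A W Y" "smooth_vf A W Z"
  shows "curvature A N X Y Z q \<in> tangent_space A q"
  unfolding curvature_tangent_lincomb(3)[OF assms]
  by (rule tangent_lincomb[OF tangent_lincomb[OF curvature_tangent_lincomb(1)[OF assms]
      curvature_tangent_lincomb(1)[OF N W XYZ(2,1,3)]] curvature_tangent_lincomb(2)[OF assms]])

text \<open>The structure equation: skewness of the coefficients turns the products of first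
  derivatives into a commutator.\<close>

lemma curvature_coef:
  assumes N: "metric_connection A g N" and ad: "adapted_frame_on A g \<Phi> W e" and q: "q \<in> W"
    and ijkl: "i < 8" "j < 8" "k < 8" "l < 8"
  shows "g q (curvature A N (e i) (e j) (e k) q) (e l q) =
    e i q (\<lambda>r. coef N e r j k l) - e j q (\<lambda>r. coef N e r i k l) + commutator (coef N e q i) (coef N e q j) k l
      - (\<Sum>m<8. (coef nab e q i j m - coef nab e q j i m) * coef N e q m k l)"
proof -
  note sm = adapted_frame_onD(1)[OF ad] and W = adapted_frame_onD(2,3)[OF ad]
  have qp: "q \<in> points A" using W q by blast
  note eT = orthonormal_frameD(1)[OF adapted_frame_onD(4)[OF ad q]]
  note s = sm[OF ijkl(1)] sm[OF ijkl(2)] sm[OF ijkl(3)]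
  note t = curvature_tangent_lincomb[OF N q s] curvature_tangent_lincomb(1)[OF N q s(2,1,3)]
  have "g q (curvature A N (e i) (e j) (e k) q) (e l q) =
      g q (N q (e i q) (\<lambda>r. N r (e j r) (e k))) (e l q) - g q (N q (e j q) (\<lambda>r. N r (e i r) (e k))) (e l q)
      - g q (N q (lie_bracket A (e i) (e j) q) (e k)) (e l q)"
    unfolding t(3)
    using riemannian_metricD(1)[OF metric qp tangent_lincomb[OF t(1) t(4), of 1 "-1"] t(2) eT[OF ijkl(4)], of 1 "-1"]
      riemannian_metricD(1)[OF metric qp t(1) t(4) eT[OF ijkl(4)], of 1 "-1"] by simp
  also have "\<dots> = e i q (\<lambda>r. coef N e r j k l) - (\<Sum>m<8. coef N e q j k m * coef N e q i l m)
      - (e j q (\<lambda>r. coef N e r i k l) - (\<Sum>m<8. coef N e q i k m * coef N e q j l m))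
      - (\<Sum>m<8. (coef nab e q i j m - coef nab e q j i m) * coef N e q m k l)"
    by (simp only: curvature_terms[OF N ad q ijkl] curvature_terms(1)[OF N ad q ijkl(2,1,3,4)])
  finally have *: "g q (curvature A N (e i) (e j) (e k) q) (e l q) = \<dots>" .
  have sk: "(\<Sum>m<8. coef N e q a k m * coef N e q b l m) = - (\<Sum>m<8. coef N e q a k m * coef N e q b m l)"
    if b: "b < 8" for a b
    unfolding sum_negf[symmetric]
  proof (rule sum.cong[OF refl])
    fix m :: nat assume "m \<in> {..<8}"
    then have "coef N e q b l m = - coef N e q b m l"
      using skew8D[OF coef_skew[OF N ad q b], of l m] ijkl by simp
    then show "coef N e q a k m * coef N e q b l m = - (coef N e q a k m * coef N e q b m l)" by simp
  qed
  show ?thesis unfolding * sk[OF ijkl(1)] sk[OF ijkl(2)] by (simp add: commutator_def sum_subtractf)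
qed

text \<open>In an adapted frame \<Phi> has constant components, so differentiating them gives 0 and
  parallelism leaves the action of the connection matrix on \<open>phi\<close>: it takes values in
  spin(7).\<close>

lemma coef_stabilizer:
  assumes ad: "adapted_frame_on A g \<Phi> W e" and q: "q \<in> W"
    and idx: "m < 8" "i < 8" "j < 8" "k < 8" "l < 8"
  shows "act (coef nabS e q m) [i, j, k, l] = 0"
proof -
  note sm = adapted_frame_onD(1)[OF ad] and W = adapted_frame_onD(2,3)[OF ad]
  note frame = adapted_frame_onD(4)[OF ad q]
  have qp: "q \<in> points A" using W q by blast
  note eT = orthonormal_frameD(1)[OF frame]
  let ?js = "[i, j, k, l]"
  let ?e = "\<lambda>i. e i q"
  have js: "set ?js \<subseteq> {..<8}" using idx by auto
  have sYs: "\<forall>Y\<in>set (map e ?js). smooth_vf A W Y" using sm idx by simp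
  have "parallel_form A nabS \<Phi>" using minimal unfolding minimal_spin7_connection_def by blast
  then have "e m q (\<lambda>r. \<Phi> r (map (\<lambda>Y. Y r) (map e ?js))) =
      (\<Sum>n<length (map e ?js). \<Phi> q ((map (\<lambda>Y. Y q) (map e ?js))[n := nabS q (e m q) (map e ?js ! n)]))"
    using W q eT[OF idx(1)] sYs unfolding parallel_form_def by blast
  also have "\<dots> = (\<Sum>n<length ?js. \<Phi> q ((map ?e ?js)[n := nabS q (e m q) (e (?js ! n))]))"
    by (simp add: eval_nat_numeral)
  also have "\<dots> = (\<Sum>n<length ?js. \<Sum>a<8. coef nabS e q m (?js ! n) a * phi (?js[n := a]))"
  proof (rule sum.cong[OF refl])
    fix n assume n: "n \<in> {..<length ?js}"
    then have jn: "?js ! n < 8" using js nth_mem by blast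
    have sub: "set (take n ?js) \<subseteq> {..<8}" "set (drop (Suc n) ?js) \<subseteq> {..<8}"
      using js set_take_subset set_drop_subset by (meson subset_trans)+
    have "nabS q (e m q) (e (?js ! n)) = (\<lambda>f. \<Sum>a<8. coef nabS e q m (?js ! n) a * e a q f)"
      unfolding coef_def
      by (rule frame_expansion[OF frame metric qp smooth_vfD(3)[OF connection_field[OF metric_connections(2) ad idx(1) jn] q]])
    then have "\<Phi> q ((map ?e ?js)[n := nabS q (e m q) (e (?js ! n))]) =
        \<Phi> q (map ?e (take n ?js) @ (\<lambda>f. \<Sum>a<8. coef nabS e q m (?js ! n) a * e a q f) # map ?e (drop (Suc n) ?js))"
      using n by (simp only: upd_conv_take_nth_drop length_map lessThan_iff take_map drop_map)
    also have "\<dots> = (\<Sum>a<8. coef nabS e q m (?js ! n) a * \<Phi> q (map ?e (take n ?js) @ e a q # map ?e (drop (Suc n) ?js)))"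
      by (rule alt_form_sum[OF Phi_alt_form[OF qp] frame_map_subset[OF frame sub(1)] frame_map_subset[OF frame sub(2)]])
        (use eT in auto)
    also have "\<dots> = (\<Sum>a<8. coef nabS e q m (?js ! n) a * phi (?js[n := a]))"
    proof (rule sum.cong[OF refl])
      fix a :: nat assume "a \<in> {..<8}"
      then have "\<Phi> q (map ?e (take n ?js @ a # drop (Suc n) ?js)) = phi (take n ?js @ a # drop (Suc n) ?js)"
        using sub by (intro Phi_frame[OF ad q]) auto
      then show "coef nabS e q m (?js ! n) a * \<Phi> q (map ?e (take n ?js) @ e a q # map ?e (drop (Suc n) ?js)) =
          coef nabS e q m (?js ! n) a * phi (?js[n := a])"
        using n by (simp only: upd_conv_take_nth_drop lessThan_iff map_append list.map)
    qed
    finally show "\<Phi> q ((map ?e ?js)[n := nabS q (e m q) (e (?js ! n))]) =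
        (\<Sum>a<8. coef nabS e q m (?js ! n) a * phi (?js[n := a]))" .
  qed
  finally have "e m q (\<lambda>r. \<Phi> r (map (\<lambda>Y. Y r) (map e ?js))) = act (coef nabS e q m) ?js"
    unfolding act_def .
  moreover have "e m q (\<lambda>r. \<Phi> r (map (\<lambda>Y. Y r) (map e ?js))) = e m q (\<lambda>r. phi ?js)"
  proof (rule tangent_local[OF eT[OF idx(1)] q Phi_smooth[OF W sYs] smooth_fun_const[OF W]])
    fix r assume "r \<in> W"
    from Phi_frame[OF ad this js] show "\<Phi> r (map (\<lambda>Y. Y r) (map e ?js)) = phi ?js" by simp
  qed
  moreover have "e m q (\<lambda>r. phi ?js) = 0"
    by (rule tangent_apply_const[OF eT[OF idx(1)] qp open_points[OF atlas]])
  ultimately show ?thesis by simp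
qed

lemma coef_difference:
  assumes ad: "adapted_frame_on A g \<Phi> W e" and q: "q \<in> W" and ijk: "i < 8" "j < 8" "k < 8"
  shows "coef nab e q i j k = coef nabS e q i j k - xic q (\<lambda>i. e i q) i j k"
proof -
  note sm = adapted_frame_onD(1)[OF ad] and W = adapted_frame_onD(2,3)[OF ad]
  have qp: "q \<in> points A" using W q by blast
  note eT = orthonormal_frameD(1)[OF adapted_frame_onD(4)[OF ad q]]
  have "xi q (e i q) (e j q) = (\<lambda>f. 1 * nabS q (e i q) (e j) f + (-1) * nab q (e i q) (e j) f)"
    using xi_eq[OF q sm[OF ijk(2)] eT[OF ijk(1)]] by simp
  then show ?thesis
    using riemannian_metricD(1)[OF metric qp smooth_vfD(3)[OF connection_field[OF metric_connections(2) ad ijk(1,2)] q]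
      smooth_vfD(3)[OF connection_field[OF metric_connections(1) ad ijk(1,2)] q] eT[OF ijk(3)], of 1 "-1"]
    by (simp add: xic_def coef_def)
qed

text \<open>\<open>xi\<close> is built from pointwise choices; its components are smooth as
  differences of connection coefficients.\<close>

lemma xic_smooth:
  assumes ad: "adapted_frame_on A g \<Phi> W e" and ijk: "i < 8" "j < 8" "k < 8"
  shows "smooth_fun A W (\<lambda>q. xic q (\<lambda>i. e i q) i j k)"
proof (rule smooth_fun_cong[OF atlas])
  show "smooth_fun A W (\<lambda>q. 1 * coef nabS e q i j k + (-1) * coef nab e q i j k)"
    by (rule smooth_fun_lincomb[OF atlas coef_smooth[OF metric_connections(2) ad ijk]
          coef_smooth[OF metric_connections(1) ad ijk]])
  show "1 * coef nabS e q i j k + (-1) * coef nab e q i j k = xic q (\<lambda>i. e i q) i j k" if "q \<in> W" for q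
    using coef_difference[OF ad that ijk] by simp
qed


section \<open>The first Bianchi identity\<close>

lemma lie_bracket_torsion_free:
  assumes p: "p \<in> W" and XYZ: "smooth_vf A W X" "smooth_vf A W Y" "smooth_vf A W Z" and f: "smooth_at A p f"
  shows "lie_bracket A X (\<lambda>r h. 1 * nab r (Y r) Z h + (-1) * nab r (Z r) Y h) p f =
    X p (\<lambda>q. Y q (\<lambda>r. Z r f)) - X p (\<lambda>q. Z q (\<lambda>r. Y r f)) - Y p (\<lambda>q. Z q (\<lambda>r. X r f)) + Z p (\<lambda>q. Y q (\<lambda>r. X r f))"
proof -
  obtain V where V: "p \<in> V" "smooth_fun A V f" using f unfolding smooth_at_def by blast
  define U where "U = V \<inter> W"
  have U: "p \<in> U" "open U" "U \<subseteq> W"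
    using V(1) p smooth_fun_openD[OF V(2)] smooth_vfD(1)[OF XYZ(1)] unfolding U_def by auto
  have fU: "smooth_fun A U f" by (rule smooth_fun_subset[OF V(2) U(2)]) (simp add: U_def)
  note s = smooth_vfD(4)[OF _ U(3)]
  \<comment> \<open>The bracket of Y and Z is represented by this difference, whose smoothness is
    part of the connection axioms.\<close>
  have D: "(\<lambda>h. 1 * nab q (Y q) Z h + (-1) * nab q (Z q) Y h) = lie_bracket A Y Z q" if "q \<in> W" for q
    using torsion_free[OF that XYZ(2,3)] by simp
  have Xp: "X p \<in> tangent_space A p" by (rule smooth_vfD(3)[OF XYZ(1) p])
  note YZ = s[OF XYZ(2) s[OF XYZ(3) fU]] and ZY = s[OF XYZ(3) s[OF XYZ(2) fU]]
  have eq: "1 * Y q (\<lambda>r. Z r f) + (-1) * Z q (\<lambda>r. Y r f) = 1 * nab q (Y q) Z f + (-1) * nab q (Z q) Y f"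
    if q: "q \<in> U" for q
    using fun_cong[OF D[of q], of f] smooth_atI[OF fU q] q U(3) by (auto simp: lie_bracket_def)
  note l = smooth_fun_lincomb[OF atlas YZ ZY, of 1 "-1"]
  have "X p (\<lambda>q. 1 * Y q (\<lambda>r. Z r f) + (-1) * Z q (\<lambda>r. Y r f)) =
      X p (\<lambda>q. 1 * nab q (Y q) Z f + (-1) * nab q (Z q) Y f)"
    by (rule tangent_local[OF Xp U(1) l smooth_fun_cong[OF atlas eq l] eq])
  moreover have "X p (\<lambda>q. 1 * Y q (\<lambda>r. Z r f) + (-1) * Z q (\<lambda>r. Y r f)) =
      1 * X p (\<lambda>q. Y q (\<lambda>r. Z r f)) + (-1) * X p (\<lambda>q. Z q (\<lambda>r. Y r f))"
    by (rule tangent_apply_lincomb[OF atlas Xp smooth_atI[OF YZ U(1)] smooth_atI[OF ZY U(1)]])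
  moreover have "1 * nab p (Y p) Z (\<lambda>q. X q f) + (-1) * nab p (Z p) Y (\<lambda>q. X q f) =
      Y p (\<lambda>q. Z q (\<lambda>r. X r f)) - Z p (\<lambda>q. Y q (\<lambda>r. X r f))"
    using fun_cong[OF D[OF p], of "\<lambda>q. X q f"] smooth_atI[OF s[OF XYZ(1) fU] U(1)]
    by (simp add: lie_bracket_def)
  ultimately show ?thesis using f by (simp add: lie_bracket_def)
qed

text \<open>Regrouped by the outer derivative, the cyclic sum of curvatures becomes the cyclic sum
  of [X, [Y, Z]], in which the third derivatives cancel.\<close>

lemma curvature_bianchi:
  assumes p: "p \<in> W" and XYZ: "smooth_vf A W X" "smooth_vf A W Y" "smooth_vf A W Z"
  shows "curvature A nab X Y Z p f + curvature A nab Y Z X p f + curvature A nab Z X Y p f = 0"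
proof (cases "smooth_at A p f")
  case False
  \<comment> \<open>Tangent vectors are 0 by convention on functions that are not smooth near
    \<open>p\<close>.\<close>
  note t = tangentD(5)[OF curvature_tangent[OF metric_connections(1) p] False]
  show ?thesis using t[OF XYZ] t[OF XYZ(2,3,1)] t[OF XYZ(3,1,2)] by simp
next
  case True
  note aff = affine_connections(1)
  have J: "nab p (X p) (\<lambda>r. nab r (Y r) Z) f - nab p (X p) (\<lambda>r. nab r (Z r) Y) f - nab p (lie_bracket A Y Z p) X f =
      X p (\<lambda>q. Y q (\<lambda>r. Z r f)) - X p (\<lambda>q. Z q (\<lambda>r. Y r f)) - Y p (\<lambda>q. Z q (\<lambda>r. X r f)) + Z p (\<lambda>q. Y q (\<lambda>r. X r f))"
    if XYZ: "smooth_vf A W X" "smooth_vf A W Y" "smooth_vf A W Z" for X Y Z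
  proof -
    let ?D = "\<lambda>r h. 1 * nab r (Y r) Z h + (-1) * nab r (Z r) Y h"
    note sYZ = affine_smooth[OF aff XYZ(2,3)] and sZY = affine_smooth[OF aff XYZ(3,2)]
    have D: "smooth_vf A W ?D" by (rule smooth_vf_lincomb[OF atlas sYZ sZY])
    have "?D p = lie_bracket A Y Z p" using torsion_free[OF p XYZ(2,3)] by simp
    moreover have "nab p (X p) ?D = (\<lambda>h. 1 * nab p (X p) (\<lambda>r. nab r (Y r) Z) h + (-1) * nab p (X p) (\<lambda>r. nab r (Z r) Y) h)"
      by (rule affine_lincomb[OF aff p smooth_vfD(3)[OF XYZ(1) p] sYZ sZY])
    moreover have "lie_bracket A X ?D p = (\<lambda>f. nab p (X p) ?D f - nab p (?D p) X f)"
      by (rule torsion_free[OF p XYZ(1) D])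
    ultimately have "lie_bracket A X ?D p f = nab p (X p) (\<lambda>r. nab r (Y r) Z) f
        - nab p (X p) (\<lambda>r. nab r (Z r) Y) f - nab p (lie_bracket A Y Z p) X f" by simp
    then show ?thesis using lie_bracket_torsion_free[OF p XYZ True] by simp
  qed
  show ?thesis
    using J[OF XYZ] J[OF XYZ(2,3,1)] J[OF XYZ(3,1,2)] unfolding curvature_def by linarith
qed

lemma metric_zero: "q \<in> points A \<Longrightarrow> w \<in> tangent_space A q \<Longrightarrow> g q (\<lambda>f. 0) w = 0"
  using riemannian_metricD(1)[OF metric _ _ _ , of q w w w 0 0] by simp

text \<open>\<open>phi\<close> is invariant under cyclic rotation of its first three indices, so
  three times the sum pairs \<open>phi\<close> with the Bianchi expression.\<close>

lemma contracted_bianchi: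
  assumes ad: "adapted_frame_on A g \<Phi> W e" and p: "p \<in> W"
    and R: "\<And>i j k l. i < 8 \<Longrightarrow> j < 8 \<Longrightarrow> k < 8 \<Longrightarrow> l < 8 \<Longrightarrow>
      R i j k l = g p (curvature A nab (e i) (e j) (e k) p) (e l p)"
  shows "(\<Sum>i<8. \<Sum>j<8. contract (R i j) i j) = 0"
proof -
  note sm = adapted_frame_onD(1)[OF ad] and W = adapted_frame_onD(2,3)[OF ad]
  have pp: "p \<in> points A" using W p by blast
  note eT = orthonormal_frameD(1)[OF adapted_frame_onD(4)[OF ad p]]
  have B: "R i j k l + R j k i l + R k i j l = 0" if ijkl: "i < 8" "j < 8" "k < 8" "l < 8" for i j k l
  proof -
    note t = curvature_tangent[OF metric_connections(1) p]
    note s = sm[OF ijkl(1)] sm[OF ijkl(2)] sm[OF ijkl(3)]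
    note t1 = t[OF s] and t2 = t[OF s(2,3,1)] and t3 = t[OF s(3,1,2)]
    have "(\<lambda>f. 1 * (1 * curvature A nab (e i) (e j) (e k) p f + 1 * curvature A nab (e j) (e k) (e i) p f) +
        1 * curvature A nab (e k) (e i) (e j) p f) = (\<lambda>f. 0)"
      using curvature_bianchi[OF p s] by simp
    then have "g p (\<lambda>f. 1 * (1 * curvature A nab (e i) (e j) (e k) p f + 1 * curvature A nab (e j) (e k) (e i) p f) +
        1 * curvature A nab (e k) (e i) (e j) p f) (e l p) = 0"
      using metric_zero[OF pp eT[OF ijkl(4)]] by simp
    then show ?thesis
      using riemannian_metricD(1)[OF metric pp tangent_lincomb[OF t1 t2, of 1 1] t3 eT[OF ijkl(4)], of 1 1]
        riemannian_metricD(1)[OF metric pp t1 t2 eT[OF ijkl(4)], of 1 1] R ijkl by simp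
  qed
  define F where "F i j k = (\<Sum>l<8. phi [i, j, k, l] * R i j k l)" for i j k
  have S: "(\<Sum>i<8. \<Sum>j<8. contract (R i j) i j) = (\<Sum>i<8. \<Sum>j<8. \<Sum>k<8. F i j k)"
    by (simp add: contract_def F_def)
  have rot1: "(\<Sum>i<8. \<Sum>j<8. \<Sum>k<8. F i j k) = (\<Sum>i<8. \<Sum>j<8. \<Sum>k<8. F j k i)" by (rule sum_rotate3)
  have rot2: "(\<Sum>i<8. \<Sum>j<8. \<Sum>k<8. F j k i) = (\<Sum>i<8. \<Sum>j<8. \<Sum>k<8. F k i j)"
    by (rule sum_rotate3[of "\<lambda>i j k. F j k i"])
  have "F i j k + F j k i + F k i j = 0" if "i < 8" "j < 8" "k < 8" for i j k
  proof -
    have "F i j k + F j k i + F k i j = (\<Sum>l<8. phi [i, j, k, l] * (R i j k l + R j k i l + R k i j l))"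
      unfolding F_def phi_cycle[of j k i] phi_cycle[of i j k, symmetric]
      by (simp add: phi_cycle[of i j k] phi_cycle[of k i j, symmetric] sum.distrib distrib_left)
    then show ?thesis using B that by simp
  qed
  then have "(\<Sum>i<8. \<Sum>j<8. \<Sum>k<8. F i j k + F j k i + F k i j) = 0" by simp
  then show ?thesis unfolding S using rot1 rot2 by (simp add: sum.distrib)
qed

text \<open>Once the coefficients of \<open>nab\<close> are written as \<open>G - x\<close>, the
  factor after 16/7 is the \<open>d\<close> of \<open>scalar_curvature_algebra\<close>, that is, div
  T.\<close>

lemma divergence_lee_form:
  assumes p: "p \<in> points A"
  defines "e \<equiv> adapted_frame A g \<Phi> p"
  defines "x \<equiv> xic p (\<lambda>i. e i p)"
  shows "divergence A g \<Phi> nab (sharp A g (lee_form A g \<Phi>)) p =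
    16 / 7 * ((\<Sum>i<8. \<Sum>j<8. e i p (\<lambda>q. xic q (\<lambda>i. e i q) j j i)) - (\<Sum>i<8. \<Sum>m<8. trace8 x m * coef nab e p i i m))"
proof -
  obtain W where W: "p \<in> W" "adapted_frame_on A g \<Phi> W e"
    unfolding e_def by (rule adapted_frame_exists[OF p])
  note ad = W(2)
  note sm = adapted_frame_onD(1)[OF ad] and O = adapted_frame_onD(2,3)[OF ad] and frame = adapted_frame_onD(4)[OF ad]
  note eT = orthonormal_frameD(1)[OF frame]
  have Wp: "q \<in> points A" if "q \<in> W" for q using O that by blast
  let ?V = "sharp A g (lee_form A g \<Phi>)"
  have field: "smooth_vf A W (\<lambda>q h. 1 * nabS q (e j q) (e j) h + (-1) * nab q (e j q) (e j) h)" if "j < 8" for j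
    using connection_field[OF metric_connections(1) ad that that] connection_field[OF metric_connections(2) ad that that]
    by (intro smooth_vf_lincomb[OF atlas])
  have V: "?V q = (\<lambda>h. \<Sum>j<8. 16 / 7 * xi q (e j q) (e j q) h)" if "q \<in> W" for q
    by (rule sharp_lee_form[OF Wp[OF that] frame[OF that]])
  \<comment> \<open>The axioms of \<open>nab\<close> speak only of smooth fields; smoothness comes
    from the formula for the dual of \<theta> in the smooth frame.\<close>
  have smV: "smooth_vf A W ?V"
  proof (rule smooth_vf_cong[OF atlas])
    show "smooth_vf A W (\<lambda>q h. \<Sum>j<8. 16 / 7 * (1 * nabS q (e j q) (e j) h + (-1) * nab q (e j q) (e j) h))"
      by (rule smooth_vf_sum[OF atlas O]) (use field in auto)
    fix q assume q: "q \<in> W"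
    have "xi q (e j q) (e j q) h = 1 * nabS q (e j q) (e j) h + (-1) * nab q (e j q) (e j) h" if "j < 8" for j h
      using xi_eq[OF q sm[OF that] eT[OF q that], symmetric] by simp
    then show "(\<lambda>h. \<Sum>j<8. 16 / 7 * (1 * nabS q (e j q) (e j) h + (-1) * nab q (e j q) (e j) h)) = ?V q"
      unfolding V[OF q] by simp
  qed
  have comp: "g q (?V q) (e m q) = (\<Sum>j<8. 16 / 7 * xic q (\<lambda>i. e i q) j j m)" if q: "q \<in> W" and m: "m < 8" for q m
    unfolding V[OF q] xic_def
    by (rule metric_sum[OF metric Wp[OF q]]) (use xi_tangent[OF Wp[OF q]] eT[OF q] m in auto)
  note xsm = xic_smooth[OF ad]
  have "g p (nab p (e i p) ?V) (e i p) = 16 / 7 * ((\<Sum>j<8. e i p (\<lambda>q. xic q (\<lambda>i. e i q) j j i))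
      - (\<Sum>m<8. trace8 x m * coef nab e p i i m))" if i: "i < 8" for i
  proof -
    note u = eT[OF W(1) i]
    have s: "smooth_fun A W (\<lambda>q. 16 / 7 * xic q (\<lambda>i. e i q) j j i)" if "j < 8" for j
      using smooth_fun_lincomb[OF atlas xsm[OF that that i] xsm[OF that that i], of "16/7" 0] by simp
    have "e i p (\<lambda>q. g q (?V q) (e i q)) = g p (nab p (e i p) ?V) (e i p) + g p (?V p) (nab p (e i p) (e i))"
      by (rule metric_compatible[OF metric_connections(1) W(1) u smV sm[OF i]])
    moreover have "e i p (\<lambda>q. g q (?V q) (e i q)) = e i p (\<lambda>q. \<Sum>j<8. 16 / 7 * xic q (\<lambda>i. e i q) j j i)"
    proof (rule tangent_local[OF u W(1) metric_smooth[OF metric smV sm[OF i]]])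
      show "smooth_fun A W (\<lambda>q. \<Sum>j<8. 16 / 7 * xic q (\<lambda>i. e i q) j j i)"
        by (rule smooth_fun_sum[OF atlas O]) (use s in auto)
    qed (rule comp[OF _ i])
    moreover have "\<dots> = (\<Sum>j<8. e i p (\<lambda>q. 16 / 7 * xic q (\<lambda>i. e i q) j j i))"
      by (rule tangent_apply_sum[OF atlas u W(1) _ O]) (use s in auto)
    moreover have "\<dots> = (\<Sum>j<8. 16 / 7 * e i p (\<lambda>q. xic q (\<lambda>i. e i q) j j i))"
    proof (rule sum.cong[OF refl])
      fix j :: nat assume "j \<in> {..<8}"
      then have "smooth_at A p (\<lambda>q. xic q (\<lambda>i. e i q) j j i)" using xsm[of j j i] i by (auto intro: smooth_atI[OF _ W(1)])
      then show "e i p (\<lambda>q. 16 / 7 * xic q (\<lambda>i. e i q) j j i) = 16 / 7 * e i p (\<lambda>q. xic q (\<lambda>i. e i q) j j i)"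
        by (rule tangentD(3)[OF u])
    qed
    moreover have "g p (?V p) (nab p (e i p) (e i)) = (\<Sum>m<8. g p (?V p) (e m p) * g p (nab p (e i p) (e i)) (e m p))"
      by (rule metric_parseval[OF frame[OF W(1)] metric p smooth_vfD(3)[OF smV W(1)]
            smooth_vfD(3)[OF connection_field[OF metric_connections(1) ad i i] W(1)]])
    moreover have "\<dots> = (\<Sum>m<8. 16 / 7 * (trace8 x m * coef nab e p i i m))"
    proof (rule sum.cong[OF refl])
      fix m :: nat assume "m \<in> {..<8}"
      then have "g p (?V p) (e m p) = 16 / 7 * trace8 x m"
        unfolding trace8_def x_def sum_distrib_left by (intro comp[OF W(1)]) simp
      then show "g p (?V p) (e m p) * g p (nab p (e i p) (e i)) (e m p) =
          16 / 7 * (trace8 x m * coef nab e p i i m)" by (simp add: coef_def)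
    qed
    ultimately show ?thesis by (simp add: sum_distrib_left right_diff_distrib)
  qed
  then show ?thesis
    unfolding divergence_def frame_at_def e_def[symmetric] by (simp add: sum_distrib_left sum_subtractf right_diff_distrib)
qed

text \<open>The factor 7/16 turns the divergence of the dual of \<theta> into div T.\<close>

lemma scalar_curvatures:
  assumes p: "p \<in> points A"
  defines "x \<equiv> xic p (frame_at A g \<Phi> p)"
  defines "T2 \<equiv> (\<Sum>l<8. (trace8 x l)\<^sup>2)" and "C \<equiv> (\<Sum>i<8. \<Sum>j<8. \<Sum>m<8. x i j m * x j i m)"
  defines "d \<equiv> 7 / 16 * divergence A g \<Phi> nab (sharp A g (lee_form A g \<Phi>)) p"
  shows "scalar_curvature A g \<Phi> nab p = - 8 * d + 8 * T2 - 8 * C"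
    and "scalar_curvature A g \<Phi> nabS p - scalar_curvature A g \<Phi> nab p = 2 * d - T2 + C"
proof -
  define e where "e = adapted_frame A g \<Phi> p"
  obtain W where W: "p \<in> W" "adapted_frame_on A g \<Phi> W e"
    unfolding e_def by (rule adapted_frame_exists[OF p])
  note ad = W(2)
  note sm = adapted_frame_onD(1)[OF ad] and O = adapted_frame_onD(2,3)[OF ad] and frame = adapted_frame_onD(4)[OF ad]
  note eT = orthonormal_frameD(1)[OF frame[OF W(1)]]
  have f: "frame_at A g \<Phi> p = (\<lambda>i. e i p)" by (simp add: frame_at_def e_def fun_eq_iff)
  have x: "x = xic p (\<lambda>i. e i p)" unfolding x_def f ..
  define G where "G = coef nabS e p"
  define dG where "dG i j k l = e i p (\<lambda>q. coef nabS e q j k l)" for i j k l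
  define dx where "dx i j k l = e i p (\<lambda>q. xic q (\<lambda>i. e i q) j k l)" for i j k l
  define c where "c i j m = (G i j m - x i j m) - (G j i m - x j i m)" for i j m
  define RS where "RS i j k l = dG i j k l - dG j i k l + commutator (G i) (G j) k l - (\<Sum>m<8. c i j m * G m k l)" for i j k l
  define R where "R i j k l = (dG i j k l - dx i j k l) - (dG j i k l - dx j i k l) +
      commutator (\<lambda>k l. G i k l - x i k l) (\<lambda>k l. G j k l - x j k l) k l - (\<Sum>m<8. c i j m * (G m k l - x m k l))" for i j k l
  note N = metric_connections
  note xsm = xic_smooth[OF ad]
  have lc_coef: "coef nab e p i j k = G i j k - x i j k" if "i < 8" "j < 8" "k < 8" for i j k
    unfolding G_def x by (rule coef_difference[OF ad W(1) that])
  have dlc: "e i p (\<lambda>q. coef nab e q j k l) = dG i j k l - dx i j k l" if "i < 8" "j < 8" "k < 8" "l < 8" for i j k l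
  proof -
    note u = eT[OF that(1)]
    note s = coef_smooth[OF N(2) ad that(2-4)] and sx = xsm[OF that(2-4)]
    have "e i p (\<lambda>q. coef nab e q j k l) = e i p (\<lambda>q. 1 * coef nabS e q j k l + (-1) * xic q (\<lambda>i. e i q) j k l)"
      by (rule tangent_local[OF u W(1) coef_smooth[OF N(1) ad that(2-4)] smooth_fun_lincomb[OF atlas s sx]])
        (use coef_difference[OF ad _ that(2-4)] in simp)
    also have "\<dots> = 1 * e i p (\<lambda>q. coef nabS e q j k l) + (-1) * e i p (\<lambda>q. xic q (\<lambda>i. e i q) j k l)"
      by (rule tangent_apply_lincomb[OF atlas u smooth_atI[OF s W(1)] smooth_atI[OF sx W(1)]])
    finally show ?thesis by (simp add: dG_def dx_def)
  qed
  have curvR: "R i j k l = g p (curvature A nab (e i) (e j) (e k) p) (e l p)"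
    if "i < 8" "j < 8" "k < 8" "l < 8" for i j k l
  proof -
    have "commutator (coef nab e p i) (coef nab e p j) k l =
        commutator (\<lambda>k l. G i k l - x i k l) (\<lambda>k l. G j k l - x j k l) k l"
      unfolding commutator_def by (rule sum.cong[OF refl]) (use lc_coef that in simp)
    moreover have "(\<Sum>m<8. (coef nab e p i j m - coef nab e p j i m) * coef nab e p m k l) =
        (\<Sum>m<8. c i j m * (G m k l - x m k l))"
      by (rule sum.cong[OF refl]) (use lc_coef that in \<open>simp add: c_def\<close>)
    ultimately show ?thesis
      unfolding curvature_coef[OF N(1) ad W(1) that] R_def
      by (simp add: dlc that)
  qed
  have curvRS: "RS i j k l = g p (curvature A nabS (e i) (e j) (e k) p) (e l p)"
    if "i < 8" "j < 8" "k < 8" "l < 8" for i j k l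
  proof -
    have "(\<Sum>m<8. (coef nab e p i j m - coef nab e p j i m) * coef nabS e p m k l) = (\<Sum>m<8. c i j m * G m k l)"
      by (rule sum.cong[OF refl]) (use lc_coef that in \<open>simp add: c_def G_def\<close>)
    then show ?thesis
      unfolding curvature_coef[OF N(2) ad W(1) that] RS_def by (simp add: dG_def G_def)
  qed
  have G: "skew8 (G i)" if "i < 8" for i unfolding G_def by (rule coef_skew[OF N(2) ad W(1) that])
  have stab: "act (G m) [i, j, k, l] = 0" if "m < 8" "i < 8" "j < 8" "k < 8" "l < 8" for m i j k l
    unfolding G_def by (rule coef_stabilizer[OF ad W(1) that])
  have xeig: "eigen2 6 (x i)" if "i < 8" for i unfolding x by (rule xic_eigen2[OF ad W(1) that])
  have dGeig: "eigen2 (-2) (dG i j)" if "i < 8" "j < 8" for i j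
    unfolding dG_def
  proof (rule eigen2_derivative[OF atlas eT[OF that(1)] W(1) O])
    show "smooth_fun A W (\<lambda>q. coef nabS e q j k l)" if "k < 8" "l < 8" for k l
      by (rule coef_smooth[OF N(2) ad \<open>j < 8\<close> that])
    show "eigen2 (-2) (coef nabS e q j)" if "q \<in> W" for q
      by (rule stabilizer_eigen2[OF coef_skew[OF N(2) ad that \<open>j < 8\<close>] coef_stabilizer[OF ad that \<open>j < 8\<close>]])
  qed
  have dxeig: "eigen2 6 (dx i j)" if "i < 8" "j < 8" for i j
    unfolding dx_def
  proof (rule eigen2_derivative[OF atlas eT[OF that(1)] W(1) O])
    show "smooth_fun A W (\<lambda>q. xic q (\<lambda>i. e i q) j k l)" if "k < 8" "l < 8" for k l
      by (rule xsm[OF \<open>j < 8\<close> that])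
    show "eigen2 6 (xic q (\<lambda>i. e i q) j)" if "q \<in> W" for q
      by (rule xic_eigen2[OF ad that \<open>j < 8\<close>])
  qed
  have d: "d = (\<Sum>i<8. \<Sum>j<8. dx i j j i) - (\<Sum>i<8. \<Sum>m<8. trace8 x m * (G i i m - x i i m))"
  proof -
    have "(\<Sum>i<8. \<Sum>m<8. trace8 x m * coef nab e p i i m) = (\<Sum>i<8. \<Sum>m<8. trace8 x m * (G i i m - x i i m))"
      by (intro sum.cong refl) (use lc_coef in simp)
    then show ?thesis
      unfolding d_def divergence_lee_form[OF p] e_def[symmetric] x[symmetric] by (simp add: dx_def)
  qed
  have sR: "scalar_curvature A g \<Phi> nab p = (\<Sum>i<8. \<Sum>j<8. R i j j i)"
    unfolding scalar_curvature_def e_def[symmetric] Let_def by (intro sum.cong refl) (use curvR in simp)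
  have sRS: "scalar_curvature A g \<Phi> nabS p = (\<Sum>i<8. \<Sum>j<8. RS i j j i)"
    unfolding scalar_curvature_def e_def[symmetric] Let_def by (intro sum.cong refl) (use curvRS in simp)
  note alg = scalar_curvature_algebra[where G = G and x = x and dG = dG and dx = dx and c = c and RS = RS and R = R,
      OF G stab xeig dGeig dxeig c_def RS_def R_def contracted_bianchi[OF ad W(1) curvR]]
  show "scalar_curvature A g \<Phi> nab p = - 8 * d + 8 * T2 - 8 * C"
    unfolding sR d T2_def C_def by (rule alg(1))
  show "scalar_curvature A g \<Phi> nabS p - scalar_curvature A g \<Phi> nab p = 2 * d - T2 + C"
    unfolding sR sRS d T2_def C_def by (rule alg(2))
qed

end

theorem theorem4p5:
  fixes A :: "'m::{t2_space,second_countable_topology} chart set"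
    and g :: "'m metric"
    and \<Phi> :: "'m \<Rightarrow> 'm form"
    and nab nabS :: "'m connection"
    and p :: 'm
  assumes "smooth_atlas A"
    and "riemannian_metric A g"
    and "spin7_structure A g \<Phi>"
    and "levi_civita A g nab"
    and "minimal_spin7_connection A g \<Phi> nab nabS"
    and "p \<in> points A"
  shows "7 * divergence A g \<Phi> nab (sharp A g (lee_form A g \<Phi>)) p =
           8 * (scalar_curvature A g \<Phi> nabS p - scalar_curvature A g \<Phi> nab p)
           + 21 / 8 * form_norm2 A g \<Phi> p (lee_form A g \<Phi> p)
           - 1 / 2 * form_norm2 A g \<Phi> p (component3_48 A g \<Phi> p (codifferential A g \<Phi> \<Phi> p))
       \<and> 7 / 2 * divergence A g \<Phi> nab (sharp A g (lee_form A g \<Phi>)) p =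
           - scalar_curvature A g \<Phi> nab p
           + 21 / 8 * form_norm2 A g \<Phi> p (lee_form A g \<Phi> p)
           - 1 / 2 * form_norm2 A g \<Phi> p (component3_48 A g \<Phi> p (codifferential A g \<Phi> \<Phi> p))"
proof -
  interpret spin7_geometry A g \<Phi> nab nabS
    by unfold_locales (fact assms)+
  \<comment> \<open>As 21/8 * 256/49 - 1/2 * 80/7 = 8, the norms contribute 8 |T|^2 - 8 C to both
    right-hand sides, while 7 times the divergence on the left is 16 div T.\<close>
  note norms = lee_form_norm2[OF assms(6)] component3_48_norm2[OF assms(6)]
  show ?thesis
  proof
    show "7 * divergence A g \<Phi> nab (sharp A g (lee_form A g \<Phi>)) p =
           8 * (scalar_curvature A g \<Phi> nabS p - scalar_curvature A g \<Phi> nab p)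
           + 21 / 8 * form_norm2 A g \<Phi> p (lee_form A g \<Phi> p)
           - 1 / 2 * form_norm2 A g \<Phi> p (component3_48 A g \<Phi> p (codifferential A g \<Phi> \<Phi> p))"
      unfolding scalar_curvatures(2)[OF assms(6)] norms by (simp add: field_simps)
    show "7 / 2 * divergence A g \<Phi> nab (sharp A g (lee_form A g \<Phi>)) p =
           - scalar_curvature A g \<Phi> nab p
           + 21 / 8 * form_norm2 A g \<Phi> p (lee_form A g \<Phi> p)
           - 1 / 2 * form_norm2 A g \<Phi> p (component3_48 A g \<Phi> p (codifferential A g \<Phi> \<Phi> p))"
      unfolding scalar_curvatures(1)[OF assms(6)] norms by (simp add: field_simps)
  qed
qed

end
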